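(* There is a deterministic algorithm for online $O(\Delta(\log\Delta)^2)$-edge-coloring of edge-arrival streams of multigraphs on $n$ vertices with maximum degree $\Delta$, using $O(n\sqrt{\Delta}(\log n)^{2.5}(\log\Delta)^3)$ bits of space and $\widetilde{O}(n\sqrt{\Delta})$ bits of advice. (By picking a uniformly random advice string, the same algorithm can alternatively be used as a robust algorithm with $1/\mathrm{poly}(n)$ error; the advice can also be verified and computed in exponential time.)
   Context: An edge coloring of a multigraph assigns a color to each edge (each parallel copy separately) so that edges sharing an endpoint get distinct colors; a $k$-edge-coloring uses at most $k$ colors. The vertex set and $\Delta$ are known in advance. In an edge-arrival stream, the edges (possibly repeated) are presented one at a time in adversarial order; an online algorithm must irrevocably output each edge's color when it arrives. Advice is a fixed read-only string depending only on $n$ and $\Delta$ (not on the input), not counted toward space. A robust algorithm succeeds with the stated probability even against an adaptive adversary that chooses each next edge after seeing all previous outputs. Logarithms are base 2; $\widetilde{O}(x)$ hides factors polylogarithmic in $n$ and $\Delta$. *)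

theory Defs
  imports "HOL-Probability.Probability" "HOL-Library.Log_Nat"
begin

section \<open>Edge streams and edge colorings\<close>

text \<open>The vertices are \<open>0, \<dots>, n - 1\<close>. A stream is a list of edges. An edge is an unordered pair of
  distinct vertices, presented in either orientation; parallel edges are repeated list entries.\<close>

type_synonym edge = "nat \<times> nat"

definition ends :: "edge \<Rightarrow> nat set" where
  "ends e = {fst e, snd e}"

definition degree :: "edge list \<Rightarrow> nat \<Rightarrow> nat" where
  "degree es x = length (filter (\<lambda>e. x \<in> ends e) es)"

definition edge_stream :: "nat \<Rightarrow> nat \<Rightarrow> edge list \<Rightarrow> bool" where
  "edge_stream n \<Delta> es \<longleftrightarrow>
     (\<forall>(u, v) \<in> set es. u < n \<and> v < n \<and> u \<noteq> v) \<and> (\<forall>x<n. degree es x \<le> \<Delta>)"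

text \<open>\<open>cs ! i\<close> is the color of the edge \<open>es ! i\<close>.\<close>

definition edge_coloring :: "nat \<Rightarrow> edge list \<Rightarrow> nat list \<Rightarrow> bool" where
  "edge_coloring k es cs \<longleftrightarrow>
     length cs = length es \<and>
     (\<forall>i j. i < j \<and> j < length es \<and> ends (es ! i) \<inter> ends (es ! j) \<noteq> {} \<longrightarrow> cs ! i \<noteq> cs ! j) \<and>
     card (set cs) \<le> k"


section \<open>Model of computation\<close>

text \<open>
  A program is a fixed (uniform) structured program for a random-access machine. It has read-only
  numeric inputs, a read-only bit string (the advice), a read-write memory of cells indexed from 0,
  each holding a natural number, and a write-only output. Time and space follow the logarithmic
  cost criterion: operating on a number costs its number of bits.
\<close>

datatype binop = Plus | Minus | Times | Div | Mod | Less | Equal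

datatype expr =
    Const nat
  | Input nat
  | Advice expr
  | Load expr
  | Op binop expr expr

datatype prog =
    Skip
  | Store expr expr
  | Emit expr
  | Seq prog prog
  | If expr prog prog
  | While expr prog

type_synonym env = "nat list \<times> bool list"
type_synonym memory = "nat list"

definition lookup :: "nat list \<Rightarrow> nat \<Rightarrow> nat" where
  "lookup xs i = (if i < length xs then xs ! i else 0)"

text \<open>Cells never written to hold 0; writing beyond the end of the memory extends it.\<close>

definition update :: "memory \<Rightarrow> nat \<Rightarrow> nat \<Rightarrow> memory" where
  "update \<mu> a x =
     (if a < length \<mu> then \<mu>[a := x] else \<mu> @ replicate (a - length \<mu>) 0 @ [x])"

fun binop_val :: "binop \<Rightarrow> nat \<Rightarrow> nat \<Rightarrow> nat" where
  "binop_val Plus x y = x + y"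
| "binop_val Minus x y = x - y"
| "binop_val Times x y = x * y"
| "binop_val Div x y = x div y"
| "binop_val Mod x y = x mod y"
| "binop_val Less x y = of_bool (x < y)"
| "binop_val Equal x y = of_bool (x = y)"

fun val :: "env \<Rightarrow> memory \<Rightarrow> expr \<Rightarrow> nat" where
  "val \<epsilon> \<mu> (Const c) = c"
| "val \<epsilon> \<mu> (Input i) = lookup (fst \<epsilon>) i"
| "val \<epsilon> \<mu> (Advice e) = lookup (map of_bool (snd \<epsilon>)) (val \<epsilon> \<mu> e)"
| "val \<epsilon> \<mu> (Load e) = lookup \<mu> (val \<epsilon> \<mu> e)"
| "val \<epsilon> \<mu> (Op f e1 e2) = binop_val f (val \<epsilon> \<mu> e1) (val \<epsilon> \<mu> e2)"

text \<open>\<open>floorlog 2 x\<close> is the length of the binary representation of \<open>x\<close>. The additional 1 accounts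
  for the delimiters of an actual bit encoding and for zeros.\<close>

abbreviation bits :: "nat \<Rightarrow> nat" where
  "bits x \<equiv> floorlog 2 x + 1"

text \<open>The total size of all values arising in the evaluation of an expression. It is charged both as
  time and as temporary space.\<close>

fun cost :: "env \<Rightarrow> memory \<Rightarrow> expr \<Rightarrow> nat" where
  "cost \<epsilon> \<mu> (Const c) = bits c"
| "cost \<epsilon> \<mu> (Input i) = bits (val \<epsilon> \<mu> (Input i))"
| "cost \<epsilon> \<mu> (Advice e) = cost \<epsilon> \<mu> e + bits (val \<epsilon> \<mu> (Advice e))"
| "cost \<epsilon> \<mu> (Load e) = cost \<epsilon> \<mu> e + bits (val \<epsilon> \<mu> (Load e))"
| "cost \<epsilon> \<mu> (Op f e1 e2) = cost \<epsilon> \<mu> e1 + cost \<epsilon> \<mu> e2 + bits (val \<epsilon> \<mu> (Op f e1 e2))"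

definition footprint :: "memory \<Rightarrow> nat" where
  "footprint \<mu> = (\<Sum>x\<leftarrow>\<mu>. bits x)"

text \<open>\<open>exec \<epsilon> p \<mu> t s out \<mu>'\<close>: started in memory \<open>\<mu>\<close>, the program \<open>p\<close> halts after time \<open>t\<close> in memory
  \<open>\<mu>'\<close>, with peak space usage \<open>s\<close> (in bits), having written \<open>out\<close>.\<close>

inductive exec :: "env \<Rightarrow> prog \<Rightarrow> memory \<Rightarrow> nat \<Rightarrow> nat \<Rightarrow> nat list \<Rightarrow> memory \<Rightarrow> bool" for \<epsilon> where
  Skip: "exec \<epsilon> Skip \<mu> 1 (footprint \<mu>) [] \<mu>"
| Store: "\<lbrakk>c = cost \<epsilon> \<mu> e1 + cost \<epsilon> \<mu> e2; \<mu>' = update \<mu> (val \<epsilon> \<mu> e1) (val \<epsilon> \<mu> e2)\<rbrakk>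
    \<Longrightarrow> exec \<epsilon> (Store e1 e2) \<mu> (1 + c) (max (footprint \<mu> + c) (footprint \<mu>')) [] \<mu>'"
| Emit: "c = cost \<epsilon> \<mu> e \<Longrightarrow> exec \<epsilon> (Emit e) \<mu> (1 + c) (footprint \<mu> + c) [val \<epsilon> \<mu> e] \<mu>"
| Seq: "\<lbrakk>exec \<epsilon> p1 \<mu> t1 s1 out1 \<mu>1; exec \<epsilon> p2 \<mu>1 t2 s2 out2 \<mu>2\<rbrakk>
    \<Longrightarrow> exec \<epsilon> (Seq p1 p2) \<mu> (t1 + t2) (max s1 s2) (out1 @ out2) \<mu>2"
| If: "\<lbrakk>c = cost \<epsilon> \<mu> e; exec \<epsilon> (if val \<epsilon> \<mu> e \<noteq> 0 then p1 else p2) \<mu> t s out \<mu>'\<rbrakk>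
    \<Longrightarrow> exec \<epsilon> (If e p1 p2) \<mu> (1 + c + t) (max (footprint \<mu> + c) s) out \<mu>'"
| WhileF: "\<lbrakk>val \<epsilon> \<mu> e = 0; c = cost \<epsilon> \<mu> e\<rbrakk>
    \<Longrightarrow> exec \<epsilon> (While e p) \<mu> (1 + c) (footprint \<mu> + c) [] \<mu>"
| WhileT: "\<lbrakk>val \<epsilon> \<mu> e \<noteq> 0; c = cost \<epsilon> \<mu> e;
      exec \<epsilon> p \<mu> t1 s1 out1 \<mu>1; exec \<epsilon> (While e p) \<mu>1 t2 s2 out2 \<mu>2\<rbrakk>
    \<Longrightarrow> exec \<epsilon> (While e p) \<mu> (1 + c + t1 + t2) (max (footprint \<mu> + c) (max s1 s2)) (out1 @ out2) \<mu>2"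

text \<open>The program \<open>p\<close>, started in the empty memory, halts within time \<open>T\<close> with output \<open>out\<close>.\<close>

definition computes_within :: "prog \<Rightarrow> env \<Rightarrow> nat \<Rightarrow> nat list \<Rightarrow> bool" where
  "computes_within p \<epsilon> T out \<longleftrightarrow> (\<exists>t s \<mu>. exec \<epsilon> p [] t s out \<mu> \<and> t \<le> T)"


section \<open>Online streaming algorithms with advice\<close>

text \<open>An online algorithm consists of an initialization program and a program that is run on the
  arrival of each edge and has to output exactly one number, the color of that edge. The memory is
  the only thing that is retained from one arrival to the next. The space includes the working
  space of the individual program runs, but not the read-only inputs and advice.\<close>

type_synonym algorithm = "prog \<times> prog"

inductive online_run ::
  "algorithm \<Rightarrow> nat \<Rightarrow> nat \<Rightarrow> bool list \<Rightarrow> edge list \<Rightarrow> nat list \<Rightarrow> memory \<Rightarrow> nat \<Rightarrow> bool"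
  for A n \<Delta> z where
  Start: "exec ([n, \<Delta>], z) (fst A) [] t s [] \<mu> \<Longrightarrow> online_run A n \<Delta> z [] [] \<mu> s"
| Arrival: "\<lbrakk>online_run A n \<Delta> z es cs \<mu> s; exec ([n, \<Delta>, u, v], z) (snd A) \<mu> t s' [c] \<mu>'\<rbrakk>
    \<Longrightarrow> online_run A n \<Delta> z (es @ [(u, v)]) (cs @ [c]) \<mu>' (max s s')"

definition runs_in_space :: "algorithm \<Rightarrow> nat \<Rightarrow> nat \<Rightarrow> bool list \<Rightarrow> nat \<Rightarrow> bool" where
  "runs_in_space A n \<Delta> z S \<longleftrightarrow>
     (\<forall>es. edge_stream n \<Delta> es \<longrightarrow> (\<exists>cs \<mu> s. online_run A n \<Delta> z es cs \<mu> s \<and> s \<le> S))"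

definition colors_stream ::
  "algorithm \<Rightarrow> nat \<Rightarrow> nat \<Rightarrow> bool list \<Rightarrow> nat \<Rightarrow> edge list \<Rightarrow> bool" where
  "colors_stream A n \<Delta> z k es \<longleftrightarrow>
     (\<exists>cs \<mu> s. online_run A n \<Delta> z es cs \<mu> s \<and> edge_coloring k es cs)"

definition good_advice :: "algorithm \<Rightarrow> nat \<Rightarrow> nat \<Rightarrow> nat \<Rightarrow> bool list \<Rightarrow> bool" where
  "good_advice A n \<Delta> k z \<longleftrightarrow> (\<forall>es. edge_stream n \<Delta> es \<longrightarrow> colors_stream A n \<Delta> z k es)"


section \<open>Adaptive adversaries\<close>

text \<open>An adaptive adversary maps the sequence of all previous outputs to the next edge, or to \<open>None\<close>
  to stop.\<close>

type_synonym adversary = "nat list \<Rightarrow> edge option"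

text \<open>\<open>es\<close> is an initial part of the stream that arises when \<open>\<A>\<close> plays against \<open>A\<close> with
  advice \<open>z\<close>.\<close>

definition generated_by ::
  "adversary \<Rightarrow> algorithm \<Rightarrow> nat \<Rightarrow> nat \<Rightarrow> bool list \<Rightarrow> edge list \<Rightarrow> bool" where
  "generated_by \<A> A n \<Delta> z es \<longleftrightarrow>
     (\<forall>i<length es. \<exists>cs \<mu> s. online_run A n \<Delta> z (take i es) cs \<mu> s \<and> \<A> cs = Some (es ! i))"

text \<open>Restricting attention to valid streams means that the adversary forfeits the game as soon as it
  presents an invalid edge or exceeds the degree bound.\<close>

definition succeeds_against ::
  "algorithm \<Rightarrow> nat \<Rightarrow> nat \<Rightarrow> nat \<Rightarrow> adversary \<Rightarrow> bool list \<Rightarrow> bool" where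
  "succeeds_against A n \<Delta> k \<A> z \<longleftrightarrow>
     (\<forall>es. edge_stream n \<Delta> es \<and> generated_by \<A> A n \<Delta> z es \<longrightarrow> colors_stream A n \<Delta> z k es)"

text \<open>Success probability at least \<open>1 - \<delta>\<close> against every adaptive adversary, if the advice is
  replaced by a uniformly random string of \<open>a\<close> bits that the adversary does not see. Randomized
  adversaries are mixtures of the deterministic ones considered here.\<close>

definition robust ::
  "algorithm \<Rightarrow> nat \<Rightarrow> nat \<Rightarrow> nat \<Rightarrow> nat \<Rightarrow> real \<Rightarrow> bool" where
  "robust A n \<Delta> k a \<delta> \<longleftrightarrow>
     (\<forall>\<A>. measure_pmf.prob (pmf_of_set {z. length z = a}) {z. succeeds_against A n \<Delta> k \<A> z}
        \<ge> 1 - \<delta>)"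

end

theory Submission
  imports Defs
begin

text \<open>Time is unrestricted, so on every arrival the algorithm can recompute by exhaustive search the
  table \<open>h\<close> that would naturally be its advice. The advice is therefore empty, the two programs for
  it are trivial, and the algorithm, being deterministic and always correct, is robust.

  At level \<open>j\<close> the life of a vertex is cut into \<open>2 ^ (I - j)\<close> epochs by its current degree. A vertex
  \<open>v\<close> in epoch \<open>e\<close> has the residue \<open>h v r + e\<close> in row \<open>r\<close>. An edge is directed from its tail to its
  head, and a row in which the residues of the two agree, that of the head shifted by half the modulus,
  can be reserved for this pair, which gives it a bundle of \<open>8 * 4 ^ j\<close> colors. A vertex has different
  residues in different epochs and roles, so no other pair uses these colors at the same vertex. So
  only the last epoch in which a row was used is recorded, in place of the set of used colors, and
  the number of rows, about \<open>sqrt \<Delta>\<close>, determines the space.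

  A pair that finds most of its rows in use at the tail moves to the next phase, with fresh rows. By
  the choice of \<open>h\<close> each phase loses all but a fraction 1/32 of the pairs, so \<open>log \<Delta>\<close> phases suffice.
  A pair that is blocked at the head or has exhausted its bundle moves to the next level with the
  roles of tail and head exchanged and with half as many epochs; the number of pairs of an epoch
  halves with every level. At the last level, the remaining few pairs are served greedily.\<close>

section \<open>Compiling arithmetic terms to space-bounded programs\<close>

text \<open>The obstacle is a circularity: the table limits the number of blocked pairs only while
  few rows are in use, but few rows are in use only if few pairs were passed on. Induction over the
  levels breaks it, and the exchange of roles keeps the constants from growing. The pairs leaving a
  level are few per head, whereas per tail there is only the trivial bound by all its pairs; after
  the exchange the good bound belongs to the new tails, and the trivial one is not carried further.
  \<open>K\<close> is logarithmic because in the union bound each blocked partner has to pay for 32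
  rows in use. \<open>I\<close> is chosen so that, unless \<open>I = 0\<close>,
  \<open>4 ^ I * K\<close> is of order \<Delta>; hence the rows of all levels, at most about
  \<open>4 * K * 2 ^ I\<close>, are of order \<open>sqrt (\<Delta> * K)\<close>, and every level
  below the last has \<open>32 * 4 ^ I * K\<close> colors per phase, again of order \<Delta>. A
  candidate table is one number of about \<open>n * 2 ^ I * K\<close> bits up to logarithmic
  factors. It fits into the space bound, so the search can hold it in a single cell. This is why
  programs are handled through terms whose values may be huge but of controlled length.\<close>

datatype tm = TN nat | TX nat | TI nat | TA tm | TB binop tm tm | TS nat tm tm | TP tm

text \<open>Exponents are capped by variable 0, so that the sizes of all values are bounded independently of
  the contents of the persistent array \<open>a\<close>.\<close>

primrec ev :: "nat list \<Rightarrow> (nat \<Rightarrow> nat) \<Rightarrow> tm \<Rightarrow> (nat \<Rightarrow> nat) \<Rightarrow> nat" where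
  "ev q a (TN c) s = c"
| "ev q a (TX x) s = s x"
| "ev q a (TI i) s = lookup q i"
| "ev q a (TA t) s = a (ev q a t s)"
| "ev q a (TB f t1 t2) s = binop_val f (ev q a t1 s) (ev q a t2 s)"
| "ev q a (TS x b t) s = (\<Sum>i<ev q a b s. ev q a t (s(x := i)))"
| "ev q a (TP t) s = 2 ^ min (ev q a t s) (s 0)"

abbreviation cell :: "nat \<Rightarrow> expr" where "cell k \<equiv> Load (Const k)"
abbreviation set_cell :: "nat \<Rightarrow> expr \<Rightarrow> prog" where "set_cell k \<equiv> Store (Const k)"

text \<open>Cells below \<open>bs\<close> hold variables and, from \<open>k\<close> on, the evaluation stack; the persistent
  array starts at cell \<open>bs\<close>.\<close>

primrec comp :: "nat \<Rightarrow> tm \<Rightarrow> nat \<Rightarrow> prog" where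
  "comp bs (TN c) k = set_cell k (Const c)"
| "comp bs (TX x) k = set_cell k (cell x)"
| "comp bs (TI i) k = set_cell k (Input i)"
| "comp bs (TA t) k = Seq (comp bs t k) (set_cell k (Load (Op Plus (Const bs) (cell k))))"
| "comp bs (TB f t1 t2) k =
     Seq (comp bs t1 k) (Seq (comp bs t2 (k + 1)) (set_cell k (Op f (cell k) (cell (k + 1)))))"
| "comp bs (TS x b t) k =
     Seq (comp bs b k) (Seq (set_cell (k + 1) (cell x)) (Seq (set_cell (k + 2) (Const 0))
       (Seq (set_cell x (Const 0))
       (Seq (While (Op Less (cell x) (cell k))
          (Seq (comp bs t (k + 3)) (Seq (set_cell (k + 2) (Op Plus (cell (k + 2)) (cell (k + 3))))
             (set_cell x (Op Plus (cell x) (Const 1))))))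
       (Seq (set_cell x (cell (k + 1))) (set_cell k (cell (k + 2))))))))"
| "comp bs (TP t) k =
     Seq (comp bs t k) (Seq (set_cell (k + 1) (Const 0)) (Seq (set_cell (k + 2) (Const 1))
       (Seq (While (Op Times (Op Less (cell (k + 1)) (cell k)) (Op Less (cell (k + 1)) (cell 0)))
          (Seq (set_cell (k + 2) (Op Plus (cell (k + 2)) (cell (k + 2))))
             (set_cell (k + 1) (Op Plus (cell (k + 1)) (Const 1)))))
       (set_cell k (cell (k + 2))))))"

primrec dep :: "tm \<Rightarrow> nat" where
  "dep (TN c) = 1" | "dep (TX x) = 1" | "dep (TI i) = 1" | "dep (TA t) = dep t"
| "dep (TB f t1 t2) = max (dep t1) (1 + dep t2)"
| "dep (TS x b t) = max (dep b) (3 + dep t)"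
| "dep (TP t) = max (dep t) 3"

primrec mv :: "tm \<Rightarrow> nat" where
  "mv (TN c) = 1" | "mv (TX x) = Suc x" | "mv (TI i) = 1" | "mv (TA t) = mv t"
| "mv (TB f t1 t2) = max (mv t1) (mv t2)"
| "mv (TS x b t) = max (Suc x) (max (mv b) (mv t))"
| "mv (TP t) = mv t"

primrec wf_tm :: "tm \<Rightarrow> bool" where
  "wf_tm (TN c) = True" | "wf_tm (TX x) = True" | "wf_tm (TI i) = True" | "wf_tm (TA t) = wf_tm t"
| "wf_tm (TB f t1 t2) = (wf_tm t1 \<and> wf_tm t2)"
| "wf_tm (TS x b t) = (x \<noteq> 0 \<and> wf_tm b \<and> wf_tm t)"
| "wf_tm (TP t) = wf_tm t"

text \<open>If every variable \<open>x\<close> is below \<open>2 ^ (G * w x)\<close>, then the value of \<open>t\<close> is below \<open>2 ^ (G * wt t w)\<close> and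
  all intermediate values are below \<open>2 ^ (G * pk t w)\<close>.\<close>

primrec wt :: "tm \<Rightarrow> (nat \<Rightarrow> nat) \<Rightarrow> nat" where
  "wt (TN c) w = Suc c" | "wt (TX x) w = w x" | "wt (TI i) w = 1" | "wt (TA t) w = 1"
| "wt (TB f t1 t2) w = wt t1 w + wt t2 w"
| "wt (TS x b t) w = wt b w + wt t (w(x := wt b w))"
| "wt (TP t) w = 2"

primrec pk :: "tm \<Rightarrow> (nat \<Rightarrow> nat) \<Rightarrow> nat" where
  "pk (TN c) w = Suc c" | "pk (TX x) w = w x" | "pk (TI i) w = 1" | "pk (TA t) w = max (pk t w) 1"
| "pk (TB f t1 t2) w = max (wt t1 w + wt t2 w) (max (pk t1 w) (pk t2 w))"
| "pk (TS x b t) w =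
     max (w x) (max (wt b w + wt t (w(x := wt b w))) (max (pk b w) (pk t (w(x := wt b w)))))"
| "pk (TP t) w = max (pk t w) 2"

lemma dep_pos: "dep t \<ge> 1" and mv_pos: "mv t \<ge> 1"
  by (induction t) auto

lemma wt_pos: "(\<And>x. w x \<ge> 1) \<Longrightarrow> wt t w \<ge> 1"
  by (induction t arbitrary: w) (auto simp: add_increasing2)

lemma pk_ge_wt: "wt t w \<le> pk t w"
  by (cases t) auto

lemma sum_lt_power2:
  fixes b m p q :: nat
  assumes "b < 2 ^ p" "\<And>i. i < b \<Longrightarrow> f i < 2 ^ q" "m \<le> b"
  shows "(\<Sum>i<m. f i) < (2::nat) ^ (p + q)"
proof (cases "m = 0")
  case False
  have "(\<Sum>i<m. f i) \<le> (\<Sum>i<m. 2 ^ q)"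
    using assms by (intro sum_mono less_imp_le) auto
  also have "\<dots> = m * 2 ^ q" by simp
  also have "\<dots> < 2 ^ p * 2 ^ q" using assms by (intro mult_strict_right_mono) auto
  finally show ?thesis by (simp add: power_add)
qed simp

text \<open>Adding the exponents is forced by products; sums fit because both exponents are
  positive. One bound for all operations keeps \<open>wt\<close> independent of the
  operation.\<close>

lemma binop_lt_power2:
  assumes "x < 2 ^ p" "y < 2 ^ q" "p \<ge> 1" "q \<ge> 1"
  shows "binop_val f x y < 2 ^ (p + q)"
proof -
  have 1: "(2::nat) ^ p \<le> 2 ^ (p + q)" by (rule power_increasing) auto
  have 2: "(2::nat) ^ 1 \<le> 2 ^ p" "(2::nat) ^ 1 \<le> 2 ^ q" using assms by (intro power_increasing; simp)+
  have "x + y < 2 ^ p + 2 ^ q" using assms by simp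
  \<comment> \<open>Both powers are at least 2, so \<open>(2 ^ p - 1) * (2 ^ q - 1) \<ge> 1\<close>,
    which rearranges to the claim; integers avoid truncated subtraction.\<close>
  also have "\<dots> \<le> 2 ^ p * 2 ^ q"
  proof -
    have "0 \<le> (int (2 ^ p) - 1) * (int (2 ^ q) - 1) - 1"
    proof -
      have "1 * 1 \<le> (int (2 ^ p) - 1) * (int (2 ^ q) - 1)"
        using 2 by (intro mult_mono) (simp_all flip: of_nat_power)
      thus ?thesis by simp
    qed
    hence "int (2 ^ p + 2 ^ q) \<le> int (2 ^ p * 2 ^ q)" by (simp add: algebra_simps)
    thus ?thesis by (simp only: of_nat_le_iff)
  qed
  finally have 3: "x + y < 2 ^ (p + q)" by (simp add: power_add)
  have 4: "x * y < 2 ^ (p + q)" unfolding power_add using assms by (intro mult_strict_mono) auto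
  have 5: "x div y < 2 ^ (p + q)" "x mod y < 2 ^ (p + q)" "x - y < 2 ^ (p + q)"
    using 1 assms(1) div_le_dividend[of x y] mod_less_eq_dividend[of x y] by linarith+
  have 6: "of_bool b < (2::nat) ^ (p + q)" for b
    using one_less_power[of "2::nat" "p + q"] assms(3) by (cases b) auto
  show ?thesis using 3 4 5 6 by (cases f) auto
qed

locale bounded_inputs =
  fixes q :: "nat list" and a :: "nat \<Rightarrow> nat" and G :: nat
  assumes G: "G \<ge> 1" and inp_G: "\<And>i. lookup q i < 2 ^ G" and arr_G: "\<And>i. a i < 2 ^ G"
begin

lemma ev_lt:
  assumes "\<And>x. s x < 2 ^ (G * w x)" "\<And>x. w x \<ge> 1" "s 0 \<le> G" "wf_tm t"
  shows "ev q a t s < 2 ^ (G * wt t w)"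
  using assms
proof (induction t arbitrary: s w)
  case (TN c)
  have "c < 2 ^ c" by (rule less_exp)
  also have "\<dots> \<le> (2::nat) ^ (G * Suc c)"
    using mult_le_mono1[OF G, of "Suc c"] by (intro power_increasing) auto
  finally show ?case by simp
next
  case (TB f t1 t2)
  have "ev q a t1 s < 2 ^ (G * wt t1 w)" "ev q a t2 s < 2 ^ (G * wt t2 w)"
    using TB by simp_all
  moreover have "G * wt t1 w \<ge> 1" "G * wt t2 w \<ge> 1"
    using G wt_pos[OF TB.prems(2)] by (simp_all add: Suc_le_eq)
  ultimately show ?case using binop_lt_power2 by (simp add: distrib_left)
next
  case (TS x b t)
  have b: "ev q a b s < 2 ^ (G * wt b w)" using TS by simp
  have "ev q a t (s(x := i)) < 2 ^ (G * wt t (w(x := wt b w)))" if "i < ev q a b s" for i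
    using TS.prems that b wt_pos[of w b] by (intro TS.IH(2)) (auto simp: Suc_le_eq)
  from sum_lt_power2[OF b this order_refl] show ?case by (simp add: distrib_left)
next
  case (TP t)
  \<comment> \<open>The cap keeps the exponent at most \<open>G\<close>; weight 2 instead of 1 makes
    the bound strict.\<close>
  have "(2::nat) ^ min (ev q a t s) (s 0) \<le> 2 ^ G" using TP by (intro power_increasing) auto
  also have "\<dots> < 2 ^ (G * 2)" using G by (intro power_strict_increasing) auto
  finally show ?case by simp
qed (use inp_G arr_G in auto)

end

section \<open>Space-bounded executions and the memory layout\<close>

definition runs :: "env \<Rightarrow> prog \<Rightarrow> memory \<Rightarrow> nat \<Rightarrow> nat list \<Rightarrow> memory \<Rightarrow> bool" where
  "runs \<epsilon> p \<mu> S out \<mu>' \<longleftrightarrow> (\<exists>t s. exec \<epsilon> p \<mu> t s out \<mu>' \<and> s \<le> S)"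

lemma runs_Seq:
  "runs \<epsilon> p1 \<mu> S o1 \<mu>1 \<Longrightarrow> runs \<epsilon> p2 \<mu>1 S o2 \<mu>2 \<Longrightarrow> runs \<epsilon> (Seq p1 p2) \<mu> S (o1 @ o2) \<mu>2"
  unfolding runs_def by (blast intro: exec.Seq max.boundedI)

lemma runs_Seq0:
  "runs \<epsilon> p1 \<mu> S [] \<mu>1 \<Longrightarrow> runs \<epsilon> p2 \<mu>1 S out \<mu>2 \<Longrightarrow> runs \<epsilon> (Seq p1 p2) \<mu> S out \<mu>2"
  using runs_Seq[of \<epsilon> p1 \<mu> S "[]" \<mu>1 p2 out \<mu>2] by simp

lemma runs_WhileF:
  "val \<epsilon> \<mu> e = 0 \<Longrightarrow> footprint \<mu> + cost \<epsilon> \<mu> e \<le> S \<Longrightarrow> runs \<epsilon> (While e p) \<mu> S [] \<mu>"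
  unfolding runs_def by (blast intro: exec.WhileF)

lemma runs_WhileT:
  assumes "val \<epsilon> \<mu> e \<noteq> 0" "footprint \<mu> + cost \<epsilon> \<mu> e \<le> S"
    "runs \<epsilon> p \<mu> S [] \<mu>1" "runs \<epsilon> (While e p) \<mu>1 S [] \<mu>2"
  shows "runs \<epsilon> (While e p) \<mu> S [] \<mu>2"
proof -
  obtain t1 s1 where 1: "exec \<epsilon> p \<mu> t1 s1 [] \<mu>1" "s1 \<le> S" using assms(3) by (auto simp: runs_def)
  obtain t2 s2 where 2: "exec \<epsilon> (While e p) \<mu>1 t2 s2 [] \<mu>2" "s2 \<le> S"
    using assms(4) by (auto simp: runs_def)
  from exec.WhileT[OF assms(1) refl 1(1) 2(1)] show ?thesis
    unfolding runs_def append_Nil using 1(2) 2(2) assms(2) by (meson max.boundedI)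
qed

lemma lookup_update [simp]: "lookup (update \<mu> i x) = (lookup \<mu>)(i := x)"
  by (rule ext) (auto simp: lookup_def update_def nth_append)

lemma length_update: "length (update \<mu> i x) = max (length \<mu>) (Suc i)"
  by (auto simp: update_def)

lemma bits_le: "x < 2 ^ V \<Longrightarrow> bits x \<le> V + 1"
  by (simp add: floorlog_le_iff)

lemma footprint_le:
  assumes "length \<mu> \<le> bs + m" "\<And>i. i < bs \<Longrightarrow> lookup \<mu> i < 2 ^ V"
    "\<And>i. bs \<le> i \<Longrightarrow> lookup \<mu> i < 2 ^ W"
  shows "footprint \<mu> \<le> bs * (V + 1) + m * (W + 1)"
proof -
  have "footprint \<mu> = (\<Sum>i<length \<mu>. bits (lookup \<mu> i))"
    unfolding footprint_def sum_list_sum_nth by (simp add: lookup_def atLeast0LessThan)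
  also have "\<dots> \<le> (\<Sum>i<bs + m. bits (lookup \<mu> i))"
    using assms(1) by (intro sum_mono2) auto
  also have "\<dots> \<le> (\<Sum>i<bs + m. if i < bs then V + 1 else W + 1)"
    using assms bits_le by (intro sum_mono) auto
  also have "\<dots> = (\<Sum>i\<in>{..<bs + m} \<inter> {..<bs}. V + 1) + (\<Sum>i\<in>{..<bs + m} \<inter> - {..<bs}. W + 1)"
    by (subst sum.If_cases) (simp_all add: lessThan_def)
  also have "{..<bs + m} \<inter> {..<bs} = {..<bs}" by auto
  also have "{..<bs + m} \<inter> - {..<bs} = {bs..<bs + m}" by auto
  finally show ?thesis by simp
qed


definition mrep :: "nat \<Rightarrow> nat \<Rightarrow> nat \<Rightarrow> (nat \<Rightarrow> nat) \<Rightarrow> (nat \<Rightarrow> nat) \<Rightarrow> memory \<Rightarrow> bool" where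
  "mrep bs V m a f \<mu> \<longleftrightarrow> (\<forall>i<bs. lookup \<mu> i = f i \<and> f i < 2 ^ V) \<and> (\<forall>i. lookup \<mu> (bs + i) = a i) \<and>
     length \<mu> \<le> bs + m"

text \<open>The terms pay for variables and stack, for the persistent array, and for the temporary
  values of one primitive expression, whose cost never exceeds \<open>12 * (V + 1)\<close>. The long
  values of \<open>V\<close> bits thus occur only a constant number of times.\<close>

definition Smax :: "nat \<Rightarrow> nat \<Rightarrow> nat \<Rightarrow> nat \<Rightarrow> nat" where
  "Smax bs V W m = bs * (V + 1) + m * (W + 1) + 12 * (V + 1)"

lemma mrep_footprint:
  assumes r: "mrep bs V m a f \<mu>" and "\<And>i. a i < 2 ^ W"
  shows "footprint \<mu> + 12 * (V + 1) \<le> Smax bs V W m"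
proof -
  have "lookup \<mu> i < 2 ^ W" if "bs \<le> i" for i
    using r assms(2)[of "i - bs"] that unfolding mrep_def by (metis le_add_diff_inverse)
  thus ?thesis using footprint_le[of \<mu> bs m V W] r by (simp add: mrep_def Smax_def)
qed

text \<open>Array entries obey two bounds: the coarse \<open>G\<close> suffices for values of terms,
  while the finer \<open>W\<close> is what the footprint of the array is charged with.\<close>

locale machine = bounded_inputs +
  fixes z :: "bool list" and bs V W m :: nat
  assumes arr_W: "\<And>i. a i < 2 ^ W" and bs_V: "bs \<le> V"
begin

abbreviation rep :: "(nat \<Rightarrow> nat) \<Rightarrow> memory \<Rightarrow> bool" where "rep \<equiv> mrep bs V m a"
abbreviation S0 :: nat where "S0 \<equiv> Smax bs V W m"

lemmas rep_def = mrep_def[of bs V m a]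
lemmas rep_footprint = mrep_footprint[OF _ arr_W]

lemma bits_const: "k \<le> bs \<Longrightarrow> bits k \<le> V + 1"
proof -
  assume "k \<le> bs"
  hence "k < 2 ^ V" using bs_V less_exp[of V] by linarith
  thus ?thesis by (rule bits_le)
qed

lemma rep_cell:
  assumes "rep f \<mu>" "i < bs"
  shows "val (q, z) \<mu> (cell i) = f i" "cost (q, z) \<mu> (cell i) \<le> 2 * (V + 1)" "f i < 2 ^ V"
  using assms bits_const[of i] bits_le[of "f i" V] by (simp_all add: rep_def)

text \<open>A total-correctness triple that includes the space bound. Writes to the array are kept
  out of it, so that \<open>rep\<close> can stay fixed during a whole evaluation.\<close>

definition trP :: "prog \<Rightarrow> (nat \<Rightarrow> nat) \<Rightarrow> ((nat \<Rightarrow> nat) \<Rightarrow> bool) \<Rightarrow> bool" where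
  "trP p f Q \<longleftrightarrow> (\<forall>\<mu>. rep f \<mu> \<longrightarrow> (\<exists>\<mu>' f'. runs (q, z) p \<mu> S0 [] \<mu>' \<and> rep f' \<mu>' \<and> Q f'))"

lemma trP_Seq: "trP p1 f Q \<Longrightarrow> (\<And>f'. Q f' \<Longrightarrow> trP p2 f' P) \<Longrightarrow> trP (Seq p1 p2) f P"
  unfolding trP_def by (meson runs_Seq0)

lemma trP_set:
  assumes "k < bs" and e: "\<And>\<mu>. rep f \<mu> \<Longrightarrow> val (q, z) \<mu> e = x"
    "\<And>\<mu>. rep f \<mu> \<Longrightarrow> cost (q, z) \<mu> e \<le> 10 * (V + 1)" and x: "x < 2 ^ V" and P: "P (f(k := x))"
  shows "trP (set_cell k e) f P"
  unfolding trP_def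
proof (intro allI impI)
  fix \<mu> assume r: "rep f \<mu>"
  let ?\<mu> = "update \<mu> k x"
  have r': "rep (f(k := x)) ?\<mu>"
    using r x assms(1) by (auto simp: rep_def length_update)
  have "exec (q, z) (set_cell k e) \<mu> (1 + (cost (q, z) \<mu> (Const k) + cost (q, z) \<mu> e))
    (max (footprint \<mu> + (cost (q, z) \<mu> (Const k) + cost (q, z) \<mu> e)) (footprint ?\<mu>)) [] ?\<mu>"
    by (rule exec.Store) (simp_all add: e[OF r])
  moreover have "max (footprint \<mu> + (cost (q, z) \<mu> (Const k) + cost (q, z) \<mu> e)) (footprint ?\<mu>) \<le> S0"
    using rep_footprint[OF r] rep_footprint[OF r'] e(2)[OF r] bits_const[of k] assms(1) by simp
  ultimately show "\<exists>\<mu>' f'. runs (q, z) (set_cell k e) \<mu> S0 [] \<mu>' \<and> rep f' \<mu>' \<and> P f'"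
    using r' P unfolding runs_def by blast
qed

text \<open>Halting comes from fixing the number \<open>N\<close> of rounds in advance; the
  induction runs backwards from the final state.\<close>

lemma trP_loop:
  assumes t: "\<And>i f \<mu>. i < N \<Longrightarrow> Inv i f \<Longrightarrow> rep f \<mu> \<Longrightarrow> val (q, z) \<mu> e \<noteq> 0"
    and body: "\<And>i f. i < N \<Longrightarrow> Inv i f \<Longrightarrow> trP p f (Inv (Suc i))"
    and f: "\<And>f \<mu>. Inv N f \<Longrightarrow> rep f \<mu> \<Longrightarrow> val (q, z) \<mu> e = 0"
    and c: "\<And>i f \<mu>. Inv i f \<Longrightarrow> rep f \<mu> \<Longrightarrow> cost (q, z) \<mu> e \<le> 12 * (V + 1)"
    and init: "Inv 0 f"
  shows "trP (While e p) f (Inv N)"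
proof -
  have "trP (While e p) f (Inv N)" if "Inv i f" "i \<le> N" for i f
    using that(2,1)
  proof (induction i arbitrary: f rule: inc_induct)
    case base
    show ?case unfolding trP_def
    proof (intro allI impI)
      fix \<mu> assume r: "rep f \<mu>"
      have "runs (q, z) (While e p) \<mu> S0 [] \<mu>"
        using f[OF base r] c[OF base r] rep_footprint[OF r] by (intro runs_WhileF) auto
      thus "\<exists>\<mu>' f'. runs (q, z) (While e p) \<mu> S0 [] \<mu>' \<and> rep f' \<mu>' \<and> Inv N f'"
        using r base by blast
    qed
  next
    case (step i)
    show ?case unfolding trP_def
    proof (intro allI impI)
      fix \<mu> assume r: "rep f \<mu>"
      obtain \<mu>1 f1 where 1: "runs (q, z) p \<mu> S0 [] \<mu>1" "rep f1 \<mu>1" "Inv (Suc i) f1"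
        using body[OF step.hyps(2) step.prems] r unfolding trP_def by blast
      obtain \<mu>2 f2 where 2: "runs (q, z) (While e p) \<mu>1 S0 [] \<mu>2" "rep f2 \<mu>2" "Inv N f2"
        using step.IH[OF 1(3)] 1(2) unfolding trP_def by blast
      have "runs (q, z) (While e p) \<mu> S0 [] \<mu>2"
        using t[OF step.hyps(2) step.prems r] c[OF step.prems r] rep_footprint[OF r]
        by (intro runs_WhileT[OF _ _ 1(1) 2(1)]) auto
      thus "\<exists>\<mu>' f'. runs (q, z) (While e p) \<mu> S0 [] \<mu>' \<and> rep f' \<mu>' \<and> Inv N f'"
        using 2 by blast
    qed
  qed
  from this[OF init] show ?thesis by simp
qed

lemma rep_op:
  assumes "rep f \<mu>" "i < bs" "j < bs" "binop_val g (f i) (f j) < 2 ^ V"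
  shows "val (q, z) \<mu> (Op g (cell i) (cell j)) = binop_val g (f i) (f j)"
    "cost (q, z) \<mu> (Op g (cell i) (cell j)) \<le> 5 * (V + 1)"
proof -
  show v: "val (q, z) \<mu> (Op g (cell i) (cell j)) = binop_val g (f i) (f j)"
    using rep_cell[OF assms(1,2)] rep_cell[OF assms(1,3)] by simp
  show "cost (q, z) \<mu> (Op g (cell i) (cell j)) \<le> 5 * (V + 1)"
    using rep_cell(2)[OF assms(1,2)] rep_cell(2)[OF assms(1,3)] bits_le[OF assms(4)] v by simp
qed

lemma trP_op:
  assumes "k < bs" "i < bs" "j < bs" "binop_val g (f i) (f j) < 2 ^ V"
    "P (f(k := binop_val g (f i) (f j)))"
  shows "trP (set_cell k (Op g (cell i) (cell j))) f P"
proof (rule trP_set)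
  show "val (q, z) \<mu> (Op g (cell i) (cell j)) = binop_val g (f i) (f j)" if "rep f \<mu>" for \<mu>
    by (rule rep_op[OF that assms(2-4)])
  show "cost (q, z) \<mu> (Op g (cell i) (cell j)) \<le> 10 * (V + 1)" if "rep f \<mu>" for \<mu>
    using rep_op(2)[OF that assms(2-4)] by simp
qed (use assms in auto)

lemma trP_cell:
  assumes "k < bs" "i < bs" "f i < 2 ^ V" "P (f(k := f i))"
  shows "trP (set_cell k (cell i)) f P"
proof (rule trP_set)
  show "val (q, z) \<mu> (cell i) = f i" if "rep f \<mu>" for \<mu>
    by (rule rep_cell[OF that assms(2)])
  show "cost (q, z) \<mu> (cell i) \<le> 10 * (V + 1)" if "rep f \<mu>" for \<mu>
    using rep_cell(2)[OF that assms(2)] by simp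
qed (use assms in auto)

lemma trP_const:
  assumes "k < bs" "c < 2 ^ V" "P (f(k := c))"
  shows "trP (set_cell k (Const c)) f P"
  using assms bits_le[of c V] by (intro trP_set[where x = c]) auto

lemma trP_inc:
  assumes "x < bs" "f x + 1 < 2 ^ V" "P (f(x := f x + 1))"
  shows "trP (set_cell x (Op Plus (cell x) (Const 1))) f P"
proof (rule trP_set)
  fix \<mu> assume r: "rep f \<mu>"
  show v: "val (q, z) \<mu> (Op Plus (cell x) (Const 1)) = f x + 1"
    using rep_cell[OF r assms(1)] by simp
  have "(1::nat) < 2 ^ V" using assms(2) by linarith
  hence "bits 1 \<le> V + 1" by (rule bits_le)
  thus "cost (q, z) \<mu> (Op Plus (cell x) (Const 1)) \<le> 10 * (V + 1)"
    using rep_cell(2)[OF r assms(1)] bits_le[OF assms(2)] v by simp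
qed (use assms in auto)

text \<open>The second claim serves array accesses, where the address \<open>bs + ev q a t s\<close>
  arises as an intermediate value.\<close>

lemma ev_lt_V:
  assumes "\<And>x. s x < 2 ^ (G * w x)" "\<And>x. w x \<ge> 1" "s 0 \<le> G" "wf_tm t" "G * pk t w + bs \<le> V"
  shows "ev q a t s < 2 ^ V" "bs + ev q a t s < 2 ^ V"
proof -
  have "G * wt t w \<le> G * pk t w" by (rule mult_le_mono2[OF pk_ge_wt])
  hence le: "G * wt t w + bs \<le> V" using assms(5) by linarith
  have "bs + ev q a t s < 2 ^ bs * 2 ^ (G * wt t w)"
  proof -
    have 1: "bs + 1 \<le> 2 ^ bs" using less_exp[of bs] by linarith
    have 2: "ev q a t s + 1 \<le> 2 ^ (G * wt t w)" using ev_lt[of s w t, OF assms(1-4)] by simp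
    have "bs + ev q a t s < (bs + 1) * (ev q a t s + 1)" by simp
    also have "\<dots> \<le> 2 ^ bs * 2 ^ (G * wt t w)" by (rule mult_le_mono[OF 1 2])
    finally show ?thesis .
  qed
  also have "\<dots> \<le> 2 ^ V" using le by (simp flip: power_add add: add.commute)
  finally show "bs + ev q a t s < 2 ^ V" .
  thus "ev q a t s < 2 ^ V" by linarith
qed

text \<open>The stack discipline carries the induction: the result goes to cell \<open>k\<close> and
  all cells below are kept, so intermediate results survive the code of a subterm, which is placed
  above them. Agreement of \<open>f\<close> with \<open>s\<close> on the variables is all that the
  start state has to provide.\<close>

lemma trP_comp:
  assumes "wf_tm t" "mv t \<le> NV" "NV \<le> k" "k + dep t \<le> bs" "\<And>x. x < NV \<Longrightarrow> f x = s x"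
    "\<And>x. s x < 2 ^ (G * w x)" "\<And>x. w x \<ge> 1" "s 0 \<le> G" "G * pk t w + bs \<le> V"
  shows "trP (comp bs t k) f (\<lambda>f'. f' k = ev q a t s \<and> (\<forall>i<k. f' i = f i))"
  using assms
proof (induction t arbitrary: k f s w)
  case (TN c)
  have "c < 2 ^ V" using ev_lt_V(1)[OF TN.prems(6,7,8,1,9)] by simp
  thus ?case using TN by (auto intro!: trP_const)
next
  case (TX x)
  have "s x < 2 ^ V" using ev_lt_V(1)[OF TX.prems(6,7,8,1,9)] by simp
  thus ?case using TX by (auto intro!: trP_cell)
next
  case (TI i)
  have l: "lookup q i < 2 ^ V" using ev_lt_V(1)[OF TI.prems(6,7,8,1,9)] by simp
  thus ?case using TI bits_le[OF l] by (auto intro!: trP_set[where x = "lookup q i"])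
next
  case (TA t)
  have "pk t w \<le> pk (TA t) w" by simp
  hence pk: "G * pk t w + bs \<le> V"
    using TA.prems(9) mult_le_mono2[of _ "pk (TA t) w" G] by (meson add_le_cancel_right le_trans)
  have v: "bs + ev q a t s < 2 ^ V"
    using TA.prems by (intro ev_lt_V(2)[OF TA.prems(6,7,8) _ pk]) auto
  have "G * 1 \<le> G * pk (TA t) w" by (rule mult_le_mono2) simp
  hence GV: "G \<le> V" using TA.prems(9) by linarith
  have av: "a i < 2 ^ V" for i
    by (rule less_le_trans[OF arr_G]) (simp add: GV)
  show ?case unfolding comp.simps
  proof (rule trP_Seq)
    show "trP (comp bs t k) f (\<lambda>f'. f' k = ev q a t s \<and> (\<forall>i<k. f' i = f i))"
      using TA.prems pk by (intro TA.IH) auto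
    fix f' assume f': "f' k = ev q a t s \<and> (\<forall>i<k. f' i = f i)"
    have k: "k < bs" using TA.prems dep_pos[of t] by simp
    show "trP (set_cell k (Load (Op Plus (Const bs) (cell k)))) f'
      (\<lambda>f'. f' k = ev q a (TA t) s \<and> (\<forall>i<k. f' i = f i))"
    proof (rule trP_set[OF k])
      fix \<mu> assume r: "rep f' \<mu>"
      have arr: "lookup \<mu> (bs + i) = a i" for i using r by (simp add: rep_def)
      show val: "val (q, z) \<mu> (Load (Op Plus (Const bs) (cell k))) = a (ev q a t s)"
        using rep_cell(1)[OF r k] f' arr by simp
      show "cost (q, z) \<mu> (Load (Op Plus (Const bs) (cell k))) \<le> 10 * (V + 1)"
        using rep_cell[OF r k] bits_const[of bs] bits_le[OF v]
          bits_le[OF av[of "ev q a t s"]] f' arr by simp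
    qed (use f' av in auto)
  qed
next
  case (TB g t1 t2)
  have "pk t1 w \<le> pk (TB g t1 t2) w" "pk t2 w \<le> pk (TB g t1 t2) w" by auto
  hence pk: "G * pk t1 w + bs \<le> V" "G * pk t2 w + bs \<le> V"
    using TB.prems(9) mult_le_mono2[of _ "pk (TB g t1 t2) w" G] by (meson add_le_cancel_right le_trans)+
  have v: "ev q a (TB g t1 t2) s < 2 ^ V" by (rule ev_lt_V(1)[OF TB.prems(6,7,8,1,9)])
  have k: "k + 1 < bs" using TB.prems dep_pos[of t2] by simp
  show ?case unfolding comp.simps
  proof (rule trP_Seq[where Q = "\<lambda>f'. f' k = ev q a t1 s \<and> (\<forall>i<k. f' i = f i)"], goal_cases)
    case 1
    show "trP (comp bs t1 k) f (\<lambda>f'. f' k = ev q a t1 s \<and> (\<forall>i<k. f' i = f i))"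
      using TB.prems pk by (intro TB.IH(1)) auto
  next
    case (2 f1)
    show ?case
    proof (rule trP_Seq)
      show "trP (comp bs t2 (k + 1)) f1 (\<lambda>f'. f' (k + 1) = ev q a t2 s \<and> (\<forall>i<k + 1. f' i = f1 i))"
        using TB.prems pk 2 by (intro TB.IH(2)) auto
      fix f2 assume f2: "f2 (k + 1) = ev q a t2 s \<and> (\<forall>i<k + 1. f2 i = f1 i)"
      show "trP (set_cell k (Op g (cell k) (cell (k + 1)))) f2
        (\<lambda>f'. f' k = ev q a (TB g t1 t2) s \<and> (\<forall>i<k. f' i = f i))"
        using f2 2 k v by (intro trP_op) auto
    qed
  qed
next
  case (TS x b t)
  let ?w = "w(x := wt b w)"
  have "pk b w \<le> pk (TS x b t) w" "pk t ?w \<le> pk (TS x b t) w" by auto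
  hence pk: "G * pk b w + bs \<le> V" "G * pk t ?w + bs \<le> V"
    using TS.prems(9) mult_le_mono2[of _ "pk (TS x b t) w" G] by (meson add_le_cancel_right le_trans)+
  have wf: "wf_tm b" "wf_tm t" "x \<noteq> 0" and mv: "mv b \<le> NV" "mv t \<le> NV" "x < NV"
    using TS.prems by auto
  define N where "N = ev q a b s"
  have N: "N < 2 ^ V" unfolding N_def by (rule ev_lt_V(1)[of s w b, OF TS.prems(6,7,8) wf(1) pk(1)])
  have Nw: "N < 2 ^ (G * wt b w)" unfolding N_def by (rule ev_lt[of s w b, OF TS.prems(6,7,8) wf(1)])
  have w1: "?w y \<ge> 1" for y using TS.prems(7) wt_pos[of w b] by auto
  have sx: "(s(x := i)) y < 2 ^ (G * ?w y)" if "i < N" for i y using TS.prems(6) that Nw by auto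
  have sx0: "(s(x := i)) 0 \<le> G" for i using TS.prems(8) wf by simp
  define g where "g i = ev q a t (s(x := i))" for i
  have gV: "g i < 2 ^ V" if "i < N" for i
    unfolding g_def by (rule ev_lt_V(1)[of "s(x := i)" ?w t, OF sx[OF that] w1 sx0 wf(2) pk(2)])
  have tot: "(\<Sum>i<N. g i) < 2 ^ V"
    using ev_lt_V(1)[OF TS.prems(6,7,8,1,9)] by (simp add: N_def g_def)
  have part: "(\<Sum>i<j. g i) < 2 ^ V" if "j \<le> N" for j
    using le_less_trans[OF sum_mono2[of "{..<N}" "{..<j}" g] tot] that by auto
  have V1: "(1::nat) < 2 ^ V" "(0::nat) < 2 ^ V"
  proof -
    have "1 * 1 \<le> G * pk b w"
      by (rule mult_le_mono[OF G le_trans[OF wt_pos[of w b, OF TS.prems(7)] pk_ge_wt]])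
    hence "V \<ge> 1" using pk by linarith
    thus "(1::nat) < 2 ^ V" "(0::nat) < 2 ^ V" using one_less_power[of "2::nat" V] by auto
  qed
  have k: "k + 3 < bs" "x < k" using TS.prems dep_pos[of t] by auto
  have sxV: "s x < 2 ^ V"
  proof -
    have "G * w x \<le> G * pk (TS x b t) w" by (rule mult_le_mono2) simp
    hence "G * w x \<le> V" using TS.prems(9) by linarith
    hence "(2::nat) ^ (G * w x) \<le> 2 ^ V" by simp
    thus ?thesis using TS.prems(6)[of x] by (rule less_le_trans[rotated])
  qed
  \<comment> \<open>Cell \<open>k\<close> holds the bound, \<open>k + 1\<close> the outer value of
    the summation variable, \<open>k + 2\<close> the partial sum. The variable itself is the loop
    counter, hence \<open>y \<noteq> x\<close>.\<close>
  define Inv where "Inv i f' \<longleftrightarrow> i \<le> N \<and> f' x = i \<and> f' k = N \<and> f' (k + 1) = s x \<and> f' (k + 2) = (\<Sum>j<i. g j) \<and>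
    (\<forall>y<k. y \<noteq> x \<longrightarrow> f' y = f y)" for i f'
  show ?case unfolding comp.simps
  proof (rule trP_Seq[where Q = "\<lambda>f'. f' k = N \<and> (\<forall>i<k. f' i = f i)"], goal_cases)
    case 1
    show "trP (comp bs b k) f (\<lambda>f'. f' k = N \<and> (\<forall>i<k. f' i = f i))"
      unfolding N_def using TS.prems pk by (intro TS.IH(1)) auto
  next
    case (2 f1)
    show ?case
    proof (rule trP_Seq[where Q = "\<lambda>f'. f' (k + 1) = s x \<and> f' k = N \<and> (\<forall>i<k. f' i = f i)"], goal_cases)
      case 1
      show "trP (set_cell (k + 1) (cell x)) f1 (\<lambda>f'. f' (k + 1) = s x \<and> f' k = N \<and> (\<forall>i<k. f' i = f i))"
        using 2 k TS.prems(5)[of x] mv sxV by (intro trP_cell) auto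
    next
      case (2 f2)
      show ?case
      proof (rule trP_Seq[where Q = "\<lambda>f'. f' (k + 2) = 0 \<and> f' (k + 1) = s x \<and> f' k = N \<and> (\<forall>i<k. f' i = f i)"], goal_cases)
        case 1
        show "trP (set_cell (k + 2) (Const 0)) f2
          (\<lambda>f'. f' (k + 2) = 0 \<and> f' (k + 1) = s x \<and> f' k = N \<and> (\<forall>i<k. f' i = f i))"
          using 2 k V1 by (intro trP_const) auto
      next
        case (2 f3)
        show ?case
        proof (rule trP_Seq[where Q = "Inv 0"], goal_cases)
          case 1
          show "trP (set_cell x (Const 0)) f3 (Inv 0)"
            using 2 k V1 by (intro trP_const) (auto simp: Inv_def)
        next
          case (2 f4)
          show ?case
          proof (rule trP_Seq[where Q = "Inv N"], goal_cases)
            case 1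
            show "trP (While (Op Less (cell x) (cell k))
          (Seq (comp bs t (k + 3)) (Seq (set_cell (k + 2) (Op Plus (cell (k + 2)) (cell (k + 3))))
             (set_cell x (Op Plus (cell x) (Const 1)))))) f4 (Inv N)"
            proof (rule trP_loop)
              fix i f' \<mu> assume "Inv i f'" and r: "rep f' \<mu>"
              hence f': "f' x = i" "f' k = N" by (auto simp: Inv_def)
              have l: "binop_val Less (f' x) (f' k) < 2 ^ V" using V1 by simp
              show "cost (q, z) \<mu> (Op Less (cell x) (cell k)) \<le> 12 * (V + 1)"
                using rep_op(2)[OF r _ _ l] k by simp
            next
              fix i f' \<mu> assume "Inv i f'" and r: "rep f' \<mu>" and i: "i < N"
              hence f': "f' x = i" "f' k = N" by (auto simp: Inv_def)
              have l: "binop_val Less (f' x) (f' k) < 2 ^ V" using V1 by simp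
              show "val (q, z) \<mu> (Op Less (cell x) (cell k)) \<noteq> 0"
                using rep_op(1)[OF r _ _ l] k f' i by simp
            next
              fix f' \<mu> assume "Inv N f'" and r: "rep f' \<mu>"
              hence f': "f' x = N" "f' k = N" by (auto simp: Inv_def)
              have l: "binop_val Less (f' x) (f' k) < 2 ^ V" using V1 by simp
              show "val (q, z) \<mu> (Op Less (cell x) (cell k)) = 0"
                using rep_op(1)[OF r _ _ l] k f' by simp
            next
              fix i f' assume i: "i < N" and inv: "Inv i f'"
              show "trP (Seq (comp bs t (k + 3)) (Seq (set_cell (k + 2) (Op Plus (cell (k + 2)) (cell (k + 3))))
                  (set_cell x (Op Plus (cell x) (Const 1))))) f' (Inv (Suc i))"
              proof (rule trP_Seq)
                show "trP (comp bs t (k + 3)) f' (\<lambda>f''. f'' (k + 3) = g i \<and> (\<forall>y<k + 3. f'' y = f' y))"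
                  unfolding g_def using TS.prems inv i mv k
                  by (intro TS.IH(2)[OF wf(2) mv(2) _ _ _ sx[OF i] w1 sx0 pk(2)]) (auto simp: Inv_def)
                fix f5 assume f5: "f5 (k + 3) = g i \<and> (\<forall>y<k + 3. f5 y = f' y)"
                show "trP (Seq (set_cell (k + 2) (Op Plus (cell (k + 2)) (cell (k + 3))))
                  (set_cell x (Op Plus (cell x) (Const 1)))) f5 (Inv (Suc i))"
                proof (rule trP_Seq)
                  have e: "binop_val Plus (f5 (k + 2)) (f5 (k + 3)) = (\<Sum>j<Suc i. g j)"
                    using f5 inv by (simp add: Inv_def)
                  show "trP (set_cell (k + 2) (Op Plus (cell (k + 2)) (cell (k + 3)))) f5
                    (\<lambda>f''. f'' = f5(k + 2 := \<Sum>j<Suc i. g j))"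
                    using k part[of "Suc i"] i e by (intro trP_op) (simp_all del: binop_val.simps)
                  fix f6 assume f6: "f6 = f5(k + 2 := \<Sum>j<Suc i. g j)"
                  have "f6 x = i" using f6 f5 inv k by (auto simp: Inv_def)
                  thus "trP (set_cell x (Op Plus (cell x) (Const 1))) f6 (Inv (Suc i))"
                    using f6 f5 inv k i N by (intro trP_inc) (auto simp: Inv_def)
                qed
              qed
            qed (use 2 in simp)
          next
            case (2 f5)
            show ?case
            proof (rule trP_Seq[where Q = "\<lambda>f'. f' (k + 2) = (\<Sum>i<N. g i) \<and> (\<forall>i<k. f' i = f i)"], goal_cases)
              case 1
              show "trP (set_cell x (cell (k + 1))) f5
                (\<lambda>f'. f' (k + 2) = (\<Sum>i<N. g i) \<and> (\<forall>i<k. f' i = f i))"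
                using 2 k sxV TS.prems(5)[of x] mv by (intro trP_cell) (auto simp: Inv_def)
            next
              case (2 f6)
              thus ?case using k tot by (intro trP_cell) (auto simp: g_def N_def)
            qed
          qed
        qed
      qed
    qed
  qed
next
  case (TP t)
  have "pk t w \<le> pk (TP t) w" by simp
  hence pk: "G * pk t w + bs \<le> V"
    using TP.prems(9) mult_le_mono2[of _ "pk (TP t) w" G] by (meson add_le_cancel_right le_trans)
  define N where "N = ev q a t s"
  define r where "r = min N (s 0)"
  have "G * 2 \<le> G * pk (TP t) w" "k + 3 \<le> bs" using TP.prems(4) by (auto intro: mult_le_mono2)
  hence GV: "G < V" using TP.prems(9) by linarith
  have pV: "2 ^ i < (2::nat) ^ V" "i < 2 ^ V" if "i \<le> r" for i
  proof -
    have "i < V" using that GV TP.prems(8) by (simp add: r_def)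
    thus "2 ^ i < (2::nat) ^ V" by simp
    show "i < 2 ^ V" by (rule less_trans[OF \<open>i < V\<close> less_exp])
  qed
  have V1: "(1::nat) < 2 ^ V" using pV(1)[of 0] by simp
  have k: "k + 2 < bs" "0 < k" using TP.prems mv_pos[of t] by auto
  have s0: "f 0 = s 0" using TP.prems(5)[of 0] TP.prems(2) mv_pos[of t] by simp
  define Inv where "Inv i f' \<longleftrightarrow> i \<le> r \<and> f' k = N \<and> f' (k + 1) = i \<and> f' (k + 2) = 2 ^ i \<and>
    (\<forall>y<k. f' y = f y)" for i f'
  \<comment> \<open>The product of two comparisons, with the exponent and with the cap in cell 0,
    stops the doubling after \<open>min N (s 0)\<close> rounds.\<close>
  let ?e = "Op Times (Op Less (cell (k + 1)) (cell k)) (Op Less (cell (k + 1)) (cell 0))"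
  have cond: "val (q, z) \<mu> ?e = of_bool (i < r)" "cost (q, z) \<mu> ?e \<le> 12 * (V + 1)"
    if "Inv i f'" "rep f' \<mu>" for i f' \<mu>
  proof -
    have l: "binop_val Less x y < 2 ^ V" for x y using V1 by simp
    note 1 = rep_op[OF that(2) _ _ l, of "k + 1" k] and 2 = rep_op[OF that(2) _ _ l, of "k + 1" 0]
    show v: "val (q, z) \<mu> ?e = of_bool (i < r)"
      using 1(1) 2(1) k that(1) s0 by (simp add: Inv_def r_def del: val.simps(4))
    have "bits (of_bool (i < r)) \<le> V + 1"
      using V1 by (intro bits_le) simp
    thus "cost (q, z) \<mu> ?e \<le> 12 * (V + 1)"
      using 1(2) 2(2) k unfolding cost.simps(5)[of _ _ Times] v by simp
  qed
  show ?case unfolding comp.simps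
  proof (rule trP_Seq[where Q = "\<lambda>f'. f' k = N \<and> (\<forall>i<k. f' i = f i)"], goal_cases)
    case 1
    show "trP (comp bs t k) f (\<lambda>f'. f' k = N \<and> (\<forall>i<k. f' i = f i))"
      unfolding N_def using TP.prems pk by (intro TP.IH) auto
  next
    case (2 f1)
    show ?case
    proof (rule trP_Seq[where Q = "\<lambda>f'. f' (k + 1) = 0 \<and> f' k = N \<and> (\<forall>i<k. f' i = f i)"], goal_cases)
      case 1
      show "trP (set_cell (k + 1) (Const 0)) f1 (\<lambda>f'. f' (k + 1) = 0 \<and> f' k = N \<and> (\<forall>i<k. f' i = f i))"
        using 2 k V1 by (intro trP_const) auto
    next
      case (2 f2)
      show ?case
      proof (rule trP_Seq[where Q = "Inv 0"], goal_cases)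
        case 1
        show "trP (set_cell (k + 2) (Const 1)) f2 (Inv 0)"
          using 2 k V1 by (intro trP_const) (auto simp: Inv_def)
      next
        case (2 f3)
        show ?case
        proof (rule trP_Seq[where Q = "Inv r"], goal_cases)
          case 1
          show "trP (While ?e (Seq (set_cell (k + 2) (Op Plus (cell (k + 2)) (cell (k + 2))))
             (set_cell (k + 1) (Op Plus (cell (k + 1)) (Const 1))))) f3 (Inv r)"
          proof (rule trP_loop)
            fix i f' assume i: "i < r" and inv: "Inv i f'"
            show "trP (Seq (set_cell (k + 2) (Op Plus (cell (k + 2)) (cell (k + 2))))
             (set_cell (k + 1) (Op Plus (cell (k + 1)) (Const 1)))) f' (Inv (Suc i))"
            proof (rule trP_Seq)
              have e: "binop_val Plus (f' (k + 2)) (f' (k + 2)) = 2 ^ Suc i"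
                using inv by (simp add: Inv_def)
              show "trP (set_cell (k + 2) (Op Plus (cell (k + 2)) (cell (k + 2)))) f'
                (\<lambda>f''. f'' = f'(k + 2 := 2 ^ Suc i))"
                using k pV(1)[of "Suc i"] i e by (intro trP_op) (simp_all del: binop_val.simps power_Suc)
              fix f6 assume f6: "f6 = f'(k + 2 := 2 ^ Suc i)"
              thus "trP (set_cell (k + 1) (Op Plus (cell (k + 1)) (Const 1))) f6 (Inv (Suc i))"
                using inv k i pV(2)[of "Suc i"] by (intro trP_inc) (auto simp: Inv_def)
            qed
          qed (use cond 2 in \<open>auto simp del: val.simps cost.simps\<close>)
        next
          case (2 f5)
          have "f5 (k + 2) = 2 ^ r" "f5 (k + 2) < 2 ^ V" using 2 pV(1)[of r] by (auto simp: Inv_def)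
          thus ?case using k 2 by (intro trP_cell) (auto simp: Inv_def r_def N_def)
        qed
      qed
    qed
  qed
qed

end

section \<open>Assignment lists and updates of the persistent array\<close>

primrec evs :: "nat list \<Rightarrow> (nat \<Rightarrow> nat) \<Rightarrow> (nat \<times> tm) list \<Rightarrow> (nat \<Rightarrow> nat) \<Rightarrow> (nat \<Rightarrow> nat)" where
  "evs q a [] s = s"
| "evs q a (p # as) s = evs q a as (s(fst p := ev q a (snd p) s))"

text \<open>Variable 0 may be reassigned within the list; the size bounds of all powers rest on each
  of its values being at most \<open>G\<close>.\<close>

primrec caps_le :: "nat \<Rightarrow> nat list \<Rightarrow> (nat \<Rightarrow> nat) \<Rightarrow> (nat \<times> tm) list \<Rightarrow> (nat \<Rightarrow> nat) \<Rightarrow> bool" where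
  "caps_le G q a [] s = (s 0 \<le> G)"
| "caps_le G q a (p # as) s = (s 0 \<le> G \<and> caps_le G q a as (s(fst p := ev q a (snd p) s)))"

primrec comps :: "nat \<Rightarrow> nat \<Rightarrow> (nat \<times> tm) list \<Rightarrow> prog" where
  "comps NV bs [] = Skip"
| "comps NV bs (p # as) = Seq (comp bs (snd p) NV) (Seq (set_cell (fst p) (cell NV)) (comps NV bs as))"

primrec pks :: "(nat \<times> tm) list \<Rightarrow> (nat \<Rightarrow> nat) \<Rightarrow> nat" where
  "pks [] w = 0"
| "pks (p # as) w = max (pk (snd p) w) (pks as (w(fst p := wt (snd p) w)))"

text \<open>The variables hold leftovers of the previous arrival; clearing them justifies the start
  state \<open>\<lambda>_. 0\<close> of \<open>evs\<close>.\<close>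

primrec zeros :: "nat \<Rightarrow> prog" where
  "zeros 0 = Skip"
| "zeros (Suc k) = Seq (zeros k) (set_cell k (Const 0))"

fun puts :: "nat \<Rightarrow> (nat \<times> nat) list \<Rightarrow> prog" where
  "puts bs [] = Skip"
| "puts bs ((i, j) # ps) = Seq (Store (Op Plus (Const bs) (cell i)) (cell j)) (puts bs ps)"

fun put_all :: "(nat \<Rightarrow> nat) \<Rightarrow> (nat \<times> nat) list \<Rightarrow> (nat \<Rightarrow> nat) \<Rightarrow> (nat \<Rightarrow> nat)" where
  "put_all s [] a = a"
| "put_all s ((i, j) # ps) a = put_all s ps (a(s i := s j))"

context machine
begin

lemma trP_Skip: "P f \<Longrightarrow> trP Skip f P"
proof -
  have "runs (q, z) Skip \<mu> S0 [] \<mu>" if "rep f \<mu>" for \<mu>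
    using rep_footprint[OF that] exec.Skip[of "(q, z)" \<mu>] unfolding runs_def by fastforce
  thus "P f \<Longrightarrow> trP Skip f P" unfolding trP_def by blast
qed

lemma trP_zeros: "k \<le> bs \<Longrightarrow> trP (zeros k) f (\<lambda>f'. \<forall>x<k. f' x = 0)"
proof (induction k)
  case (Suc k)
  have "trP (Seq (zeros k) (set_cell k (Const 0))) f (\<lambda>f'. \<forall>x<Suc k. f' x = 0)"
    using Suc by (intro trP_Seq[OF Suc.IH] trP_const) (auto simp: less_Suc_eq)
  thus ?case by simp
qed (auto intro: trP_Skip)

lemma trP_comps:
  assumes "\<forall>p\<in>set as. wf_tm (snd p) \<and> mv (snd p) \<le> NV \<and> fst p < NV \<and> NV + dep (snd p) \<le> bs"
    "\<And>x. x < NV \<Longrightarrow> f x = s x" "\<And>x. s x < 2 ^ (G * w x)" "\<And>x. w x \<ge> 1"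
    "caps_le G q a as s" "G * pks as w + bs \<le> V"
  shows "trP (comps NV bs as) f (\<lambda>f'. \<forall>x<NV. f' x = evs q a as s x)"
  using assms
proof (induction as arbitrary: f s w)
  case Nil
  thus ?case by (auto intro: trP_Skip)
next
  case (Cons p as)
  obtain x t where p: "p = (x, t)" by (cases p)
  have t: "wf_tm t" "mv t \<le> NV" "x < NV" "NV + dep t \<le> bs" using Cons.prems(1) p by auto
  have "pk t w \<le> pks (p # as) w" "pks as (w(x := wt t w)) \<le> pks (p # as) w" using p by auto
  hence pk: "G * pk t w + bs \<le> V" "G * pks as (w(x := wt t w)) + bs \<le> V"
    using Cons.prems(6) mult_le_mono2[of _ "pks (p # as) w" G] by (meson add_le_cancel_right le_trans)+
  have s0: "s 0 \<le> G" using Cons.prems(5) by simp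
  have NV: "NV < bs" using t dep_pos[of t] by linarith
  have v: "ev q a t s < 2 ^ V" by (rule ev_lt_V(1)[OF Cons.prems(3,4) s0 t(1) pk(1)])
  show ?case unfolding comps.simps p fst_conv snd_conv evs.simps
  proof (rule trP_Seq)
    show "trP (comp bs t NV) f (\<lambda>f'. f' NV = ev q a t s \<and> (\<forall>i<NV. f' i = f i))"
      using t by (intro trP_comp[OF t(1,2) _ _ Cons.prems(2,3,4) s0 pk(1)]) auto
    fix f1 assume f1: "f1 NV = ev q a t s \<and> (\<forall>i<NV. f1 i = f i)"
    show "trP (Seq (set_cell x (cell NV)) (comps NV bs as)) f1
      (\<lambda>f'. \<forall>y<NV. f' y = evs q a as (s(x := ev q a t s)) y)"
    proof (rule trP_Seq)
      show "trP (set_cell x (cell NV)) f1 (\<lambda>f'. \<forall>y<NV. f' y = (s(x := ev q a t s)) y)"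
        using f1 t NV v Cons.prems(2) by (intro trP_cell) auto
      fix f2 assume f2: "\<forall>y<NV. f2 y = (s(x := ev q a t s)) y"
      show "trP (comps NV bs as) f2 (\<lambda>f'. \<forall>y<NV. f' y = evs q a as (s(x := ev q a t s)) y)"
      proof (rule Cons.IH)
        show "(s(x := ev q a t s)) y < 2 ^ (G * (w(x := wt t w)) y)" for y
          using ev_lt[of s w t, OF Cons.prems(3,4) s0 t(1)] Cons.prems(3) by simp
        show "(w(x := wt t w)) y \<ge> 1" for y using Cons.prems(4) wt_pos[of w t] by simp
      qed (use Cons.prems f2 p pk in \<open>auto simp del: fun_upd_apply\<close>)
    qed
  qed
qed

end

text \<open>Addresses and values are both read from variables, which no write touches; so
  \<open>f\<close> stays the same while the array changes, and the bound \<open>W\<close> is carried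
  along.\<close>

lemma puts_runs:
  assumes "\<And>i. a i < 2 ^ W" "\<forall>(i, j)\<in>set ps. i < bs \<and> j < bs \<and> f i < m \<and> f j < 2 ^ W"
    "mrep bs V m a f \<mu>" "bs \<le> V" "bs + m < 2 ^ V" "W \<le> V"
  shows "\<exists>\<mu>'. runs (q, z) (puts bs ps) \<mu> (Smax bs V W m) [] \<mu>' \<and> mrep bs V m (put_all f ps a) f \<mu>' \<and>
    (\<forall>i. put_all f ps a i < 2 ^ W)"
  using assms
proof (induction ps arbitrary: a \<mu>)
  case Nil
  have "runs (q, z) Skip \<mu> (Smax bs V W m) [] \<mu>"
    using mrep_footprint[OF Nil(3,1)] exec.Skip[of "(q, z)" \<mu>] unfolding runs_def by fastforce
  thus ?case using Nil by auto
next
  case (Cons p ps)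
  obtain i j where p: "p = (i, j)" by (cases p)
  have ij: "i < bs" "j < bs" "f i < m" "f j < 2 ^ W" using Cons.prems(2) p by auto
  let ?\<mu> = "update \<mu> (bs + f i) (f j)" and ?a = "a(f i := f j)"
  have l: "lookup \<mu> i = f i" "lookup \<mu> j = f j" "f i < 2 ^ V" "f j < 2 ^ V"
    using Cons.prems(3) ij by (auto simp: mrep_def)
  have a: "?a i < 2 ^ W" for i using Cons.prems(1) ij by simp
  have r: "mrep bs V m ?a f ?\<mu>"
    using Cons.prems(3) ij by (auto simp: mrep_def length_update)
  let ?c = "cost (q, z) \<mu> (Op Plus (Const bs) (cell i)) + cost (q, z) \<mu> (cell j)"
  have "runs (q, z) (Store (Op Plus (Const bs) (cell i)) (cell j)) \<mu> (Smax bs V W m) [] ?\<mu>"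
  proof -
    have e: "exec (q, z) (Store (Op Plus (Const bs) (cell i)) (cell j)) \<mu> (1 + ?c)
        (max (footprint \<mu> + ?c) (footprint ?\<mu>)) [] ?\<mu>"
      by (rule exec.Store) (simp_all add: l)
    have b: "bits k \<le> V + 1" if "k \<le> bs" for k
      using that bits_le[of k V] Cons.prems(4) less_exp[of V] by linarith
    have "?c \<le> 12 * (V + 1)"
      using b[of bs] b[of i] b[of j] bits_le[OF l(3)] bits_le[OF l(4)] ij
        bits_le[of "bs + f i" V] Cons.prems(5) by (simp add: l)
    thus ?thesis using e mrep_footprint[OF Cons.prems(3,1)] mrep_footprint[OF r a]
      unfolding runs_def by (meson add_le_mono1 add_left_mono le_trans max.boundedI le_add1)
  qed
  moreover obtain \<mu>' where "runs (q, z) (puts bs ps) ?\<mu> (Smax bs V W m) [] \<mu>'"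
    "mrep bs V m (put_all f ps ?a) f \<mu>'" "\<forall>i. put_all f ps ?a i < 2 ^ W"
    using Cons.IH[OF a _ r] Cons.prems p by (auto simp del: fun_upd_apply)
  ultimately show ?case using p by (auto intro: runs_Seq0 simp del: fun_upd_apply)
qed

definition program :: "nat \<Rightarrow> nat \<Rightarrow> (nat \<times> tm) list \<Rightarrow> (nat \<times> nat) list \<Rightarrow> nat \<Rightarrow> prog" where
  "program NV bs as ps c = Seq (zeros NV) (Seq (comps NV bs as) (Seq (puts bs ps) (Emit (cell c))))"

text \<open>The weight \<open>pks\<close> depends on the program text only, so the length
  \<open>V\<close> of all intermediate values is \<open>G\<close> up to constants. A bound on one
  number thereby bounds the space of a whole arrival.\<close>

theorem program_runs:
  assumes as: "\<forall>p\<in>set as. wf_tm (snd p) \<and> mv (snd p) \<le> NV \<and> fst p < NV \<and> NV + dep (snd p) \<le> bs"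
    and ps: "\<forall>(i, j)\<in>set ps. i < NV \<and> j < NV" and c: "c < NV" "NV \<le> bs"
    and G: "1 \<le> G" "\<And>i. lookup q i < 2 ^ G" "W \<le> G" and a: "\<And>i. a i < 2 ^ W"
    and V: "V = G * Suc (pks as (\<lambda>_. 1)) + bs" and m: "m < 2 ^ G"
    and caps: "caps_le G q a as (\<lambda>_. 0)"
  defines "s \<equiv> evs q a as (\<lambda>_. 0)"
  assumes put: "\<forall>(i, j)\<in>set ps. s i < m \<and> s j < 2 ^ W" and r: "mrep bs V m a f \<mu>"
  shows "\<exists>\<mu>' f'. runs (q, z) (program NV bs as ps c) \<mu> (Smax bs V W m) [s c] \<mu>' \<and>
    mrep bs V m (put_all s ps a) f' \<mu>' \<and> (\<forall>i. put_all s ps a i < 2 ^ W)"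
proof -
  have aG: "a i < 2 ^ G" for i by (rule less_le_trans[OF a]) (simp add: G(3))
  have GW: "W \<le> G" and G1: "Suc 0 \<le> G" using G by auto
  interpret machine q a G z bs V W m
    by unfold_locales (use G a aG V in auto)
  have "trP (Seq (zeros NV) (comps NV bs as)) f (\<lambda>f'. \<forall>x<NV. f' x = s x)"
    unfolding s_def
  proof (rule trP_Seq[OF trP_zeros[OF c(2)]])
    fix f' :: "nat \<Rightarrow> nat" assume "\<forall>x<NV. f' x = 0"
    thus "trP (comps NV bs as) f' (\<lambda>f'. \<forall>x<NV. f' x = evs q a as (\<lambda>_. 0) x)"
      using as caps V by (intro trP_comps[where w = "\<lambda>_. 1"]) (auto simp: algebra_simps)
  qed
  then obtain \<mu>1 f1 where 1: "runs (q, z) (Seq (zeros NV) (comps NV bs as)) \<mu> S0 [] \<mu>1"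
    "rep f1 \<mu>1" "\<forall>x<NV. f1 x = s x"
    using r unfolding trP_def by blast
  have "put_all f1 ps a' = put_all s ps a'" for a'
    using ps 1(3) by (induction s ps a' rule: put_all.induct) auto
  moreover have "bs + m < 2 ^ V"
  proof -
    have "bs + m < (bs + 1) * (m + 1)" by simp
    also have "\<dots> \<le> 2 ^ bs * 2 ^ G"
      using Suc_leI[OF less_exp[of bs]] m by (intro mult_le_mono) auto
    also have "\<dots> \<le> 2 ^ V" using V by (simp flip: power_add)
    finally show ?thesis .
  qed
  moreover have "\<forall>(i, j)\<in>set ps. i < bs \<and> j < bs \<and> f1 i < m \<and> f1 j < 2 ^ W"
    using ps put 1(3) c by fastforce
  ultimately obtain \<mu>2 where 2: "runs (q, z) (puts bs ps) \<mu>1 S0 [] \<mu>2"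
    "mrep bs V m (put_all s ps a) f1 \<mu>2" "\<forall>i. put_all s ps a i < 2 ^ W"
    using puts_runs[of a W ps bs f1 m V \<mu>1 q z] a 1(2) V GW by auto
  have aG2: "put_all s ps a i < 2 ^ G" for i
    by (rule less_le_trans[OF 2(3)[rule_format]]) (simp add: GW)
  \<comment> \<open>The emitted cell is read after the array has changed, so the facts on variables
    are needed for the new array.\<close>
  interpret m2: machine q "put_all s ps a" G z bs V W m
    using 2(3) aG2 V by unfold_locales (auto simp: G1 inp_G)
  have cc: "c < bs" using c by simp
  have emit: "runs (q, z) (Emit (cell c)) \<mu>2 S0 [s c] \<mu>2"
  proof -
    have "exec (q, z) (Emit (cell c)) \<mu>2 (1 + cost (q, z) \<mu>2 (cell c)) (footprint \<mu>2 + cost (q, z) \<mu>2 (cell c))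
      [val (q, z) \<mu>2 (cell c)] \<mu>2" by (rule exec.Emit) simp
    moreover have "val (q, z) \<mu>2 (cell c) = s c" using m2.rep_cell(1)[OF 2(2) cc] 1(3) c by simp
    moreover have "footprint \<mu>2 + cost (q, z) \<mu>2 (cell c) \<le> S0"
      using m2.rep_cell(2)[OF 2(2) cc] m2.rep_footprint[OF 2(2)] by simp
    ultimately show ?thesis unfolding runs_def by auto
  qed
  \<comment> \<open>Clearing and evaluation are verified together under the old array, but the
    program nests its sequence to the right; hence the regrouping.\<close>
  have seq: "runs \<epsilon> (Seq (Seq p1 p2) p3) \<mu> S out \<mu>' \<Longrightarrow> runs \<epsilon> (Seq p1 (Seq p2 p3)) \<mu> S out \<mu>'"
    for \<epsilon> p1 p2 p3 \<mu> S out \<mu>'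
  proof -
    assume "runs \<epsilon> (Seq (Seq p1 p2) p3) \<mu> S out \<mu>'"
    then obtain t s where ts: "exec \<epsilon> (Seq (Seq p1 p2) p3) \<mu> t s out \<mu>'" "s \<le> S" by (auto simp: runs_def)
    from ts(1) show ?thesis
    proof (cases rule: exec.cases)
      case (Seq t1 s1 o1 \<mu>1 t2 s2 o2)
      note S2 = this
      from S2(4) show ?thesis
      proof (cases rule: exec.cases)
        case (Seq t3 s3 o3 \<mu>3 t4 s4 o4)
        from exec.Seq[OF Seq(4) exec.Seq[OF Seq(5) S2(5)]] show ?thesis
          unfolding runs_def using ts(2) S2 Seq by fastforce
      qed
    qed
  qed
  have "runs (q, z) (program NV bs as ps c) \<mu> S0 [s c] \<mu>2"
    unfolding program_def by (rule seq[OF runs_Seq0[OF 1(1) runs_Seq0[OF 2(1) emit]]])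
  thus ?thesis using 2 by blast
qed

section \<open>Levels, phases and their pairs\<close>

lemma mod_add_cancel_nat: "(a + c) mod m = (b + c) mod m \<longleftrightarrow> a mod m = b mod m" for a b c m :: nat
  by (auto simp: nat_mod_eq_iff)

definition epochs :: "nat \<Rightarrow> nat \<Rightarrow> nat" where
  "epochs I j = 2 ^ (I - j)"

definition agree :: "nat \<Rightarrow> nat \<Rightarrow> (nat \<Rightarrow> nat) \<Rightarrow> (nat \<Rightarrow> nat) \<Rightarrow> nat \<Rightarrow> nat set" where
  "agree M R f g d = {r. r < R \<and> f r mod M = (g r + d) mod M}"

text \<open>Whatever small set \<open>U\<close> of rows is in use at \<open>u\<close>, few vertices-with-shift \<open>(v, d)\<close> find at least half
  of the rows they share with \<open>u\<close> in use.\<close>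

definition spread :: "nat \<Rightarrow> nat \<Rightarrow> nat \<Rightarrow> (nat \<Rightarrow> nat \<Rightarrow> nat) \<Rightarrow> bool" where
  "spread n M R h \<longleftrightarrow> (\<forall>u<n. \<forall>U\<subseteq>{..<R}. 10 * card U \<le> R \<longrightarrow>
     32 * card {(v, d). v < n \<and> v \<noteq> u \<and> d < M \<and>
        card (agree M R (h u) (h v) d) \<le> 2 * card (agree M R (h u) (h v) d \<inter> U)} \<le> card U)"

text \<open>A vertex together with an epoch.\<close>

type_synonym vv = "nat \<times> nat"

text \<open>\<open>I\<close> is the last level, \<open>A\<close> the number of phases, \<open>T0\<close> the length of an epoch at level 0, and \<open>RI\<close> the
  number of rows of the last level.\<close>

locale design =
  fixes n I K T0 A RI :: nat and h :: "nat \<Rightarrow> nat \<Rightarrow> nat"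
  assumes T0K: "20 * T0 \<le> K * 2 ^ I" and T0A: "T0 < 32 ^ A"
    and spreadI: "\<And>j. j < I \<Longrightarrow> spread n (2 * epochs I j) (2 * epochs I j * K) h"
begin

abbreviation E :: "nat \<Rightarrow> nat" where "E \<equiv> epochs I"
definition M :: "nat \<Rightarrow> nat" where "M j = 2 * E j"
definition R :: "nat \<Rightarrow> nat" where "R j = (if j < I then M j * K else RI)"
definition B :: "nat \<Rightarrow> nat" where "B j = 8 * 4 ^ j"
definition T :: "nat \<Rightarrow> nat" where "T j = T0 * 2 ^ j"

definition common :: "nat \<Rightarrow> vv \<Rightarrow> vv \<Rightarrow> nat set" where
  "common j X Y = {r. r < R j \<and>
     (h (fst X) r + snd X) mod M j = (h (fst Y) r + snd Y + E j) mod M j}"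

definition isvv :: "nat \<Rightarrow> vv \<Rightarrow> bool" where
  "isvv j X \<longleftrightarrow> fst X < n \<and> snd X < E j"

lemma finite_isvv: "finite {X. isvv j X}"
proof (rule finite_subset)
  show "{X. isvv j X} \<subseteq> {..<n} \<times> {..<E j}"
    by (auto simp: isvv_def)
qed auto

lemma finite_common [simp]: "finite (common j X Y)"
  by (simp add: common_def)

text \<open>The epochs enter only through their difference, a shift between 1 and
  \<open>2 * E j - 1\<close>. One property of the table therefore serves all epochs.\<close>

lemma common_tail:
  assumes "snd X < E j" "snd Y < E j" "j < I"
  shows "common j X Y = agree (M j) (R j) (h (fst X)) (h (fst Y)) (snd Y + E j - snd X)"
proof -
  have "(a + snd X) mod M j = (b + snd Y + E j) mod M j \<longleftrightarrow>
      a mod M j = (b + (snd Y + E j - snd X)) mod M j" for a b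
  proof -
    have "b + snd Y + E j = (b + (snd Y + E j - snd X)) + snd X"
      using assms by simp
    thus ?thesis
      using mod_add_cancel_nat[of a "snd X" "M j" "b + (snd Y + E j - snd X)"] by presburger
  qed
  thus ?thesis by (simp add: common_def agree_def)
qed

text \<open>Adding and subtracting \<open>E j\<close> agree modulo \<open>M j = 2 * E j\<close>. So
  the view from the head has the same form as that from the tail, and \<open>spread\<close> covers
  both.\<close>

lemma common_head:
  assumes "snd X < E j" "snd Y < E j" "j < I"
  shows "common j X Y = agree (M j) (R j) (h (fst Y)) (h (fst X)) (snd X + E j - snd Y)"
proof -
  have "(a + snd X) mod M j = (b + snd Y + E j) mod M j \<longleftrightarrow>
      b mod M j = (a + (snd X + E j - snd Y)) mod M j" for a b
  proof -
    have "a + snd X + M j = (a + (snd X + E j - snd Y)) + (snd Y + E j)"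
      using assms by (simp add: M_def)
    moreover have "(a + snd X + M j) mod M j = (a + snd X) mod M j" by simp
    ultimately show ?thesis
      using mod_add_cancel_nat[of b "snd Y + E j" "M j" "a + (snd X + E j - snd Y)"]
      by (metis add.assoc)
  qed
  thus ?thesis by (simp add: common_def agree_def)
qed

text \<open>With \<open>X\<close> fixed, the shift determines the epoch of the partner, so different
  blocked partners remain different among those that \<open>spread\<close> counts.\<close>

lemma blocked_card:
  assumes j: "j < I" and X: "isvv j X" and U: "U \<subseteq> {..<R j}" "10 * card U \<le> R j"
    and eq: "\<And>Y. isvv j Y \<Longrightarrow>
      c Y = agree (M j) (R j) (h (fst X)) (h (fst Y)) (snd Y + E j - snd X)"
  shows "32 * card {Y. isvv j Y \<and> fst Y \<noteq> fst X \<and> card (c Y) \<le> 2 * card (c Y \<inter> U)} \<le> card U"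
    (is "32 * card ?S \<le> _")
proof -
  let ?Q = "{(v, d). v < n \<and> v \<noteq> fst X \<and> d < M j \<and>
        card (agree (M j) (R j) (h (fst X)) (h v) d) \<le>
        2 * card (agree (M j) (R j) (h (fst X)) (h v) d \<inter> U)}"
  have fin: "finite ?Q"
    by (rule finite_subset[of _ "{..<n} \<times> {..<M j}"]) auto
  have Xs: "snd X < E j" using X by (simp add: isvv_def)
  have inj: "inj_on (\<lambda>Y. (fst Y, snd Y + E j - snd X)) ?S"
    using Xs by (auto intro!: inj_onI prod_eqI)
  have "(\<lambda>Y. (fst Y, snd Y + E j - snd X)) ` ?S \<subseteq> ?Q"
  proof
    fix q assume "q \<in> (\<lambda>Y. (fst Y, snd Y + E j - snd X)) ` ?S"
    then obtain Y where Y: "Y \<in> ?S" "q = (fst Y, snd Y + E j - snd X)" by blast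
    have "snd Y + E j - snd X < M j"
      using Y(1) Xs by (auto simp: isvv_def M_def)
    with Y eq[of Y] show "q \<in> ?Q" by (auto simp: isvv_def)
  qed
  hence "card ?S \<le> card ?Q"
    using card_inj_on_le[OF inj _ fin] by simp
  moreover have "32 * card ?Q \<le> card U"
  proof -
    have "spread n (M j) (R j) h"
      using spreadI[OF j] j by (simp add: M_def R_def)
    thus ?thesis
      using U X unfolding spread_def isvv_def by blast
  qed
  ultimately show ?thesis by linarith
qed

lemma tail_blocked_card:
  assumes j: "j < I" and X: "isvv j X" and U: "U \<subseteq> {..<R j}" "10 * card U \<le> R j"
  shows "32 * card {Y. isvv j Y \<and> fst Y \<noteq> fst X \<and>
      card (common j X Y) \<le> 2 * card (common j X Y \<inter> U)} \<le> card U"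
  using X j by (intro blocked_card[OF j X U, of "common j X"] common_tail) (simp_all add: isvv_def)

lemma head_blocked_card:
  assumes j: "j < I" and Y: "isvv j Y" and U: "U \<subseteq> {..<R j}" "10 * card U \<le> R j"
  shows "32 * card {X. isvv j X \<and> fst X \<noteq> fst Y \<and>
      card (common j X Y) \<le> 2 * card (common j X Y \<inter> U)} \<le> card U"
  using Y j by (intro blocked_card[OF j Y U, of "\<lambda>X. common j X Y"] common_head) (simp_all add: isvv_def)

end

text \<open>\<open>VS j l\<close> contains the pairs (tail, head) that ever visited phase \<open>l\<close> of level \<open>j\<close>, \<open>AL j l\<close> those to
  which a row was allocated there, with that row, and \<open>cn j l X r\<close> counts the colors used from the
  bundle of row \<open>r\<close> allocated to the tail \<open>X\<close>.\<close>

locale ledger = design +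
  fixes VS :: "nat \<Rightarrow> nat \<Rightarrow> (vv \<times> vv) set"
    and AL :: "nat \<Rightarrow> nat \<Rightarrow> (vv \<times> vv \<times> nat) set"
    and cn :: "nat \<Rightarrow> nat \<Rightarrow> vv \<Rightarrow> nat \<Rightarrow> nat"
  assumes VS_vv: "\<And>j l X Y. (X, Y) \<in> VS j l \<Longrightarrow> isvv j X \<and> isvv j Y \<and> fst X \<noteq> fst Y"
    and AL_VS: "\<And>j l X Y r. (X, Y, r) \<in> AL j l \<Longrightarrow> (X, Y) \<in> VS j l \<and> r < R j \<and> l < A"
    and AL_tail: "\<And>j l X Y Y' r. (X, Y, r) \<in> AL j l \<Longrightarrow> (X, Y', r) \<in> AL j l \<Longrightarrow> Y = Y'"
    and AL_head: "\<And>j l X X' Y r. (X, Y, r) \<in> AL j l \<Longrightarrow> (X', Y, r) \<in> AL j l \<Longrightarrow> X = X'"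
    and VS_Suc: "\<And>j l X Y. j < I \<Longrightarrow> (X, Y) \<in> VS j (Suc l) \<Longrightarrow> (X, Y) \<in> VS j l \<and>
      card (common j X Y) \<le> 2 * card (common j X Y \<inter> {r. \<exists>Y. (X, Y, r) \<in> AL j l})"
    and AL_once: "\<And>j l l' X Y r r'. j < I \<Longrightarrow> (X, Y, r) \<in> AL j l \<Longrightarrow> (X, Y, r') \<in> AL j l' \<Longrightarrow>
      l = l' \<and> r = r'"
    and VS_level: "\<And>j X Y. j < I \<Longrightarrow> (Y, X) \<in> VS (Suc j) 0 \<Longrightarrow>
      \<exists>X' Y'. (X', Y') \<in> VS j 0 \<and> X = map_prod id (\<lambda>e. e div 2) X' \<and> Y = map_prod id (\<lambda>e. e div 2) Y' \<and>
       ((\<exists>l r. (X', Y', r) \<in> AL j l \<and> B j \<le> cn j l X' r) \<or>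
        (\<exists>l. card (common j X' Y') \<le> 2 * card (common j X' Y' \<inter> {r. \<exists>X. (X, Y', r) \<in> AL j l})) \<or>
        (X', Y') \<in> VS j A)"
    and exh: "\<And>j X. B j * card {(l, X', Y', r). (X', Y', r) \<in> AL j l \<and> (X' = X \<or> Y' = X) \<and>
       B j \<le> cn j l X' r} \<le> T j"
    and VS_0: "\<And>X. card {Y. (X, Y) \<in> VS 0 0 \<or> (Y, X) \<in> VS 0 0} \<le> T0"
begin

section \<open>Bounds on the pairs of a vertex, level by level\<close>

definition UT :: "nat \<Rightarrow> nat \<Rightarrow> vv \<Rightarrow> nat set" where "UT j l X = {r. \<exists>Y. (X, Y, r) \<in> AL j l}"
definition UH :: "nat \<Rightarrow> nat \<Rightarrow> vv \<Rightarrow> nat set" where "UH j l Y = {r. \<exists>X. (X, Y, r) \<in> AL j l}"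
definition VT :: "nat \<Rightarrow> nat \<Rightarrow> vv \<Rightarrow> vv set" where "VT j l X = {Y. (X, Y) \<in> VS j l}"
definition VH :: "nat \<Rightarrow> vv \<Rightarrow> vv set" where "VH j Y = {X. (X, Y) \<in> VS j 0}"

lemma finite_VT: "finite (VT j l X)"
  by (rule finite_subset[OF _ finite_isvv[of j]]) (unfold VT_def, blast dest: VS_vv)

lemma finite_VH: "finite (VH j X)"
  by (rule finite_subset[OF _ finite_isvv[of j]]) (unfold VH_def, blast dest: VS_vv)

text \<open>By \<open>AL_once\<close> a pair owns at most one row of a level, so the rows in use at
  a tail are charged to distinct heads.\<close>

lemma UT_le_VT:
  assumes "j < I" shows "card (UT j l X) \<le> card (VT j l X)"
proof -
  have "card (UT j l X) \<le> card ((\<lambda>Y. THE r. (X, Y, r) \<in> AL j l) ` VT j l X)"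
  proof (rule card_mono)
    show "UT j l X \<subseteq> (\<lambda>Y. THE r. (X, Y, r) \<in> AL j l) ` VT j l X"
    proof
      fix r assume "r \<in> UT j l X"
      then obtain Y where Y: "(X, Y, r) \<in> AL j l" by (auto simp: UT_def)
      hence "(THE r. (X, Y, r) \<in> AL j l) = r"
        using AL_once[OF assms] by blast
      thus "r \<in> (\<lambda>Y. THE r. (X, Y, r) \<in> AL j l) ` VT j l X"
        using AL_VS[OF Y] by (intro image_eqI[of _ _ Y]) (simp_all add: VT_def)
    qed
  qed (simp add: finite_VT)
  also have "\<dots> \<le> card (VT j l X)" by (rule card_image_le[OF finite_VT])
  finally show ?thesis .
qed

lemma VS_mono: "j < I \<Longrightarrow> (X, Y) \<in> VS j l \<Longrightarrow> (X, Y) \<in> VS j 0"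
  by (induction l) (blast dest: VS_Suc)+

text \<open>All phases are charged at once, since \<open>AL_once\<close> forbids a second row even
  in another phase. The later sum over the phases therefore costs no factor
  \<open>A\<close>.\<close>

lemma UH_le_VH:
  assumes "j < I" shows "card {(l, r). r \<in> UH j l Y} \<le> card (VH j Y)"
    and "finite {(l, r). r \<in> UH j l Y}"
proof -
  have sub: "{(l, r). r \<in> UH j l Y} \<subseteq> (\<lambda>X. THE p. (X, Y, snd p) \<in> AL j (fst p)) ` VH j Y"
  proof
    fix p assume "p \<in> {(l, r). r \<in> UH j l Y}"
    then obtain X where X: "(X, Y, snd p) \<in> AL j (fst p)" by (auto simp: UH_def)
    hence "(THE p. (X, Y, snd p) \<in> AL j (fst p)) = p"
      using AL_once[OF assms X] by (intro the_equality) (blast intro: prod_eqI sym)+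
    thus "p \<in> (\<lambda>X. THE p. (X, Y, snd p) \<in> AL j (fst p)) ` VH j Y"
      using VS_mono[OF assms, of X Y "fst p"] AL_VS[OF X]
      by (intro image_eqI[of _ _ X]) (simp_all add: VH_def)
  qed
  show "finite {(l, r). r \<in> UH j l Y}"
    by (rule finite_subset[OF sub]) (simp add: finite_VH)
  have "card {(l, r). r \<in> UH j l Y} \<le> card ((\<lambda>X. THE p. (X, Y, snd p) \<in> AL j (fst p)) ` VH j Y)"
    by (rule card_mono[OF _ sub]) (simp add: finite_VH)
  also have "\<dots> \<le> card (VH j Y)" by (rule card_image_le[OF finite_VH])
  finally show "card {(l, r). r \<in> UH j l Y} \<le> card (VH j Y)" .
qed

lemma UH_le: assumes "j < I" shows "card (UH j l Y) \<le> card (VH j Y)"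
proof -
  have "card (UH j l Y) = card (Pair l ` UH j l Y)"
    by (rule card_image[symmetric]) (auto intro: inj_onI)
  also have "\<dots> \<le> card {(l, r). r \<in> UH j l Y}"
    by (rule card_mono[OF UH_le_VH(2)[OF assms]]) auto
  also have "\<dots> \<le> card (VH j Y)" by (rule UH_le_VH(1)[OF assms])
  finally show ?thesis .
qed

text \<open>\<open>2 ^ j * R j = 2 * K * 2 ^ I \<ge> 40 * T0\<close>. Here 40 is 10, the density
  demanded by \<open>spread\<close>, times 4, the constant for heads; this is the origin of the 20
  in \<open>T0K\<close>.\<close>

lemma R_ge:
  assumes "j < I" "2 ^ j * c \<le> 4 * T0" shows "10 * c \<le> R j"
proof -
  have p: "(2::nat) ^ I = 2 ^ j * E j"
    using assms by (simp add: epochs_def flip: power_add)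
  have "2 ^ j * (10 * c) \<le> 40 * T0" using assms(2) by (simp add: mult_ac)
  also have "\<dots> \<le> 2 * (K * 2 ^ I)" using T0K by simp
  also have "\<dots> = 2 ^ j * R j" using assms(1) unfolding p by (simp add: R_def M_def)
  finally show ?thesis by simp
qed

text \<open>A pair enters the next phase only if at least half of its common rows are in use at the
  tail. \<open>spread\<close> limits such pairs to 1/32 of the number of these rows, which in turn
  is at most the number of pairs of the phase.\<close>

lemma phases_aux:
  assumes "j < I" and t: "\<And>X. 2 ^ j * card (VT j 0 X) \<le> T0"
  shows "32 ^ l * card (VT j l X) \<le> card (VT j 0 X)"
proof (induction l)
  case (Suc l)
  show ?case
  proof (cases "VT j (Suc l) X = {}")
    case False
    then obtain Y where "(X, Y) \<in> VS j (Suc l)" by (auto simp: VT_def)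
    hence X: "isvv j X" using VS_vv by blast
    have mono: "card (VT j l X) \<le> card (VT j 0 X)"
      by (rule card_mono[OF finite_VT]) (unfold VT_def, blast dest: VS_mono[OF assms(1)])
    have le: "card (UT j l X) \<le> card (VT j 0 X)"
      using UT_le_VT[OF assms(1)] mono le_trans by blast
    have c10: "10 * card (UT j l X) \<le> R j"
    proof (rule R_ge[OF assms(1)])
      have "2 ^ j * card (UT j l X) \<le> 2 ^ j * card (VT j 0 X)" using le by simp
      also have "\<dots> \<le> 4 * T0" using t[of X] by simp
      finally show "2 ^ j * card (UT j l X) \<le> 4 * T0" .
    qed
    have "VT j (Suc l) X \<subseteq> {Y. isvv j Y \<and> fst Y \<noteq> fst X \<and>
      card (common j X Y) \<le> 2 * card (common j X Y \<inter> UT j l X)}"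
    proof
      fix Y assume "Y \<in> VT j (Suc l) X"
      hence "(X, Y) \<in> VS j (Suc l)" by (simp add: VT_def)
      from VS_Suc[OF assms(1) this] VS_vv[OF this]
      show "Y \<in> {Y. isvv j Y \<and> fst Y \<noteq> fst X \<and>
        card (common j X Y) \<le> 2 * card (common j X Y \<inter> UT j l X)}"
        by (simp add: UT_def)
    qed
    hence "card (VT j (Suc l) X) \<le> card {Y. isvv j Y \<and> fst Y \<noteq> fst X \<and>
      card (common j X Y) \<le> 2 * card (common j X Y \<inter> UT j l X)}"
      by (rule card_mono[rotated]) (rule finite_subset[OF _ finite_isvv[of j]], auto)
    moreover have "32 * card {Y. isvv j Y \<and> fst Y \<noteq> fst X \<and>
      card (common j X Y) \<le> 2 * card (common j X Y \<inter> UT j l X)} \<le> card (UT j l X)"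
      by (rule tail_blocked_card[OF assms(1) X _ c10]) (unfold UT_def, blast dest: AL_VS)
    ultimately have "32 * card (VT j (Suc l) X) \<le> card (VT j l X)"
      using UT_le_VT[OF assms(1), of l X] by linarith
    hence "32 ^ l * (32 * card (VT j (Suc l) X)) \<le> 32 ^ l * card (VT j l X)"
      by (rule mult_left_mono) simp
    also note Suc
    finally show ?thesis by (simp add: mult_ac)
  qed simp
qed simp

lemma no_phase_A:
  assumes "j < I" and t: "\<And>X. 2 ^ j * card (VT j 0 X) \<le> T0"
  shows "VS j A = {}"
proof -
  have "VT j A X = {}" for X
  proof (rule ccontr)
    assume "VT j A X \<noteq> {}"
    hence "1 \<le> card (VT j A X)" using finite_VT by (simp add: Suc_le_eq card_gt_0_iff)
    hence "32 ^ A * 1 \<le> 32 ^ A * card (VT j A X)" by (intro mult_left_mono) auto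
    also have "\<dots> \<le> card (VT j 0 X)" by (rule phases_aux[OF assms])
    also have "\<dots> \<le> 2 ^ j * card (VT j 0 X)" by simp
    also have "\<dots> \<le> T0" by (rule t)
    finally show False using T0A by simp
  qed
  thus ?thesis by (auto simp: VT_def)
qed

definition HB :: "nat \<Rightarrow> vv \<Rightarrow> vv set" where
  "HB j Y = {X. isvv j X \<and> fst X \<noteq> fst Y \<and>
     (\<exists>l. card (common j X Y) \<le> 2 * card (common j X Y \<inter> UH j l Y))}"

text \<open>Summing over the phases is harmless, because rows in use in different phases belong to
  different pairs. A phase with no row in use at \<open>Y\<close> blocks nobody there, which leaves
  a finite union.\<close>

lemma HB_card:
  assumes "j < I" "isvv j Y" and b: "2 ^ j * card (VH j Y) \<le> 4 * T0"
  shows "32 * card (HB j Y) \<le> card (VH j Y)"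
proof -
  let ?P = "{(l, r). r \<in> UH j l Y}"
  let ?L = "fst ` ?P"
  define S where "S l = {X. isvv j X \<and> fst X \<noteq> fst Y \<and>
     card (common j X Y) \<le> 2 * card (common j X Y \<inter> UH j l Y)}" for l
  have fP: "finite ?P" by (rule UH_le_VH(2)[OF assms(1)])
  have fS: "finite (S l)" for l
    by (rule finite_subset[OF _ finite_isvv[of j]]) (auto simp: S_def)
  have c10: "10 * card (UH j l Y) \<le> R j" for l
  proof (rule R_ge[OF assms(1)])
    have "2 ^ j * card (UH j l Y) \<le> 2 ^ j * card (VH j Y)" using UH_le[OF assms(1)] by simp
    also note b
    finally show "2 ^ j * card (UH j l Y) \<le> 4 * T0" .
  qed
  have S: "32 * card (S l) \<le> card (UH j l Y)" for l
    unfolding S_def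
    by (rule head_blocked_card[OF assms(1,2) _ c10]) (unfold UH_def, blast dest: AL_VS)
  have "HB j Y \<subseteq> (\<Union>l\<in>?L. S l)"
  proof
    fix X assume "X \<in> HB j Y"
    then obtain l where l: "X \<in> S l" by (auto simp: HB_def S_def)
    have "l \<in> ?L"
    proof (rule ccontr)
      assume "l \<notin> ?L"
      hence "UH j l Y = {}" by force
      hence "card (S l) = 0" using S[of l] by simp
      thus False using l fS by auto
    qed
    thus "X \<in> (\<Union>l\<in>?L. S l)" using l by blast
  qed
  hence "card (HB j Y) \<le> card (\<Union>l\<in>?L. S l)"
    by (rule card_mono[rotated]) (auto simp: fS fP)
  also have "\<dots> \<le> (\<Sum>l\<in>?L. card (S l))"
    by (rule card_UN_le) (simp add: fP)
  finally have "32 * card (HB j Y) \<le> (\<Sum>l\<in>?L. 32 * card (S l))"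
    by (simp add: sum_distrib_left[symmetric])
  also have "\<dots> \<le> (\<Sum>l\<in>?L. card (UH j l Y))" by (rule sum_mono) (rule S)
  also have "\<dots> = card (SIGMA l:?L. UH j l Y)"
  proof (rule card_SigmaI[symmetric])
    show "\<forall>l\<in>?L. finite (UH j l Y)"
    proof
      fix l
      have "UH j l Y \<subseteq> snd ` ?P" by force
      thus "finite (UH j l Y)" using fP finite_subset by blast
    qed
  qed (simp add: fP)
  also have "(SIGMA l:?L. UH j l Y) = ?P" by force
  also have "card ?P \<le> card (VH j Y)" by (rule UH_le_VH(1)[OF assms(1)])
  finally show ?thesis .
qed

text \<open>Let \<open>t = T0 / 2 ^ j\<close>. At a head, exhaustion loses at most
  \<open>T j / B j = t / 8\<close> pairs and blocking at most \<open>4 * t / 32 = t / 8\<close>. Two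
  merging epochs give \<open>t / 2\<close>, just what a tail of the next level is allowed. A new
  head inherits two tail bounds, and \<open>2 * t = 4 * (t / 2)\<close>. This explains the factor 8
  in \<open>B\<close>, the 32 in \<open>spread\<close> and the 4 here.\<close>

lemma bounds: "j \<le> I \<Longrightarrow> 2 ^ j * card (VT j 0 X) \<le> T0 \<and> 2 ^ j * card (VH j X) \<le> 4 * T0"
proof (induction j arbitrary: X)
  case 0
  have fin: "finite {Y. (X, Y) \<in> VS 0 0 \<or> (Y, X) \<in> VS 0 0}"
    by (rule finite_subset[OF _ finite_isvv[of 0]]) (blast dest: VS_vv)
  have "card (VT 0 0 X) \<le> T0" "card (VH 0 X) \<le> T0"
    using VS_0[of X] card_mono[OF fin, of "VT 0 0 X"] card_mono[OF fin, of "VH 0 X"]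
    by (fastforce simp: VT_def VH_def)+
  thus ?case by simp
next
  case (Suc j)
  hence j: "j < I" by simp
  have IH: "2 ^ j * card (VT j 0 X) \<le> T0" "2 ^ j * card (VH j X) \<le> 4 * T0" for X
    using Suc by auto
  have noA: "VS j A = {}" by (rule no_phase_A[OF j IH(1)])
  let ?hf = "map_prod id (\<lambda>e. e div 2) :: vv \<Rightarrow> vv"
  define XH where "XH Y = {X'. \<exists>l r. (X', Y, r) \<in> AL j l \<and> B j \<le> cn j l X' r}" for Y
  have four: "(4::nat) ^ j = 2 ^ j * 2 ^ j" by (simp flip: power_mult_distrib)
  \<comment> \<open>An epoch of the next level is the union of two epochs of this one.\<close>
  have pre: "Y' = (fst X, 2 * snd X) \<or> Y' = (fst X, Suc (2 * snd X))" if "X = ?hf Y'" for X Y'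
    using that by (cases Y') (auto simp: map_prod_def)
  show ?case
  proof
    define G where "G Y = XH Y \<union> (if isvv j Y then HB j Y else {})" for Y
    have fXH: "finite (XH Y)" for Y
      by (rule finite_subset[OF _ finite_isvv[of j]]) (unfold XH_def, blast dest: AL_VS VS_vv)
    have fHB: "finite (HB j Y)" for Y
      by (rule finite_subset[OF _ finite_isvv[of j]]) (auto simp: HB_def)
    have fG: "finite (G Y)" for Y using fXH fHB by (simp add: G_def)
    have cG: "2 ^ j * 4 * card (G Y) \<le> T0" for Y
    proof -
      have "B j * card (XH Y) \<le> T j"
      proof -
        let ?Z = "{(l, X', Y', r). (X', Y', r) \<in> AL j l \<and> (X' = Y \<or> Y' = Y) \<and> B j \<le> cn j l X' r}"
        have "?Z \<subseteq> {..<A} \<times> {X. isvv j X} \<times> {X. isvv j X} \<times> {..<R j}"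
        proof
          fix z assume "z \<in> ?Z"
          then obtain l X' Y' r where z: "z = (l, X', Y', r)" "(X', Y', r) \<in> AL j l" by blast
          show "z \<in> {..<A} \<times> {X. isvv j X} \<times> {X. isvv j X} \<times> {..<R j}"
            using AL_VS[OF z(2)] VS_vv z(1) by simp blast
        qed
        hence fZ: "finite ?Z"
          by (rule finite_subset) (simp add: finite_isvv)
        have "XH Y \<subseteq> (\<lambda>(l, X', Y', r). X') ` ?Z"
        proof
          fix X' assume "X' \<in> XH Y"
          then obtain l r where "(X', Y, r) \<in> AL j l" "B j \<le> cn j l X' r" by (auto simp: XH_def)
          thus "X' \<in> (\<lambda>(l, X', Y', r). X') ` ?Z" by (intro image_eqI[of _ _ "(l, X', Y, r)"]) simp_all
        qed
        hence "card (XH Y) \<le> card ?Z"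
          using surj_card_le[OF fZ] by blast
        hence "B j * card (XH Y) \<le> B j * card ?Z" by simp
        also have "\<dots> \<le> T j" by (rule exh)
        finally show ?thesis .
      qed
      hence "2 ^ j * (2 ^ j * (8 * card (XH Y))) \<le> 2 ^ j * T0"
        by (simp add: B_def T_def four mult_ac)
      hence 1: "2 ^ j * (8 * card (XH Y)) \<le> T0" by simp
      have 2: "2 ^ j * (8 * card (HB j Y)) \<le> T0" if Y: "isvv j Y"
      proof -
        have "2 ^ j * (32 * card (HB j Y)) \<le> 2 ^ j * card (VH j Y)"
          using HB_card[OF j Y IH(2)] by simp
        also have "\<dots> \<le> 4 * T0" by (rule IH)
        finally show ?thesis by simp
      qed
      have "card (G Y) \<le> card (XH Y) + (if isvv j Y then card (HB j Y) else 0)"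
        using card_Un_le[of "XH Y" "HB j Y"] by (simp add: G_def)
      hence "2 ^ j * (8 * card (G Y)) \<le> 2 ^ j * (8 * (card (XH Y) + (if isvv j Y then card (HB j Y) else 0)))"
        by simp
      also have "\<dots> \<le> 2 * T0" using 1 2 by (cases "isvv j Y") (simp_all add: algebra_simps)
      finally show ?thesis by (simp add: mult_ac)
    qed
    let ?Y0 = "(fst X, 2 * snd X)" and ?Y1 = "(fst X, Suc (2 * snd X))"
    \<comment> \<open>The roles are exchanged: the tail \<open>X\<close> was a head of level
      \<open>j\<close>, in epoch \<open>?Y0\<close> or \<open>?Y1\<close>, so its new partners are
      the old tails that failed there.\<close>
    have "VT (Suc j) 0 X \<subseteq> ?hf ` (G ?Y0 \<union> G ?Y1)"
    proof
      fix Z assume "Z \<in> VT (Suc j) 0 X"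
      hence "(X, Z) \<in> VS (Suc j) 0" by (simp add: VT_def)
      from VS_level[OF j this] noA obtain X' Y' where XY: "(X', Y') \<in> VS j 0"
        "Z = ?hf X'" "X = ?hf Y'"
        "(\<exists>l r. (X', Y', r) \<in> AL j l \<and> B j \<le> cn j l X' r) \<or>
        (\<exists>l. card (common j X' Y') \<le> 2 * card (common j X' Y' \<inter> {r. \<exists>X. (X, Y', r) \<in> AL j l}))"
        by blast
      have "X' \<in> G Y'"
        using XY(4) VS_vv[OF XY(1)] by (auto simp: G_def XH_def HB_def UH_def)
      thus "Z \<in> ?hf ` (G ?Y0 \<union> G ?Y1)"
        using XY(2) pre[OF XY(3)] by auto
    qed
    hence "card (VT (Suc j) 0 X) \<le> card (G ?Y0 \<union> G ?Y1)"
      using surj_card_le fG by (meson finite_UnI)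
    also have "\<dots> \<le> card (G ?Y0) + card (G ?Y1)" by (rule card_Un_le)
    finally have "2 ^ j * 4 * card (VT (Suc j) 0 X) \<le> 2 ^ j * 4 * (card (G ?Y0) + card (G ?Y1))"
      by simp
    also have "\<dots> \<le> 2 * T0" using cG[of ?Y0] cG[of ?Y1] by (simp add: algebra_simps)
    finally show "2 ^ Suc j * card (VT (Suc j) 0 X) \<le> T0" by simp
  next
    let ?X0 = "(fst X, 2 * snd X)" and ?X1 = "(fst X, Suc (2 * snd X))"
    have "VH (Suc j) X \<subseteq> ?hf ` (VT j 0 ?X0 \<union> VT j 0 ?X1)"
    proof
      fix Z assume "Z \<in> VH (Suc j) X"
      hence "(Z, X) \<in> VS (Suc j) 0" by (simp add: VH_def)
      from VS_level[OF j this] noA obtain X' Y' where XY: "(X', Y') \<in> VS j 0"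
        "X = ?hf X'" "Z = ?hf Y'"
        by blast
      thus "Z \<in> ?hf ` (VT j 0 ?X0 \<union> VT j 0 ?X1)"
        using pre[OF XY(2)] by (auto simp: VT_def)
    qed
    hence "card (VH (Suc j) X) \<le> card (VT j 0 ?X0 \<union> VT j 0 ?X1)"
      using surj_card_le finite_VT by (meson finite_UnI)
    also have "\<dots> \<le> card (VT j 0 ?X0) + card (VT j 0 ?X1)" by (rule card_Un_le)
    finally have "2 ^ j * card (VH (Suc j) X) \<le> 2 ^ j * (card (VT j 0 ?X0) + card (VT j 0 ?X1))"
      by simp
    also have "\<dots> \<le> 2 * T0" using IH(1)[of ?X0] IH(1)[of ?X1] by (simp add: algebra_simps)
    finally show "2 ^ Suc j * card (VH (Suc j) X) \<le> 4 * T0" by simp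
  qed
qed

end

section \<open>Existence of spread tables\<close>

text \<open>For each \<open>b\<close> at most one \<open>d\<close> in \<open>J\<close> matches, so
  the product is linear in the indicators of the matches; and each \<open>d\<close> is matched by
  exactly \<open>k\<close> of the \<open>b\<close>, one in every period.\<close>

lemma sum_residue_weight:
  fixes c :: real
  assumes M: "M > 0" and J: "J \<subseteq> {..<M}"
  shows "(\<Sum>b<M * k. \<Prod>d\<in>J. if x mod M = (b + d) mod M then c else 1) = real k * (real M + (c - 1) * real (card J))"
proof -
  have fJ: "finite J" using J finite_subset by blast
  define m where "m b d \<longleftrightarrow> x mod M = (b + d) mod M" for b d
  have uniq: "d = d'" if "d \<in> J" "d' \<in> J" "m b d" "m b d'" for b d d'
  proof -
    have "(d + b) mod M = (d' + b) mod M" using that by (simp add: m_def add.commute)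
    hence "d mod M = d' mod M" by (simp add: mod_add_cancel_nat)
    thus ?thesis using that J by (metis lessThan_iff mod_less subsetD)
  qed
  have w: "(\<Prod>d\<in>J. if m b d then c else 1) = 1 + (\<Sum>d\<in>J. if m b d then c - 1 else 0)" for b
  proof (cases "\<exists>d\<in>J. m b d")
    case True
    then obtain d where d: "d \<in> J" "m b d" by blast
    have "(\<Prod>d\<in>J. if m b d then c else 1) = (\<Prod>d'\<in>J. if d' = d then c else 1)"
      using uniq d by (intro prod.cong) auto
    moreover have "(\<Sum>d\<in>J. if m b d then c - 1 else 0) = (\<Sum>d'\<in>J. if d' = d then c - 1 else 0)"
      using uniq d by (intro sum.cong) auto
    ultimately show ?thesis using d fJ by simp
  next
    case False
    thus ?thesis by (auto intro!: sum.neutral prod.neutral)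
  qed
  have cnt: "card {b. b < M * k \<and> m b d} = k" if "d < M" for d
  proof -
    define y where "y = (x + (M - d)) mod M"
    have iff: "m b d \<longleftrightarrow> b mod M = y" for b
    proof -
      have "m b d \<longleftrightarrow> (x + (M - d)) mod M = (b + d + (M - d)) mod M"
        by (simp add: m_def mod_add_cancel_nat)
      also have "b + d + (M - d) = b + M" using that by simp
      finally show ?thesis by (auto simp: y_def)
    qed
    have y: "y < M" using M by (simp add: y_def)
    have "{b. b < M * k \<and> m b d} = (\<lambda>i. i * M + y) ` {..<k}"
    proof (intro equalityI subsetI)
      fix b assume "b \<in> {b. b < M * k \<and> m b d}"
      hence b: "b < M * k" "b mod M = y" using iff by auto
      hence "b div M < k" by (simp add: less_mult_imp_div_less mult.commute)
      moreover have "b = b div M * M + y" using b by (metis div_mult_mod_eq)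
      ultimately show "b \<in> (\<lambda>i. i * M + y) ` {..<k}" by blast
    next
      fix b assume "b \<in> (\<lambda>i. i * M + y) ` {..<k}"
      then obtain i where i: "i < k" "b = i * M + y" by auto
      have "b < Suc i * M" using i y by simp
      also have "\<dots> \<le> k * M" using i by (intro mult_le_mono1) simp
      finally show "b \<in> {b. b < M * k \<and> m b d}" using i y iff by (simp add: mult.commute)
    qed
    moreover have "inj_on (\<lambda>i. i * M + y) {..<k}" using M by (auto intro!: inj_onI)
    ultimately show ?thesis by (simp add: card_image)
  qed
  have "(\<Sum>b<M * k. \<Prod>d\<in>J. if m b d then c else 1) =
      real (M * k) + (\<Sum>b<M * k. \<Sum>d\<in>J. if m b d then c - 1 else 0)"
    by (simp add: w sum.distrib)
  also have "(\<Sum>b<M * k. \<Sum>d\<in>J. if m b d then c - 1 else 0) =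
      (\<Sum>d\<in>J. \<Sum>b<M * k. if m b d then c - 1 else 0)" by (rule sum.swap)
  also have "\<dots> = (\<Sum>d\<in>J. (c - 1) * real k)"
  proof (rule sum.cong)
    fix d assume "d \<in> J"
    hence "d < M" using J by auto
    have "(\<Sum>b<M * k. if m b d then c - 1 else 0) = (\<Sum>b\<in>{b. b < M * k \<and> m b d}. c - 1)"
      by (rule sum.mono_neutral_cong_right) auto
    thus "(\<Sum>b<M * k. if m b d then c - 1 else 0) = (c - 1) * real k"
      using cnt[OF \<open>d < M\<close>] by simp
  qed simp
  finally show ?thesis by (simp add: m_def algebra_simps)
qed

definition bad_at :: "nat \<Rightarrow> nat \<Rightarrow> (nat \<Rightarrow> nat \<Rightarrow> nat) \<Rightarrow> nat \<Rightarrow> nat set \<Rightarrow> (nat \<times> nat) set \<Rightarrow> bool" where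
  "bad_at M R h u U Z \<longleftrightarrow> (\<forall>(v, d)\<in>Z.
     card (agree M R (h u) (h v) d) \<le> 2 * card (agree M R (h u) (h v) d \<inter> U))"

text \<open>The exponential moment \<open>3 ^ (#hits in U) / 3 ^ (#hits outside U)\<close> is at least 1 for a bad table,
  and its mean over all tables factorizes over the entries.\<close>

lemma card_bad_tables:
  assumes M: "M > 0" and u: "u < n" and U: "U \<subseteq> {..<R}" "10 * card U \<le> R"
    and Z: "Z \<subseteq> ({..<n} - {u}) \<times> {..<M}" and R: "R \<le> R0" and k: "k > 0"
  defines "Tab \<equiv> PiE {..<n} (\<lambda>_. PiE {..<R0} (\<lambda>_. {..<M * k}))"
  shows "real (card {h \<in> Tab. bad_at M R h u U Z}) \<le> real (card Tab) * exp (- 0.4 * real R * real (card Z) / real M)"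
proof -
  define cf where "cf r = (if r < R then if r \<in> U then 3 else 1 / 3 else 1 :: real)" for r
  define J where "J v = {d. (v, d) \<in> Z}" for v
  define Row where "Row = PiE {..<R0} (\<lambda>_. {..<M * k})"
  define F where "F g h = (\<Prod>v\<in>{..<n} - {u}. \<Prod>r<R0. \<Prod>d\<in>J v. if g r mod M = (h v r + d) mod M then cf r else 1)"
    for g :: "nat \<Rightarrow> nat" and h :: "nat \<Rightarrow> nat \<Rightarrow> nat"
  have fZ: "finite Z" by (rule finite_subset[OF Z]) simp
  have J: "J v \<subseteq> {..<M}" for v using Z by (auto simp: J_def)
  have fJ: "finite (J v)" for v using J finite_subset by blast
  have ZJ: "Z = Sigma ({..<n} - {u}) J" using Z by (auto simp: J_def)
  have cf0: "cf r > 0" for r by (simp add: cf_def)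
  have fRow: "finite Row" and cRow: "card Row = (M * k) ^ R0"
    by (auto simp: Row_def card_PiE intro!: finite_PiE)
  have fTab: "finite Tab" and cTab: "card Tab = card Row ^ n"
    using fRow by (auto simp: Tab_def Row_def[symmetric] card_PiE intro!: finite_PiE)
  have F1: "F (h u) h \<ge> 1" if "bad_at M R h u U Z" for h
  proof -
    define a where "a v d = (\<Prod>r<R0. if h u r mod M = (h v r + d) mod M then cf r else 1)" for v d
    have a1: "a v d \<ge> 1" if "(v, d) \<in> Z" for v d
    proof -
      let ?A = "agree M R (h u) (h v) d"
      have fA: "finite ?A" by (simp add: agree_def)
      have "a v d = (\<Prod>r\<in>?A. cf r)"
        unfolding a_def using R by (intro prod.mono_neutral_cong_right) (auto simp: agree_def cf_def)
      also have "\<dots> = (\<Prod>r\<in>?A \<inter> U. 3) * (\<Prod>r\<in>?A - U. 1 / 3)"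
      proof -
        have "(\<Prod>r\<in>?A. cf r) = (\<Prod>r\<in>?A \<inter> U. cf r) * (\<Prod>r\<in>?A - U. cf r)"
          by (rule prod.Int_Diff[OF fA])
        also have "(\<Prod>r\<in>?A \<inter> U. cf r) = (\<Prod>r\<in>?A \<inter> U. 3)"
          by (rule prod.cong) (auto simp: agree_def cf_def)
        also have "(\<Prod>r\<in>?A - U. cf r) = (\<Prod>r\<in>?A - U. 1 / 3)"
          by (rule prod.cong) (auto simp: agree_def cf_def)
        finally show ?thesis .
      qed
      also have "\<dots> = 3 ^ card (?A \<inter> U) * (1 / 3) ^ card (?A - U)" by simp
      finally have e: "a v d = 3 ^ card (?A \<inter> U) / 3 ^ card (?A - U)" by (simp add: power_divide)
      have "card ?A = card (?A \<inter> U) + card (?A - U)"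
        using fA by (metis card_Int_Diff)
      moreover have "card ?A \<le> 2 * card (?A \<inter> U)" using \<open>bad_at M R h u U Z\<close> that by (auto simp: bad_at_def)
      \<comment> \<open>A blocked partner has at least as many agreements inside \<open>U\<close> as
        outside, so its weights 3 and 1/3 multiply to at least 1.\<close>
      ultimately have "card (?A - U) \<le> card (?A \<inter> U)" by linarith
      hence "(3::real) ^ card (?A - U) \<le> 3 ^ card (?A \<inter> U)" by (intro power_increasing) auto
      thus ?thesis by (simp add: e)
    qed
    have "F (h u) h = (\<Prod>v\<in>{..<n} - {u}. \<Prod>d\<in>J v. a v d)"
      unfolding F_def a_def by (intro prod.cong refl prod.swap)
    also have "\<dots> \<ge> 1"
      using a1 by (intro prod_ge_1) (auto simp: J_def)
    finally show ?thesis .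
  qed
  have F0: "F g h \<ge> 0" for g h
    unfolding F_def by (intro prod_nonneg) (auto intro: less_imp_le[OF cf0])
  have rowsum: "(\<Sum>w\<in>Row. \<Prod>r<R0. \<Prod>d\<in>J v. if g r mod M = (w r + d) mod M then cf r else 1) \<le>
      real (card Row) * exp (- 0.4 * real R * real (card (J v)) / real M)" for g v
  proof -
    have "(\<Sum>w\<in>Row. \<Prod>r<R0. \<Prod>d\<in>J v. if g r mod M = (w r + d) mod M then cf r else 1) =
      (\<Prod>r<R0. \<Sum>b<M * k. \<Prod>d\<in>J v. if g r mod M = (b + d) mod M then cf r else 1)"
      unfolding Row_def by (rule prod_sum_PiE[symmetric]) auto
    also have "\<dots> = (\<Prod>r<R0. real k * (real M + (cf r - 1) * real (card (J v))))"
      by (intro prod.cong refl sum_residue_weight[OF M J])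
    also have "\<dots> \<le> (\<Prod>r<R0. real (M * k) * exp ((cf r - 1) * real (card (J v)) / real M))"
    proof (rule prod_mono, intro conjI)
      fix r
      have cJ: "card (J v) \<le> M" using card_mono[OF _ J, of v] by simp
      have "(cf r - 1) * real (card (J v)) \<ge> - 1 * real (card (J v))"
        using cf0[of r] by (intro mult_right_mono) auto
      hence "real M + (cf r - 1) * real (card (J v)) \<ge> 0" using cJ by simp
      thus "0 \<le> real k * (real M + (cf r - 1) * real (card (J v)))" by simp
      have "1 + (cf r - 1) * real (card (J v)) / real M \<le> exp ((cf r - 1) * real (card (J v)) / real M)"
        by (rule exp_ge_add_one_self)
      hence "real (M * k) * (1 + (cf r - 1) * real (card (J v)) / real M) \<le>
        real (M * k) * exp ((cf r - 1) * real (card (J v)) / real M)"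
        by (intro mult_left_mono) auto
      moreover have "real (M * k) * (1 + (cf r - 1) * real (card (J v)) / real M) =
        real k * (real M + (cf r - 1) * real (card (J v)))"
        using M by (simp add: distrib_left)
      ultimately show "real k * (real M + (cf r - 1) * real (card (J v))) \<le>
        real (M * k) * exp ((cf r - 1) * real (card (J v)) / real M)" by linarith
    qed
    also have "\<dots> = real (card Row) * exp ((\<Sum>r<R0. cf r - 1) * real (card (J v)) / real M)"
      by (simp add: prod.distrib cRow exp_sum[symmetric] sum_distrib_right sum_divide_distrib)
    also have "(\<Sum>r<R0. cf r - 1) = (\<Sum>r<R. cf r - 1)"
      using R by (intro sum.mono_neutral_right) (auto simp: cf_def)
    also have "\<dots> = (\<Sum>r<R. (if r \<in> U then 8 / 3 else 0) - 2 / 3)"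
      by (intro sum.cong) (auto simp: cf_def)
    also have "\<dots> = 8 / 3 * real (card U) - 2 / 3 * real R"
    proof -
      have "(\<Sum>r<R. (if r \<in> U then 8 / 3 else 0 :: real)) = (\<Sum>r\<in>U. 8 / 3)"
        using U by (intro sum.mono_neutral_cong_right) auto
      thus ?thesis by (simp add: sum_subtractf)
    qed
    also have "real (card Row) * exp ((8 / 3 * real (card U) - 2 / 3 * real R) * real (card (J v)) / real M) \<le>
        real (card Row) * exp (- 0.4 * real R * real (card (J v)) / real M)"
    proof -
      have "10 * real (card U) \<le> real R" using U(2) by linarith
      \<comment> \<open>From \<open>card U \<le> R / 10\<close>:
        \<open>8/3 * 1/10 - 2/3 = - 0.4\<close>. The 10 in \<open>spread\<close> is what makes the
        exponent negative.\<close>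
      hence "8 / 3 * real (card U) - 2 / 3 * real R \<le> - 0.4 * real R" by linarith
      hence "(8 / 3 * real (card U) - 2 / 3 * real R) * real (card (J v)) / real M \<le>
        - 0.4 * real R * real (card (J v)) / real M"
        by (intro divide_right_mono mult_right_mono) auto
      thus ?thesis by (intro mult_left_mono) auto
    qed
    finally show ?thesis .
  qed
  \<comment> \<open>The row of \<open>u\<close> is split off: once it is fixed, the entries of the
    other vertices vary independently and the mean factorizes.\<close>
  have Tab_eq: "Tab = (\<lambda>(g, h). h(u := g)) ` (Row \<times> PiE ({..<n} - {u}) (\<lambda>_. Row))"
  proof -
    have "{..<n} = insert u ({..<n} - {u})" using u by auto
    hence "Tab = PiE (insert u ({..<n} - {u})) (\<lambda>_. Row)" by (simp add: Tab_def Row_def)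
    thus ?thesis by (simp only: PiE_insert_eq)
  qed
  have inj: "inj_on (\<lambda>(g, h). h(u := g)) (Row \<times> PiE ({..<n} - {u}) (\<lambda>_. Row))"
    using inj_combinator[of u "{..<n} - {u}" "\<lambda>_. Row"] by simp
  have Fupd: "F g (h(u := g)) = F g h" for g h
    unfolding F_def by (intro prod.cong refl) auto
  have "real (card {h \<in> Tab. bad_at M R h u U Z}) = (\<Sum>h\<in>{h \<in> Tab. bad_at M R h u U Z}. 1)" by simp
  also have "\<dots> \<le> (\<Sum>h\<in>{h \<in> Tab. bad_at M R h u U Z}. F (h u) h)"
    by (rule sum_mono) (use F1 in auto)
  also have "\<dots> \<le> (\<Sum>h\<in>Tab. F (h u) h)"
    by (rule sum_mono2[OF fTab]) (auto intro: F0)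
  also have "\<dots> = (\<Sum>(g, h)\<in>Row \<times> PiE ({..<n} - {u}) (\<lambda>_. Row). F g h)"
    unfolding Tab_eq by (subst sum.reindex[OF inj]) (simp add: case_prod_beta Fupd)
  also have "\<dots> = (\<Sum>g\<in>Row. \<Sum>h\<in>PiE ({..<n} - {u}) (\<lambda>_. Row). F g h)"
    by (simp add: sum.cartesian_product)
  also have "\<dots> = (\<Sum>g\<in>Row. \<Prod>v\<in>{..<n} - {u}. \<Sum>w\<in>Row. \<Prod>r<R0. \<Prod>d\<in>J v.
      if g r mod M = (w r + d) mod M then cf r else 1)"
    unfolding F_def by (intro sum.cong refl prod_sum_PiE[symmetric]) (auto simp: fRow)
  also have "\<dots> \<le> (\<Sum>g\<in>Row. \<Prod>v\<in>{..<n} - {u}. real (card Row) * exp (- 0.4 * real R * real (card (J v)) / real M))"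
    using rowsum by (intro sum_mono prod_mono conjI sum_nonneg prod_nonneg) (auto intro: less_imp_le[OF cf0])
  also have "\<dots> = real (card Tab) * exp (\<Sum>v\<in>{..<n} - {u}. - 0.4 * real R * real (card (J v)) / real M)"
  proof -
    have "card Row * card Row ^ (n - 1) = card Tab"
      using u cTab by (cases n) auto
    hence "real (card Row) * real (card Row) ^ (n - 1) = real (card Tab)"
      by (metis of_nat_mult of_nat_power)
    thus ?thesis using u by (simp add: prod.distrib exp_sum)
  qed
  also have "(\<Sum>v\<in>{..<n} - {u}. - 0.4 * real R * real (card (J v)) / real M) =
      - 0.4 * real R * real (card Z) / real M"
  proof -
    have "card Z = (\<Sum>v\<in>{..<n} - {u}. card (J v))"
      unfolding ZJ by (rule card_SigmaI) (auto simp: fJ)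
    thus ?thesis by (simp add: sum_distrib_left sum_divide_distrib)
  qed
  finally show ?thesis .
qed

text \<open>A union bound over \<open>u\<close>, a set \<open>U\<close> of \<open>q\<close> rows and
  a set \<open>Z\<close> of \<open>q div 32 + 1\<close> blocked partners, one too many for
  \<open>spread\<close>. There are at most \<open>R0 ^ (32 * m q)\<close> sets \<open>U\<close>, so
  each element of \<open>Z\<close> has to pay for 32 rows, which its factor
  \<open>exp (- 0.4 * K)\<close> outweighs. Entries range over \<open>2 ^ (I + 1)\<close> values, a
  multiple of every modulus, so one table serves all levels.\<close>

lemma spread_exists:
  fixes n I K :: nat
  assumes n: "n \<ge> 1" and K: "K > 0"
  defines "R0 \<equiv> 2 * 2 ^ I * K"
  assumes small: "real I * real n * real (R0 + 1) * (real R0 ^ 32 * real n * 2 ^ (I + 1)) * exp (- 0.4 * real K) < 1"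
  shows "\<exists>h. (\<forall>v<n. \<forall>r<R0. h v r < 2 ^ (I + 1)) \<and>
    (\<forall>j<I. spread n (2 * epochs I j) (2 * epochs I j * K) h)"
proof (cases "I = 0")
  case True
  thus ?thesis by (intro exI[of _ "\<lambda>_ _. 0"]) simp
next
  case False
  define Tab where "Tab = PiE {..<n} (\<lambda>_. PiE {..<R0} (\<lambda>_. {..<(2::nat) ^ (I + 1)}))"
  define e where "e = real R0 ^ 32 * real n * 2 ^ (I + 1) * exp (- 0.4 * real K)"
  have R0: "R0 \<ge> 1" using K by (simp add: R0_def)
  have e0: "e \<ge> 0" by (simp add: e_def)
  have small': "real I * real n * real (R0 + 1) * e < 1" using small by (simp add: e_def mult_ac)
  have e1: "e \<le> 1"
  proof -
    have "1 * 1 * 1 * e \<le> real I * real n * real (R0 + 1) * e"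
      using False n e0 by (intro mult_mono) auto
    thus ?thesis using small' by simp
  qed
  have fTab: "finite Tab" by (auto simp: Tab_def intro!: finite_PiE)
  have neTab: "Tab \<noteq> {}" by (auto simp: Tab_def PiE_eq_empty_iff lessThan_empty_iff)
  have cTab: "card Tab > 0" using fTab neTab by (simp add: card_gt_0_iff)
  have bad_j: "real (card {h \<in> Tab. \<not> spread n (2 * epochs I j) (2 * epochs I j * K) h}) \<le>
      real n * real (R0 + 1) * (e * real (card Tab))" if j: "j < I" for j
  proof -
    define M where "M = 2 * epochs I j"
    define R where "R = M * K"
    have M: "M > 0" "M * 2 ^ j = 2 ^ (I + 1)" using j by (simp_all add: M_def epochs_def flip: power_add)
    have Mle: "M \<le> 2 ^ (I + 1)" using M(2) by (metis le_add1 mult.right_neutral mult_le_mono2 one_le_numeral one_le_power)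
    have R: "R \<le> R0" "R \<ge> 1"
      using Mle mult_le_mono1[OF Mle, of K] K M(1) by (auto simp: R_def R0_def Suc_le_eq)
    define m where "m q = q div 32 + 1" for q :: nat
    define P where "P u q = {U. U \<subseteq> {..<R} \<and> card U = q \<and> 10 * q \<le> R} \<times>
       {Z. Z \<subseteq> ({..<n} - {u}) \<times> {..<M} \<and> card Z = m q}" for u q
    define Bd where "Bd u p = {h \<in> Tab. bad_at M R h u (fst p) (snd p)}" for u p
    have fP: "finite (P u q)" for u q
    proof -
      have "finite {U. U \<subseteq> {..<R} \<and> card U = q \<and> 10 * q \<le> R}"
        by (rule finite_subset[of _ "Pow {..<R}"]) auto
      moreover have "finite {Z. Z \<subseteq> ({..<n} - {u}) \<times> {..<M} \<and> card Z = m q}"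
        by (rule finite_subset[of _ "Pow (({..<n} - {u}) \<times> {..<M})"]) auto
      ultimately show ?thesis unfolding P_def by (rule finite_cartesian_product)
    qed
    have cP: "card (P u q) \<le> R0 ^ (32 * m q) * (n * 2 ^ (I + 1)) ^ m q" for u q
    proof -
      have "card {U. U \<subseteq> {..<R} \<and> card U = q \<and> 10 * q \<le> R} \<le> card {U. U \<subseteq> {..<R} \<and> card U = q}"
        by (rule card_mono) (auto intro: finite_subset[of _ "Pow {..<R}"])
      also have "\<dots> = R choose q" by (simp add: n_subsets)
      also have "\<dots> \<le> R0 ^ (32 * m q)"
      proof (cases "q \<le> R")
        case True
        have "R choose q \<le> R ^ q" by (rule binomial_le_pow[OF True])
        also have "\<dots> \<le> R0 ^ q" using R by (intro power_mono) auto
        also have "\<dots> \<le> R0 ^ (32 * m q)"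
          using R0 by (intro power_increasing) (auto simp: m_def)
        finally show ?thesis .
      qed (simp add: binomial_eq_0)
      finally have 1: "card {U. U \<subseteq> {..<R} \<and> card U = q \<and> 10 * q \<le> R} \<le> R0 ^ (32 * m q)" .
      let ?S = "({..<n} - {u}) \<times> {..<M}"
      have "card {Z. Z \<subseteq> ?S \<and> card Z = m q} = card ?S choose m q" by (simp add: n_subsets)
      also have "\<dots> \<le> card ?S ^ m q"
        by (cases "m q \<le> card ?S") (simp_all add: binomial_le_pow binomial_eq_0 del: card_cartesian_product)
      also have "\<dots> \<le> (n * 2 ^ (I + 1)) ^ m q"
      proof (rule power_mono)
        have "card ?S = card ({..<n} - {u}) * M" by simp
        also have "\<dots> \<le> n * 2 ^ (I + 1)"
          using Mle card_mono[of "{..<n}" "{..<n} - {u}"] by (intro mult_le_mono) auto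
        finally show "card ?S \<le> n * 2 ^ (I + 1)" .
      qed simp
      finally have 2: "card {Z. Z \<subseteq> ?S \<and> card Z = m q} \<le> (n * 2 ^ (I + 1)) ^ m q" .
      show ?thesis unfolding P_def card_cartesian_product by (rule mult_le_mono[OF 1 2])
    qed
    have cB: "real (card (Bd u p)) \<le> real (card Tab) * exp (- 0.4 * real K) ^ m q"
      if "p \<in> P u q" "u < n" for u p q
    proof -
      have p: "fst p \<subseteq> {..<R}" "10 * card (fst p) \<le> R" "snd p \<subseteq> ({..<n} - {u}) \<times> {..<M}" "card (snd p) = m q"
        using that by (auto simp: P_def)
      have "real (card (Bd u p)) \<le> real (card Tab) * exp (- 0.4 * real R * real (card (snd p)) / real M)"
        unfolding Bd_def Tab_def M(2)[symmetric]
        by (rule card_bad_tables[OF M(1) that(2) p(1,2,3) R(1)]) simp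
      also have "- 0.4 * real R * real (card (snd p)) / real M = real (m q) * (- 0.4 * real K)"
        using M(1) p(4) by (simp add: R_def)
      finally show ?thesis by (simp add: exp_of_nat_mult[symmetric])
    qed
    have cq: "real (\<Sum>p\<in>P u q. card (Bd u p)) \<le> e * real (card Tab)" if "u < n" for u q
    proof -
      have "real (\<Sum>p\<in>P u q. card (Bd u p)) = (\<Sum>p\<in>P u q. real (card (Bd u p)))" by simp
      also have "\<dots> \<le> real (card (P u q)) * (real (card Tab) * exp (- 0.4 * real K) ^ m q)"
        using cB[OF _ that] by (intro sum_bounded_above) auto
      also have "\<dots> \<le> real (R0 ^ (32 * m q) * (n * 2 ^ (I + 1)) ^ m q) * (real (card Tab) * exp (- 0.4 * real K) ^ m q)"
        by (intro mult_right_mono) (simp_all only: of_nat_le_iff cP, simp)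
      also have "\<dots> = e ^ m q * real (card Tab)"
      proof -
        have "real R0 ^ (32 * m q) = (real R0 ^ 32) ^ m q" by (rule power_mult)
        thus ?thesis by (simp add: e_def power_mult_distrib mult.assoc mult.left_commute mult.commute[of "real (card Tab)"])
      qed
      \<comment> \<open>As \<open>e \<le> 1\<close>, the worst case is a single element in
        \<open>Z\<close>; the bound becomes independent of \<open>q\<close>.\<close>
      also have "\<dots> \<le> e ^ 1 * real (card Tab)"
        using e0 e1 by (intro mult_right_mono power_decreasing) (auto simp: m_def)
      finally show ?thesis by simp
    qed
    have sub: "{h \<in> Tab. \<not> spread n M R h} \<subseteq> (\<Union>u<n. \<Union>q<R + 1. \<Union>p\<in>P u q. Bd u p)"
    proof
      fix h assume h: "h \<in> {h \<in> Tab. \<not> spread n M R h}"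
      then obtain u U where u: "u < n" "U \<subseteq> {..<R}" "10 * card U \<le> R"
        "card U < 32 * card {(v, d). v < n \<and> v \<noteq> u \<and> d < M \<and>
          card (agree M R (h u) (h v) d) \<le> 2 * card (agree M R (h u) (h v) d \<inter> U)}" (is "_ < 32 * card ?Q")
        unfolding spread_def by (auto simp: not_le)
      have "m (card U) \<le> card ?Q" using u(4) by (simp add: m_def)
      then obtain Z where Z: "Z \<subseteq> ?Q" "card Z = m (card U)" by (meson obtain_subset_with_card_n)
      have "card U \<le> R" using card_mono[OF _ u(2)] by simp
      moreover have "(U, Z) \<in> P u (card U)" using u Z by (auto simp: P_def)
      moreover have "h \<in> Bd u (U, Z)" using h Z by (auto simp: Bd_def bad_at_def)
      ultimately show "h \<in> (\<Union>u<n. \<Union>q<R + 1. \<Union>p\<in>P u q. Bd u p)"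
        using u(1) by (intro UN_I[of u] UN_I[of "card U"] UN_I[of "(U, Z)"]) auto
    qed
    have fB: "finite (Bd u p)" for u p using fTab by (simp add: Bd_def)
    have "card {h \<in> Tab. \<not> spread n M R h} \<le> card (\<Union>u<n. \<Union>q<R + 1. \<Union>p\<in>P u q. Bd u p)"
      by (rule card_mono[OF _ sub]) (auto simp: fP fB)
    also have "\<dots> \<le> (\<Sum>u<n. card (\<Union>q<R + 1. \<Union>p\<in>P u q. Bd u p))" by (rule card_UN_le) simp
    also have "\<dots> \<le> (\<Sum>u<n. \<Sum>q<R + 1. card (\<Union>p\<in>P u q. Bd u p))"
      by (intro sum_mono card_UN_le) simp
    also have "\<dots> \<le> (\<Sum>u<n. \<Sum>q<R + 1. \<Sum>p\<in>P u q. card (Bd u p))"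
      by (intro sum_mono card_UN_le fP)
    finally have "real (card {h \<in> Tab. \<not> spread n M R h}) \<le> (\<Sum>u<n. \<Sum>q<R + 1. real (\<Sum>p\<in>P u q. card (Bd u p)))"
      by (metis (mono_tags, lifting) of_nat_le_iff of_nat_sum sum.cong)
    also have "\<dots> \<le> (\<Sum>u<n. \<Sum>q<R + 1. e * real (card Tab))"
      using cq by (intro sum_mono) auto
    also have "\<dots> = real n * (real (R + 1) * (e * real (card Tab)))" by simp
    also have "\<dots> \<le> real n * (real (R0 + 1) * (e * real (card Tab)))"
      using R e0 by (intro mult_left_mono mult_right_mono) auto
    finally show ?thesis by (simp add: M_def R_def mult_ac)
  qed
  have "\<exists>h\<in>Tab. \<forall>j<I. spread n (2 * epochs I j) (2 * epochs I j * K) h"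
  proof (rule ccontr)
    assume "\<not> ?thesis"
    hence "Tab \<subseteq> (\<Union>j<I. {h \<in> Tab. \<not> spread n (2 * epochs I j) (2 * epochs I j * K) h})" by auto
    hence "card Tab \<le> card (\<Union>j<I. {h \<in> Tab. \<not> spread n (2 * epochs I j) (2 * epochs I j * K) h})"
      using fTab by (intro card_mono) auto
    also have "\<dots> \<le> (\<Sum>j<I. card {h \<in> Tab. \<not> spread n (2 * epochs I j) (2 * epochs I j * K) h})"
      by (rule card_UN_le) simp
    finally have "real (card Tab) \<le> (\<Sum>j<I. real (card {h \<in> Tab. \<not> spread n (2 * epochs I j) (2 * epochs I j * K) h}))"
      by (metis (mono_tags, lifting) of_nat_le_iff of_nat_sum sum.cong)
    also have "\<dots> \<le> (\<Sum>j<I. real n * real (R0 + 1) * (e * real (card Tab)))"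
      using bad_j by (intro sum_mono) auto
    also have "\<dots> = real I * real n * real (R0 + 1) * e * real (card Tab)" by simp
    also have "\<dots> < 1 * real (card Tab)"
      using small' cTab by (intro mult_strict_right_mono) auto
    finally show False by simp
  qed
  then obtain h where h: "h \<in> Tab" "\<forall>j<I. spread n (2 * epochs I j) (2 * epochs I j * K) h" by blast
  have "h v r < 2 ^ (I + 1)" if "v < n" "r < R0" for v r
    using h(1) that by (auto simp: Tab_def PiE_iff)
  thus ?thesis using h(2) by blast
qed

section \<open>The coloring algorithm and its invariants\<close>

text \<open>The least \<open>i < b\<close> with \<open>P i\<close>, or \<open>b\<close> if there is
  none, written as a cardinality because sums are the only loops that the terms have.\<close>

definition mu :: "nat \<Rightarrow> (nat \<Rightarrow> bool) \<Rightarrow> nat" where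
  "mu b P = card {i. i < b \<and> (\<forall>k<Suc i. \<not> P k)}"

lemma mu_eq:
  assumes "i < b" "P i" shows "mu b P < b" "P (mu b P)" "\<And>k. k < mu b P \<Longrightarrow> \<not> P k"
proof -
  define m where "m = (LEAST i. P i)"
  have m: "P m" "m \<le> i" "\<And>k. k < m \<Longrightarrow> \<not> P k"
    using assms(2) unfolding m_def by (auto intro: LeastI Least_le dest: not_less_Least)
  have "{i. i < b \<and> (\<forall>k<Suc i. \<not> P k)} = {..<m}"
  proof (intro equalityI subsetI)
    fix k assume "k \<in> {i. i < b \<and> (\<forall>k<Suc i. \<not> P k)}"
    hence "\<not> m < Suc k" using m(1) by blast
    thus "k \<in> {..<m}" by simp
  next
    fix k assume "k \<in> {..<m}"
    thus "k \<in> {i. i < b \<and> (\<forall>k<Suc i. \<not> P k)}" using m assms(1) by auto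
  qed
  hence "mu b P = m" by (simp add: mu_def)
  thus "mu b P < b" "P (mu b P)" "\<And>k. k < mu b P \<Longrightarrow> \<not> P k" using m assms(1) by auto
qed

text \<open>A quadratic pairing: \<open>y\<close> never reaches the next square after
  \<open>(x + y) ^ 2\<close>. Injectivity is all that is asked of it, as colors are counted by their
  number and not by their size.\<close>

definition pr :: "nat \<Rightarrow> nat \<Rightarrow> nat" where
  "pr x y = (x + y)\<^sup>2 + y"

lemma pr_inject [simp]: "pr x y = pr x' y' \<longleftrightarrow> x = x' \<and> y = y'"
proof
  have le: "x + y \<le> x' + y'" if "pr x y = pr x' y'" for x y x' y'
  proof (rule ccontr)
    assume "\<not> x + y \<le> x' + y'"
    hence "x' + y' + 1 \<le> x + y" by simp
    hence "(x' + y' + 1)\<^sup>2 \<le> (x + y)\<^sup>2" by (rule power_mono) simp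
    hence "(x' + y')\<^sup>2 + 2 * (x' + y') + 1 \<le> pr x y" by (simp add: pr_def power2_eq_square)
    thus False unfolding that by (simp add: pr_def)
  qed
  assume eq: "pr x y = pr x' y'"
  have "x + y = x' + y'" using le[OF eq] le[OF eq[symmetric]] by simp
  thus "x = x' \<and> y = y'" using eq by (simp add: pr_def)
qed simp

text \<open>The orientation depends only on the parity of the level and on the set of endpoints. So
  parallel edges presented in either order form the same pair, and the next level swaps the
  roles.\<close>

definition tl_of :: "nat \<Rightarrow> nat \<Rightarrow> nat \<Rightarrow> nat" where
  "tl_of j u v = (if even j then min u v else max u v)"

definition hd_of :: "nat \<Rightarrow> nat \<Rightarrow> nat \<Rightarrow> nat" where
  "hd_of j u v = (if even j then max u v else min u v)"

text \<open>The array \<open>a\<close> holds the degree of \<open>x\<close> at position \<open>x\<close>, followed by four fields \<open>adr f j l x r\<close> for each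
  row \<open>r\<close> at vertex \<open>x\<close>: one plus the last epoch in which \<open>x\<close> used the row as tail (0) and as head (1),
  and the head (2) and the color count (3) of the last pair served with tail \<open>x\<close>. Of the conditions on
  a pair, \<open>rc\<close> says that row \<open>r\<close> is allocated to it, \<open>lv\<close> that it is moreover not exhausted, \<open>fr\<close> that it
  can be allocated, \<open>ps\<close> that the pair passes to the next phase, and \<open>so\<close> that it is served in this one.\<close>

locale algo = design +
  fixes \<Delta> :: nat
  assumes T0_\<Delta>: "\<Delta> < T0 * 2 ^ I" and RI: "12 * T0 < RI * 2 ^ I"
begin

text \<open>The number of rows of all levels below \<open>j\<close>, a geometric sum with terms
  \<open>2 * 2 ^ (I - i) * K\<close>.\<close>

definition OF :: "nat \<Rightarrow> nat" where "OF j = 4 * K * (2 ^ I - 2 ^ (I - j))"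
definition adr :: "nat \<Rightarrow> nat \<Rightarrow> nat \<Rightarrow> nat \<Rightarrow> nat \<Rightarrow> nat" where
  "adr f j l x r = n + ((((OF j + r) * A + l) * 4 + f) * n + x)"
definition ep :: "(nat \<Rightarrow> nat) \<Rightarrow> nat \<Rightarrow> nat \<Rightarrow> nat" where "ep a j x = a x div T j"
definition mA :: "(nat \<Rightarrow> nat) \<Rightarrow> nat \<Rightarrow> nat \<Rightarrow> nat \<Rightarrow> nat \<Rightarrow> bool" where
  "mA a j x y r \<longleftrightarrow> j = I \<or> (h x r + ep a j x) mod M j = (h y r + ep a j y + E j) mod M j"
definition ut :: "(nat \<Rightarrow> nat) \<Rightarrow> nat \<Rightarrow> nat \<Rightarrow> nat \<Rightarrow> nat \<Rightarrow> bool" where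
  "ut a j l x r \<longleftrightarrow> a (adr 0 j l x r) = Suc (ep a j x)"
definition uh :: "(nat \<Rightarrow> nat) \<Rightarrow> nat \<Rightarrow> nat \<Rightarrow> nat \<Rightarrow> nat \<Rightarrow> bool" where
  "uh a j l y r \<longleftrightarrow> a (adr 1 j l y r) = Suc (ep a j y)"
definition fr :: "(nat \<Rightarrow> nat) \<Rightarrow> nat \<Rightarrow> nat \<Rightarrow> nat \<Rightarrow> nat \<Rightarrow> nat \<Rightarrow> bool" where
  "fr a j l x y r \<longleftrightarrow> mA a j x y r \<and> \<not> ut a j l x r \<and> \<not> uh a j l y r \<and>
     (j = I \<longrightarrow> \<not> uh a j l x r \<and> \<not> ut a j l y r)"
definition rc :: "(nat \<Rightarrow> nat) \<Rightarrow> nat \<Rightarrow> nat \<Rightarrow> nat \<Rightarrow> nat \<Rightarrow> nat \<Rightarrow> bool" where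
  "rc a j l x y r \<longleftrightarrow> mA a j x y r \<and> ut a j l x r \<and> a (adr 2 j l x r) = y"
definition lv :: "(nat \<Rightarrow> nat) \<Rightarrow> nat \<Rightarrow> nat \<Rightarrow> nat \<Rightarrow> nat \<Rightarrow> nat \<Rightarrow> bool" where
  "lv a j l x y r \<longleftrightarrow> rc a j l x y r \<and> a (adr 3 j l x r) < B j"
definition ps :: "(nat \<Rightarrow> nat) \<Rightarrow> nat \<Rightarrow> nat \<Rightarrow> nat \<Rightarrow> nat \<Rightarrow> bool" where
  "ps a j l x y \<longleftrightarrow> (\<forall>r<R j. \<not> rc a j l x y r) \<and> (\<forall>r<R j. \<not> fr a j l x y r) \<and>
     card {r. r < R j \<and> mA a j x y r} \<le> 2 * card {r. r < R j \<and> mA a j x y r \<and> ut a j l x r}"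
text \<open>The disjunct \<open>j = I\<close> lets a pair with exhausted rows take a further row at
  the last level, which has no successor.\<close>

definition so :: "(nat \<Rightarrow> nat) \<Rightarrow> nat \<Rightarrow> nat \<Rightarrow> nat \<Rightarrow> nat \<Rightarrow> bool" where
  "so a j l x y \<longleftrightarrow> (\<exists>r<R j. lv a j l x y r) \<or>
     (((\<forall>r<R j. \<not> rc a j l x y r) \<or> j = I) \<and> (\<exists>r<R j. fr a j l x y r))"
definition sl :: "(nat \<Rightarrow> nat) \<Rightarrow> nat \<Rightarrow> nat \<Rightarrow> nat \<Rightarrow> bool" where
  "sl a j x y \<longleftrightarrow> (\<exists>l<A. (\<forall>l'<l. ps a j l' x y) \<and> \<not> ps a j l x y \<and> so a j l x y)"

definition js :: "(nat \<Rightarrow> nat) \<Rightarrow> nat \<Rightarrow> nat \<Rightarrow> nat" where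
  "js a u v = mu (Suc I) (\<lambda>j. sl a j (tl_of j u v) (hd_of j u v))"
definition xs :: "(nat \<Rightarrow> nat) \<Rightarrow> nat \<Rightarrow> nat \<Rightarrow> nat" where "xs a u v = tl_of (js a u v) u v"
definition ys :: "(nat \<Rightarrow> nat) \<Rightarrow> nat \<Rightarrow> nat \<Rightarrow> nat" where "ys a u v = hd_of (js a u v) u v"
definition ls :: "(nat \<Rightarrow> nat) \<Rightarrow> nat \<Rightarrow> nat \<Rightarrow> nat" where
  "ls a u v = mu A (\<lambda>l. \<not> ps a (js a u v) l (xs a u v) (ys a u v))"
definition live :: "(nat \<Rightarrow> nat) \<Rightarrow> nat \<Rightarrow> nat \<Rightarrow> bool" where
  "live a u v \<longleftrightarrow> (\<exists>r<R (js a u v). lv a (js a u v) (ls a u v) (xs a u v) (ys a u v) r)"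
definition rs :: "(nat \<Rightarrow> nat) \<Rightarrow> nat \<Rightarrow> nat \<Rightarrow> nat" where
  "rs a u v = (if live a u v then mu (R (js a u v)) (lv a (js a u v) (ls a u v) (xs a u v) (ys a u v))
     else mu (R (js a u v)) (fr a (js a u v) (ls a u v) (xs a u v) (ys a u v)))"
definition bs :: "(nat \<Rightarrow> nat) \<Rightarrow> nat \<Rightarrow> nat \<Rightarrow> nat" where
  "bs a u v = (if live a u v then a (adr 3 (js a u v) (ls a u v) (xs a u v) (rs a u v)) else 0)"
definition cs :: "(nat \<Rightarrow> nat) \<Rightarrow> nat \<Rightarrow> nat \<Rightarrow> nat" where
  "cs a u v = (h (xs a u v) (rs a u v) + ep a (js a u v) (xs a u v)) mod M (js a u v)"

definition nxt :: "(nat \<Rightarrow> nat) \<Rightarrow> nat \<Rightarrow> nat \<Rightarrow> (nat \<Rightarrow> nat)" where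
  "nxt a u v = a(adr 0 (js a u v) (ls a u v) (xs a u v) (rs a u v) := Suc (ep a (js a u v) (xs a u v)),
     adr 1 (js a u v) (ls a u v) (ys a u v) (rs a u v) := Suc (ep a (js a u v) (ys a u v)),
     adr 2 (js a u v) (ls a u v) (xs a u v) (rs a u v) := ys a u v,
     adr 3 (js a u v) (ls a u v) (xs a u v) (rs a u v) := Suc (bs a u v),
     u := Suc (a u), v := Suc (a v))"

definition color :: "nat \<times> nat \<times> nat \<times> nat \<times> nat \<Rightarrow> nat" where
  "color = (\<lambda>(j, l, r, c, b). pr j (pr l (pr r (pr c b))))"

definition tup :: "(nat \<Rightarrow> nat) \<Rightarrow> nat \<Rightarrow> nat \<Rightarrow> nat \<times> nat \<times> nat \<times> nat \<times> nat" where
  "tup a u v = (js a u v, ls a u v, rs a u v, cs a u v, bs a u v)"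

lemma color_inject [simp]: "color t = color t' \<longleftrightarrow> t = t'"
  by (auto simp: color_def split: prod.splits)

lemma T0_pos: "T0 > 0" using T0_\<Delta> by (cases T0) auto
lemma A_pos: "A > 0" using T0A T0_pos by (cases A) auto
lemma T_pos: "T j > 0" using T0_pos by (simp add: T_def)
lemma OF_le: "i < j \<Longrightarrow> j \<le> I \<Longrightarrow> OF i + R i \<le> OF j"
proof -
  assume ij: "i < j" "j \<le> I"
  have "(2::nat) ^ (I - j) \<le> 2 ^ (I - Suc i)" using ij by (intro power_increasing) auto
  moreover have "(2::nat) ^ (I - i) = 2 * 2 ^ (I - Suc i)" using ij by (metis Suc_diff_Suc less_le_trans power_Suc)
  moreover have "(2::nat) ^ (I - i) \<le> 2 ^ I" by (rule power_increasing) auto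
  ultimately have "2 ^ I - 2 ^ (I - i) + 2 ^ (I - Suc i) \<le> (2::nat) ^ I - 2 ^ (I - j)" by linarith
  hence "4 * K * (2 ^ I - 2 ^ (I - i) + 2 ^ (I - Suc i)) \<le> 4 * K * (2 ^ I - 2 ^ (I - j))" by (rule mult_le_mono2)
  thus ?thesis using ij \<open>2 ^ (I - i) = 2 * 2 ^ (I - Suc i)\<close>
    by (simp add: OF_def R_def M_def epochs_def algebra_simps)
qed

text \<open>Peeling off the digits \<open>x\<close>, \<open>f\<close> and \<open>l\<close> leaves
  \<open>OF j + r\<close>, and the levels occupy disjoint ranges there.\<close>

lemma adr_inject:
  assumes "f < 4" "f' < 4" "l < A" "l' < A" "x < n" "x' < n" "r < R j" "r' < R j'" "j \<le> I" "j' \<le> I"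
  shows "adr f j l x r = adr f' j' l' x' r' \<longleftrightarrow> f = f' \<and> j = j' \<and> l = l' \<and> x = x' \<and> r = r'"
proof
  have un: "q = q' \<and> s = s'" if "q * m + s = q' * m + s'" "s < m" "s' < m" for q q' s s' m :: nat
  proof -
    have "(q * m + s) div m = q" using that(2) by simp
    moreover have "(q' * m + s') div m = q'" using that(3) by simp
    ultimately have "q = q'" using that(1) by simp
    thus ?thesis using that(1) by simp
  qed
  assume "adr f j l x r = adr f' j' l' x' r'"
  hence "(((OF j + r) * A + l) * 4 + f) * n + x = (((OF j' + r') * A + l') * 4 + f') * n + x'"
    by (simp add: adr_def)
  from un[OF this assms(5,6)] have 1: "((OF j + r) * A + l) * 4 + f = ((OF j' + r') * A + l') * 4 + f'" "x = x'" by auto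
  from un[OF 1(1) assms(1,2)] have 2: "(OF j + r) * A + l = (OF j' + r') * A + l'" "f = f'" by auto
  from un[OF 2(1) assms(3,4)] have 3: "OF j + r = OF j' + r'" "l = l'" by auto
  have "j = j'"
  proof (rule ccontr)
    assume "j \<noteq> j'"
    hence "j < j' \<or> j' < j" by auto
    thus False using OF_le[of j j'] OF_le[of j' j] assms 3 by linarith
  qed
  thus "f = f' \<and> j = j' \<and> l = l' \<and> x = x' \<and> r = r'" using 1 2 3 by auto
qed simp

lemma adr_ge: "adr f j l x r \<ge> n" by (simp add: adr_def)

definition NA :: nat where "NA = n + (OF I + RI) * A * 4 * n"

lemma adr_lt:
  assumes "f < 4" "l < A" "x < n" "r < R j" "j \<le> I" shows "adr f j l x r < NA"
proof -
  have "OF j + r < OF I + RI"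
    using assms OF_le[of j I] by (cases "j = I") (auto simp: R_def)
  hence "Suc (OF j + r) * A \<le> (OF I + RI) * A" by (intro mult_le_mono1) simp
  hence "Suc ((OF j + r) * A + l) \<le> (OF I + RI) * A" using assms by simp
  hence "Suc ((OF j + r) * A + l) * 4 \<le> (OF I + RI) * A * 4" by (rule mult_le_mono1)
  hence "Suc (((OF j + r) * A + l) * 4 + f) \<le> (OF I + RI) * A * 4" using assms by simp
  hence "Suc (((OF j + r) * A + l) * 4 + f) * n \<le> (OF I + RI) * A * 4 * n" by (rule mult_le_mono1)
  thus ?thesis using assms by (simp add: adr_def NA_def)
qed

end

text \<open>\<open>col v\<close> is the set of colors of the edges at \<open>v\<close>; a color is a tuple of level, phase, row, residue and
  position in the bundle.\<close>

locale hist = algo +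
  fixes a :: "nat \<Rightarrow> nat" and VS :: "nat \<Rightarrow> nat \<Rightarrow> (vv \<times> vv) set"
    and AL :: "nat \<Rightarrow> nat \<Rightarrow> (vv \<times> vv \<times> nat) set"
    and cn :: "nat \<Rightarrow> nat \<Rightarrow> vv \<Rightarrow> nat \<Rightarrow> nat"
    and col :: "nat \<Rightarrow> (nat \<times> nat \<times> nat \<times> nat \<times> nat) set"
  assumes VS_vv: "\<And>j l X Y. (X, Y) \<in> VS j l \<Longrightarrow> isvv j X \<and> isvv j Y \<and> fst X \<noteq> fst Y \<and> j \<le> I"
    and AL_VS: "\<And>j l X Y r. (X, Y, r) \<in> AL j l \<Longrightarrow> (X, Y) \<in> VS j l \<and> r < R j \<and> l < A"
    and AL_tail: "\<And>j l X Y Y' r. (X, Y, r) \<in> AL j l \<Longrightarrow> (X, Y', r) \<in> AL j l \<Longrightarrow> Y = Y'"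
    and AL_head: "\<And>j l X X' Y r. (X, Y, r) \<in> AL j l \<Longrightarrow> (X', Y, r) \<in> AL j l \<Longrightarrow> X = X'"
    and VS_Suc: "\<And>j l X Y. j < I \<Longrightarrow> (X, Y) \<in> VS j (Suc l) \<Longrightarrow> (X, Y) \<in> VS j l \<and>
      card (common j X Y) \<le> 2 * card (common j X Y \<inter> {r. \<exists>Y. (X, Y, r) \<in> AL j l})"
    and cov: "\<And>j l X Y r. j < I \<Longrightarrow> (X, Y) \<in> VS j (Suc l) \<Longrightarrow> r \<in> common j X Y \<Longrightarrow>
      (\<exists>Y. (X, Y, r) \<in> AL j l) \<or> (\<exists>X. (X, Y, r) \<in> AL j l)"
    and AL_common: "\<And>j l X Y r. j < I \<Longrightarrow> (X, Y, r) \<in> AL j l \<Longrightarrow> r \<in> common j X Y"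
    and AL_once: "\<And>j l l' X Y r r'. j < I \<Longrightarrow> (X, Y, r) \<in> AL j l \<Longrightarrow> (X, Y, r') \<in> AL j l' \<Longrightarrow>
      l = l' \<and> r = r'"
    and VS_level: "\<And>j X Y. j < I \<Longrightarrow> (Y, X) \<in> VS (Suc j) 0 \<Longrightarrow>
      \<exists>X' Y'. (X', Y') \<in> VS j 0 \<and> X = map_prod id (\<lambda>e. e div 2) X' \<and> Y = map_prod id (\<lambda>e. e div 2) Y' \<and>
       ((\<exists>l r. (X', Y', r) \<in> AL j l \<and> B j \<le> cn j l X' r) \<or>
        (\<exists>l. card (common j X' Y') \<le> 2 * card (common j X' Y' \<inter> {r. \<exists>X. (X, Y', r) \<in> AL j l})) \<or>
        (X', Y') \<in> VS j A)"
    and AL_I0: "\<And>l X Y r. (X, Y, r) \<in> AL I l \<Longrightarrow> l = 0"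
    and AL_I: "\<And>X Y X' Y' r. (X, Y, r) \<in> AL I 0 \<Longrightarrow> (X', Y', r) \<in> AL I 0 \<Longrightarrow>
      fst X = fst X' \<or> fst X = fst Y' \<or> fst Y = fst X' \<or> fst Y = fst Y' \<Longrightarrow> X = X' \<and> Y = Y'"
    and AL_I_live: "\<And>X Y r r'. (X, Y, r) \<in> AL I 0 \<Longrightarrow> (X, Y, r') \<in> AL I 0 \<Longrightarrow>
      cn I 0 X r < B I \<Longrightarrow> cn I 0 X r' < B I \<Longrightarrow> r = r'"
    and cnt: "\<And>j X. j \<le> I \<Longrightarrow> (\<Sum>(l, X', Y', r)\<in>{(l, X', Y', r). (X', Y', r) \<in> AL j l \<and> (X' = X \<or> Y' = X)}. cn j l X' r)
       \<le> min (T j) (a (fst X) - snd X * T j)"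
    and vs0: "\<And>X. card {Y. (X, Y) \<in> VS 0 0 \<or> (Y, X) \<in> VS 0 0} \<le> min T0 (a (fst X) - snd X * T0)"
    and R1: "\<And>j l x r e. j \<le> I \<Longrightarrow> l < A \<Longrightarrow> x < n \<Longrightarrow> r < R j \<Longrightarrow> a (adr 0 j l x r) = Suc e \<Longrightarrow>
      \<exists>Y. ((x, e), Y, r) \<in> AL j l \<and> a (adr 2 j l x r) = fst Y \<and> a (adr 3 j l x r) = cn j l (x, e) r"
    and R2: "\<And>j l X Y r. (X, Y, r) \<in> AL j l \<Longrightarrow> snd X < a (adr 0 j l (fst X) r) \<and> snd Y < a (adr 1 j l (fst Y) r) \<and>
      snd X \<le> ep a j (fst X) \<and> snd Y \<le> ep a j (fst Y)"
    and R3: "\<And>j l y r e. j \<le> I \<Longrightarrow> l < A \<Longrightarrow> y < n \<Longrightarrow> r < R j \<Longrightarrow> a (adr 1 j l y r) = Suc e \<Longrightarrow>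
      \<exists>X. (X, (y, e), r) \<in> AL j l"
    and col: "\<And>v j l r c b. (j, l, r, c, b) \<in> col v \<Longrightarrow> \<exists>X Y. (X, Y, r) \<in> AL j l \<and> (v = fst X \<or> v = fst Y) \<and>
      c = (h (fst X) r + snd X) mod M j \<and> b < cn j l X r"
    and a_le: "\<And>i. a i \<le> n + \<Delta> + B I + 1"
begin

section \<open>What the array reveals about the history\<close>

lemma AL_props:
  assumes "(X, Y, r) \<in> AL j l"
  shows "r < R j" "l < A" "j \<le> I" "isvv j X" "isvv j Y" "fst X \<noteq> fst Y" "fst X < n" "fst Y < n"
  using AL_VS[OF assms] VS_vv[of X Y j l] by (auto simp: isvv_def)

text \<open>Storing only the last epoch loses nothing about the current one: an allocation of the
  current epoch forces the entry above that epoch, the entry itself stems from an allocation, and by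
  \<open>R2\<close> none lies in the future. Hence the two epochs coincide.\<close>

lemma ut_iff:
  assumes "j \<le> I" "l < A" "x < n" "r < R j"
  shows "ut a j l x r \<longleftrightarrow> (\<exists>Y. ((x, ep a j x), Y, r) \<in> AL j l)"
proof
  assume "ut a j l x r"
  thus "\<exists>Y. ((x, ep a j x), Y, r) \<in> AL j l" using R1[OF assms] by (auto simp: ut_def)
next
  assume "\<exists>Y. ((x, ep a j x), Y, r) \<in> AL j l"
  then obtain Y where Y: "((x, ep a j x), Y, r) \<in> AL j l" by blast
  from R2[OF Y] obtain e where e: "a (adr 0 j l x r) = Suc e" "ep a j x \<le> e"
    by (cases "a (adr 0 j l x r)") auto
  from R1[OF assms e(1)] obtain Y' where "((x, e), Y', r) \<in> AL j l" by blast
  from R2[OF this] e show "ut a j l x r" by (simp add: ut_def)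
qed

lemma uh_iff:
  assumes "j \<le> I" "l < A" "y < n" "r < R j"
  shows "uh a j l y r \<longleftrightarrow> (\<exists>X. (X, (y, ep a j y), r) \<in> AL j l)"
proof
  assume "uh a j l y r"
  thus "\<exists>X. (X, (y, ep a j y), r) \<in> AL j l" using R3[OF assms] by (auto simp: uh_def)
next
  assume "\<exists>X. (X, (y, ep a j y), r) \<in> AL j l"
  then obtain X where X: "(X, (y, ep a j y), r) \<in> AL j l" by blast
  from R2[OF X] obtain e where e: "a (adr 1 j l y r) = Suc e" "ep a j y \<le> e"
    by (cases "a (adr 1 j l y r)") auto
  from R3[OF assms e(1)] obtain X' where "(X', (y, e), r) \<in> AL j l" by blast
  from R2[OF this] e show "uh a j l y r" by (simp add: uh_def)
qed

lemma mA_common: "j < I \<Longrightarrow> r < R j \<Longrightarrow> mA a j x y r \<longleftrightarrow> r \<in> common j (x, ep a j x) (y, ep a j y)"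
  by (auto simp: mA_def common_def)

text \<open>The array stores the head without its epoch. The agreement of the residues restores it,
  because two epochs below \<open>E j\<close> that are congruent modulo \<open>2 * E j\<close> are
  equal. At the last level there is only epoch 0.\<close>

lemma rc_AL:
  assumes "j \<le> I" "l < A" "x < n" "r < R j" "ep a j y < E j"
  shows "rc a j l x y r \<longleftrightarrow> ((x, ep a j x), (y, ep a j y), r) \<in> AL j l"
    and "rc a j l x y r \<Longrightarrow> a (adr 3 j l x r) = cn j l (x, ep a j x) r"
proof -
  have R1': "\<exists>Y. ((x, ep a j x), Y, r) \<in> AL j l \<and> a (adr 2 j l x r) = fst Y \<and>
      a (adr 3 j l x r) = cn j l (x, ep a j x) r" if "ut a j l x r"
    using R1[OF assms(1-4)] that by (simp add: ut_def)
  thus "rc a j l x y r \<Longrightarrow> a (adr 3 j l x r) = cn j l (x, ep a j x) r" by (auto simp: rc_def)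
  show "rc a j l x y r \<longleftrightarrow> ((x, ep a j x), (y, ep a j y), r) \<in> AL j l"
  proof
    assume rc: "rc a j l x y r"
    then obtain e where e: "((x, ep a j x), (y, e), r) \<in> AL j l"
      using R1' by (auto simp: rc_def)
    have eE: "e < E j" using AL_props(5)[OF e] by (simp add: isvv_def)
    have "e = ep a j y"
    proof (cases "j = I")
      case True
      thus ?thesis using eE assms(5) by (simp add: epochs_def)
    next
      case False
      hence j: "j < I" using assms(1) by simp
      have "r \<in> common j (x, ep a j x) (y, ep a j y)" using rc mA_common[OF j assms(4)] by (simp add: rc_def)
      moreover have "r \<in> common j (x, ep a j x) (y, e)" by (rule AL_common[OF j e])
      ultimately have "(e + (h y r + E j)) mod M j = (ep a j y + (h y r + E j)) mod M j"
        by (simp add: common_def add_ac)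
      hence "e mod M j = ep a j y mod M j" by (simp only: mod_add_cancel_nat)
      thus ?thesis using eE assms(5) by (simp add: M_def)
    qed
    thus "((x, ep a j x), (y, ep a j y), r) \<in> AL j l" using e by simp
  next
    assume AL: "((x, ep a j x), (y, ep a j y), r) \<in> AL j l"
    hence ut: "ut a j l x r" using ut_iff[OF assms(1-4)] by blast
    from R1'[OF ut] AL_tail[OF AL] have "a (adr 2 j l x r) = y" by auto
    moreover have "mA a j x y r"
    proof (cases "j = I")
      case False
      thus ?thesis using AL_common[OF _ AL] mA_common assms by simp
    qed (simp add: mA_def)
    ultimately show "rc a j l x y r" using ut by (simp add: rc_def)
  qed
qed

lemma VS_mono:
  assumes "j < I" shows "(X, Y) \<in> VS j l' \<Longrightarrow> l \<le> l' \<Longrightarrow> (X, Y) \<in> VS j l"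
  by (induction l') (auto simp: le_Suc_eq dest: VS_Suc[OF assms])

lemma finite_al: "finite {(l, X', Y', r). (X', Y', r) \<in> AL j l \<and> (X' = X \<or> Y' = X)}"
proof (rule finite_subset)
  show "{(l, X', Y', r). (X', Y', r) \<in> AL j l \<and> (X' = X \<or> Y' = X)} \<subseteq>
    {..<A} \<times> {X. isvv j X} \<times> {X. isvv j X} \<times> {..<R j}"
  proof
    fix z assume "z \<in> {(l, X', Y', r). (X', Y', r) \<in> AL j l \<and> (X' = X \<or> Y' = X)}"
    then obtain l X' Y' r where z: "z = (l, X', Y', r)" "(X', Y', r) \<in> AL j l" by blast
    show "z \<in> {..<A} \<times> {X. isvv j X} \<times> {X. isvv j X} \<times> {..<R j}"
      using AL_props[OF z(2)] z(1) by simp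
  qed
qed (simp add: finite_isvv)

end

declare split_paired_All [simp del] split_paired_Ex [simp del]

section \<open>Preservation of the invariants by one arrival\<close>

locale step = hist +
  fixes u v :: nat
  assumes uv: "u < n" "v < n" "u \<noteq> v" and du: "a u < \<Delta>" and dv: "a v < \<Delta>"
begin

section \<open>The pairs visited by the new edge\<close>

definition x :: "nat \<Rightarrow> nat" where "x j = tl_of j u v"
definition y :: "nat \<Rightarrow> nat" where "y j = hd_of j u v"
definition X :: "nat \<Rightarrow> vv" where "X j = (x j, ep a j (x j))"
definition Y :: "nat \<Rightarrow> vv" where "Y j = (y j, ep a j (y j))"

definition reach :: "nat \<Rightarrow> bool" where
  "reach j \<longleftrightarrow> j \<le> I \<and> (\<forall>j'<j. \<not> sl a j' (x j') (y j'))"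
definition pl :: "nat \<Rightarrow> nat \<Rightarrow> bool" where
  "pl j l \<longleftrightarrow> l \<le> A \<and> (\<forall>l'<l. ps a j l' (x j) (y j))"
text \<open>All levels and phases that the edge reaches are entered before its row is known, while
  the allocations remain the old ones. The counting must already cover the new pair when a free row
  at the last level is deduced from it.\<close>

definition VS' :: "nat \<Rightarrow> nat \<Rightarrow> (vv \<times> vv) set" where
  "VS' j l = VS j l \<union> (if reach j \<and> pl j l then {(X j, Y j)} else {})"

lemma xy: "x j < n" "y j < n" "x j \<noteq> y j" "{x j, y j} = {u, v}" "x (Suc j) = y j" "y (Suc j) = x j"
  using uv by (auto simp: x_def y_def tl_of_def hd_of_def min_def max_def)

lemma xy_in: "x j \<in> {u, v}" "y j \<in> {u, v}"
  using xy(4)[of j] by blast+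

lemma ep_lt: assumes "w \<in> {u, v}" "j \<le> I" shows "ep a j w < E j"
proof -
  have "a w < T0 * 2 ^ I" using assms(1) du dv T0_\<Delta> by auto
  also have "T0 * 2 ^ I = E j * T j" using assms(2) by (simp add: T_def epochs_def flip: power_add)
  finally show ?thesis by (simp add: ep_def less_mult_imp_div_less)
qed

lemma ep_xy: "j \<le> I \<Longrightarrow> ep a j (x j) < E j" "j \<le> I \<Longrightarrow> ep a j (y j) < E j"
  using ep_lt[OF xy_in(1)] ep_lt[OF xy_in(2)] by blast+

lemma XY_vv: "j \<le> I \<Longrightarrow> isvv j (X j) \<and> isvv j (Y j) \<and> fst (X j) \<noteq> fst (Y j)"
  using xy ep_xy by (simp add: isvv_def X_def Y_def)

lemma ut_x: "j \<le> I \<Longrightarrow> l < A \<Longrightarrow> r < R j \<Longrightarrow> ut a j l (x j) r \<longleftrightarrow> (\<exists>Y. (X j, Y, r) \<in> AL j l)"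
  using ut_iff[of j l "x j" r] xy by (simp add: X_def)

lemma uh_y: "j \<le> I \<Longrightarrow> l < A \<Longrightarrow> r < R j \<Longrightarrow> uh a j l (y j) r \<longleftrightarrow> (\<exists>X. (X, Y j, r) \<in> AL j l)"
  using uh_iff[of j l "y j" r] xy by (simp add: Y_def)

lemma rc_xy: "j \<le> I \<Longrightarrow> l < A \<Longrightarrow> r < R j \<Longrightarrow> rc a j l (x j) (y j) r \<longleftrightarrow> (X j, Y j, r) \<in> AL j l"
  using rc_AL(1)[of j l "x j" r "y j"] xy ep_xy by (simp add: X_def Y_def)

lemma ct_xy: "j \<le> I \<Longrightarrow> l < A \<Longrightarrow> r < R j \<Longrightarrow> rc a j l (x j) (y j) r \<Longrightarrow>
    a (adr 3 j l (x j) r) = cn j l (X j) r"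
  using rc_AL(2)[of j l "x j" r "y j"] xy ep_xy by (simp add: X_def)

lemma mA_xy: "j < I \<Longrightarrow> r < R j \<Longrightarrow> mA a j (x j) (y j) r \<longleftrightarrow> r \<in> common j (X j) (Y j)"
  using mA_common[of j r "x j" "y j"] by (simp add: X_def Y_def)

lemma common_R: "r \<in> common j X' Y' \<Longrightarrow> r < R j" by (simp add: common_def)

lemma tail_blocked_iff:
  assumes "j < I" "l < A"
  shows "card {r. r < R j \<and> mA a j (x j) (y j) r} \<le>
      2 * card {r. r < R j \<and> mA a j (x j) (y j) r \<and> ut a j l (x j) r} \<longleftrightarrow>
    card (common j (X j) (Y j)) \<le> 2 * card (common j (X j) (Y j) \<inter> {r. \<exists>Y. (X j, Y, r) \<in> AL j l})"
proof -
  have "{r. r < R j \<and> mA a j (x j) (y j) r} = common j (X j) (Y j)"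
    using mA_xy[OF assms(1)] common_R by blast
  moreover have "{r. r < R j \<and> mA a j (x j) (y j) r \<and> ut a j l (x j) r} =
      common j (X j) (Y j) \<inter> {r. \<exists>Y. (X j, Y, r) \<in> AL j l}"
    using mA_xy[OF assms(1)] common_R ut_x[OF less_imp_le[OF assms(1)] assms(2)] by blast
  ultimately show ?thesis by simp
qed

lemma not_fr_cov:
  assumes "j < I" "l < A" "\<forall>r<R j. \<not> fr a j l (x j) (y j) r" "r \<in> common j (X j) (Y j)"
  shows "(\<exists>Y. (X j, Y, r) \<in> AL j l) \<or> (\<exists>X. (X, Y j, r) \<in> AL j l)"
  using assms common_R[OF assms(4)] mA_xy[OF assms(1)] ut_x[of j l r] uh_y[of j l r]
  by (auto simp: fr_def)

lemma ps_blocked: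
  assumes "j < I" "l < A" "ps a j l (x j) (y j)"
  shows "card (common j (X j) (Y j)) \<le> 2 * card (common j (X j) (Y j) \<inter> {r. \<exists>Y. (X j, Y, r) \<in> AL j l})"
  using assms tail_blocked_iff[OF assms(1,2)] by (simp add: ps_def)

lemma ep_half: "ep a (Suc j) w = ep a j w div 2"
  by (simp add: ep_def T_def div_mult2_eq[symmetric] mult_ac)

text \<open>Every common row is in use at the tail or at the head, or it would be free. Fewer than
  half are in use at the tail, or the pair would pass to the next phase. So at least half are in use
  at the head.\<close>

lemma head_blocked:
  assumes "j < I" "l < A" "\<not> ps a j l (x j) (y j)" "\<not> so a j l (x j) (y j)"
    "\<forall>r<R j. \<not> rc a j l (x j) (y j) r"
  shows "card (common j (X j) (Y j)) \<le> 2 * card (common j (X j) (Y j) \<inter> {r. \<exists>X. (X, Y j, r) \<in> AL j l})"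
proof -
  let ?C = "common j (X j) (Y j)" and ?T = "{r. \<exists>Y. (X j, Y, r) \<in> AL j l}" and ?H = "{r. \<exists>X. (X, Y j, r) \<in> AL j l}"
  have nf: "\<forall>r<R j. \<not> fr a j l (x j) (y j) r" using assms(4,5) by (auto simp: so_def)
  hence nb: "2 * card (?C \<inter> ?T) < card ?C"
    using assms(3,5) tail_blocked_iff[OF assms(1,2)] by (simp add: ps_def)
  have "?C \<subseteq> (?C \<inter> ?T) \<union> (?C \<inter> ?H)" using not_fr_cov[OF assms(1,2) nf] by blast
  hence "card ?C \<le> card ((?C \<inter> ?T) \<union> (?C \<inter> ?H))" by (intro card_mono) auto
  also have "\<dots> \<le> card (?C \<inter> ?T) + card (?C \<inter> ?H)" by (rule card_Un_le)
  finally show ?thesis using nb by linarith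
qed

lemma exhausted:
  assumes "j < I" "l < A" "\<not> so a j l (x j) (y j)" "r < R j" "rc a j l (x j) (y j) r"
  shows "(X j, Y j, r) \<in> AL j l \<and> B j \<le> cn j l (X j) r"
proof -
  have "\<not> lv a j l (x j) (y j) r" using assms by (auto simp: so_def)
  thus ?thesis using assms ct_xy[of j l r] rc_xy[of j l r] by (auto simp: lv_def not_less)
qed

text \<open>The first phase that the pair does not pass decides: if a row is allocated to it there,
  this row is exhausted; if not, the head is blocked.\<close>

lemma not_sl_cases:
  assumes "j < I" "\<not> sl a j (x j) (y j)"
  shows "pl j A \<or> (\<exists>l r. (X j, Y j, r) \<in> AL j l \<and> B j \<le> cn j l (X j) r) \<or>
    (\<exists>l. card (common j (X j) (Y j)) \<le> 2 * card (common j (X j) (Y j) \<inter> {r. \<exists>X. (X, Y j, r) \<in> AL j l}))"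
proof (cases "pl j A")
  case False
  then obtain l0 where l0: "l0 < A" "\<not> ps a j l0 (x j) (y j)" by (auto simp: pl_def)
  define l where "l = (LEAST l. \<not> ps a j l (x j) (y j))"
  have l: "\<not> ps a j l (x j) (y j)" "l \<le> l0" "\<And>l'. l' < l \<Longrightarrow> ps a j l' (x j) (y j)"
    using l0 LeastI[of "\<lambda>l. \<not> ps a j l (x j) (y j)" l0] Least_le[of "\<lambda>l. \<not> ps a j l (x j) (y j)" l0]
      not_less_Least[of _ "\<lambda>l. \<not> ps a j l (x j) (y j)"] unfolding l_def by blast+
  have lA: "l < A" using l(2) l0 by simp
  have so: "\<not> so a j l (x j) (y j)" using assms(2) l lA by (auto simp: sl_def)
  show ?thesis
  proof (cases "\<exists>r<R j. rc a j l (x j) (y j) r")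
    case True
    thus ?thesis using exhausted[OF assms(1) lA so] by blast
  next
    case False
    thus ?thesis using head_blocked[OF assms(1) lA l(1) so] by blast
  qed
qed simp

text \<open>The edge adds at most one partner to each endpoint and also raises its degree within the
  epoch by one. Before the arrival this degree is a remainder below \<open>T0\<close>, so both
  limits of the minimum are kept.\<close>

lemma vs0_new:
  "card {Z. (W, Z) \<in> VS' 0 0 \<or> (Z, W) \<in> VS' 0 0} \<le>
     min T0 ((a(u := Suc (a u), v := Suc (a v))) (fst W) - snd W * T0)"
proof -
  let ?O = "{Z. (W, Z) \<in> VS 0 0 \<or> (Z, W) \<in> VS 0 0}"
  let ?N = "{Z. (W, Z) \<in> VS' 0 0 \<or> (Z, W) \<in> VS' 0 0}"
  have fO: "finite ?O"
    by (rule finite_subset[OF _ finite_isvv[of 0]]) (blast dest: VS_vv)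
  show ?thesis
  proof (cases "W = X 0 \<or> W = Y 0")
    case False
    hence e: "?N = ?O" by (auto simp: VS'_def)
    have "min T0 (a (fst W) - snd W * T0) \<le> min T0 ((a(u := Suc (a u), v := Suc (a v))) (fst W) - snd W * T0)"
      by (rule min.mono) auto
    thus ?thesis unfolding e using vs0[of W] by (rule le_trans[rotated])
  next
    case True
    have "?N \<subseteq> ?O \<union> {if W = X 0 then Y 0 else X 0}"
      using XY_vv[of 0] by (auto simp: VS'_def split: if_splits)
    hence "card ?N \<le> card (?O \<union> {if W = X 0 then Y 0 else X 0})" using fO by (intro card_mono) auto
    also have "\<dots> \<le> card ?O + 1" using card_Un_le[of ?O "{if W = X 0 then Y 0 else X 0}"] by simp
    finally have c: "card ?N \<le> card ?O + 1" .
    have W: "fst W \<in> {u, v}"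
      using True xy_in[of 0] by (elim disjE) (simp_all add: X_def Y_def)
    have W2: "snd W = a (fst W) div T0"
      using True by (elim disjE) (simp_all add: X_def Y_def ep_def T_def)
    have "card ?O \<le> a (fst W) mod T0" using vs0[of W] by (simp add: W2 minus_div_mult_eq_mod)
    moreover have "a (fst W) mod T0 < T0" using T0_pos by simp
    moreover have "(a(u := Suc (a u), v := Suc (a v))) (fst W) - snd W * T0 = Suc (a (fst W) mod T0)"
    proof -
      have "(a(u := Suc (a u), v := Suc (a v))) (fst W) = Suc (a (fst W))" using W uv by auto
      thus ?thesis by (simp add: W2 Suc_diff_le minus_div_mult_eq_mod)
    qed
    ultimately show ?thesis using c by simp
  qed
qed

lemma exh: "B j * card {(l, X', Y', r). (X', Y', r) \<in> AL j l \<and> (X' = W \<or> Y' = W) \<and> B j \<le> cn j l X' r} \<le> T j"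
  (is "_ * card ?E \<le> _")
proof (cases "?E = {}")
  case True
  show ?thesis unfolding True by simp
next
  case False
  then obtain l X' Y' r where "(X', Y', r) \<in> AL j l" by blast
  hence j: "j \<le> I" by (rule AL_props)
  let ?S = "{(l, X', Y', r). (X', Y', r) \<in> AL j l \<and> (X' = W \<or> Y' = W)}"
  have "B j * card ?E = (\<Sum>(l, X', Y', r)\<in>?E. B j)" by simp
  also have "\<dots> \<le> (\<Sum>(l, X', Y', r)\<in>?E. cn j l X' r)" by (rule sum_mono) auto
  also have "\<dots> \<le> (\<Sum>(l, X', Y', r)\<in>?S. cn j l X' r)"
    by (rule sum_mono2[OF finite_al]) auto
  also have "\<dots> \<le> T j" using cnt[OF j, of W] by simp
  finally show ?thesis .
qed

lemma VS'_vv: "(Z, W) \<in> VS' j l \<Longrightarrow> isvv j Z \<and> isvv j W \<and> fst Z \<noteq> fst W \<and> j \<le> I"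
  using XY_vv[of j] VS_vv[of Z W j l] by (auto simp: VS'_def reach_def split: if_splits)

lemma VS'_Suc:
  assumes "j < I" "(Z, W) \<in> VS' j (Suc l)"
  shows "(Z, W) \<in> VS' j l \<and>
    card (common j Z W) \<le> 2 * card (common j Z W \<inter> {r. \<exists>W. (Z, W, r) \<in> AL j l})"
proof (cases "(Z, W) \<in> VS j (Suc l)")
  case True
  thus ?thesis using VS_Suc[OF assms(1) True] by (auto simp: VS'_def)
next
  case False
  hence new: "reach j" "pl j (Suc l)" "Z = X j" "W = Y j" using assms(2) by (auto simp: VS'_def split: if_splits)
  have "pl j l" "l < A" "ps a j l (x j) (y j)" using new(2) by (auto simp: pl_def)
  thus ?thesis using ps_blocked[OF assms(1)] new by (auto simp: VS'_def)
qed

lemma VS'_cov: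
  assumes "j < I" "(Z, W) \<in> VS' j (Suc l)" "r \<in> common j Z W"
  shows "(\<exists>W. (Z, W, r) \<in> AL j l) \<or> (\<exists>Z. (Z, W, r) \<in> AL j l)"
proof (cases "(Z, W) \<in> VS j (Suc l)")
  case True
  thus ?thesis using cov assms by blast
next
  case False
  hence new: "reach j" "pl j (Suc l)" "Z = X j" "W = Y j" using assms(2) by (auto simp: VS'_def split: if_splits)
  have "l < A" "ps a j l (x j) (y j)" using new(2) by (auto simp: pl_def)
  hence "l < A" "\<forall>r<R j. \<not> fr a j l (x j) (y j) r" by (auto simp: ps_def)
  from not_fr_cov[OF assms(1) this] show ?thesis using assms(3) new by blast
qed

lemma VS'_level:
  assumes "j < I" "(W, Z) \<in> VS' (Suc j) 0"
  shows "\<exists>X' Y'. (X', Y') \<in> VS' j 0 \<and> Z = map_prod id (\<lambda>e. e div 2) X' \<and> W = map_prod id (\<lambda>e. e div 2) Y' \<and>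
       ((\<exists>l r. (X', Y', r) \<in> AL j l \<and> B j \<le> cn j l X' r) \<or>
        (\<exists>l. card (common j X' Y') \<le> 2 * card (common j X' Y' \<inter> {r. \<exists>X. (X, Y', r) \<in> AL j l})) \<or>
        (X', Y') \<in> VS' j A)"
proof (cases "(W, Z) \<in> VS (Suc j) 0")
  case True
  from VS_level[OF assms(1) this] show ?thesis unfolding VS'_def by blast
next
  case False
  hence new: "reach (Suc j)" "W = X (Suc j)" "Z = Y (Suc j)" using assms(2) by (auto simp: VS'_def split: if_splits)
  have r: "reach j" "\<not> sl a j (x j) (y j)" using new(1) by (auto simp: reach_def)
  have 1: "(X j, Y j) \<in> VS' j 0" using r by (simp add: VS'_def pl_def)
  have 2: "Z = map_prod id (\<lambda>e. e div 2) (X j)" "W = map_prod id (\<lambda>e. e div 2) (Y j)"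
    using new xy(5,6)[of j] by (simp_all add: X_def Y_def ep_half)
  have 3: "pl j A \<Longrightarrow> (X j, Y j) \<in> VS' j A" using r by (simp add: VS'_def)
  show ?thesis using not_sl_cases[OF assms(1) r(2)] 1 2 3 by blast
qed

lemma ledger: "ledger n I K T0 A RI h VS' AL cn"
proof unfold_locales
  show "card {Y. (X, Y) \<in> VS' 0 0 \<or> (Y, X) \<in> VS' 0 0} \<le> T0" for X
    using vs0_new[of X] by simp
  show "isvv j Z \<and> isvv j W \<and> fst Z \<noteq> fst W" if "(Z, W) \<in> VS' j l" for j l Z W using VS'_vv[OF that] by simp
  show "(Z, W) \<in> VS' j l \<and> r < R j \<and> l < A" if "(Z, W, r) \<in> AL j l" for j l Z W r
    using AL_VS[OF that] by (simp add: VS'_def)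
qed (rule AL_tail AL_head VS'_Suc AL_once VS'_level exh; assumption)+

section \<open>A free row at the last level\<close>

interpretation L: ledger n I K T0 A RI h VS' AL cn by (rule ledger)

definition AU :: "nat \<Rightarrow> nat set" where
  "AU w = {r. \<exists>Z W. (Z, W, r) \<in> AL I 0 \<and> (Z = (w, 0) \<or> W = (w, 0))}"

lemma I_epoch: "isvv I Z \<Longrightarrow> Z = (fst Z, 0)"
  by (cases Z) (simp add: isvv_def epochs_def)

text \<open>The 6 is \<open>1 + 5\<close>. Exhausted rows number at most \<open>T0 / 2 ^ I\<close>
  by their color counts. Unexhausted ones are at most one per pair by \<open>AL_I_live\<close>,
  hence at most \<open>(T0 + 4 * T0) / 2 ^ I\<close> by \<open>bounds\<close>.\<close>

lemma card_AU: "2 ^ I * card (AU w) \<le> 6 * T0" and finite_AU: "finite (AU w)"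
proof -
  let ?V = "(w, 0) :: vv"
  define Ex where "Ex = {(l, X', Y', r). (X', Y', r) \<in> AL I l \<and> (X' = ?V \<or> Y' = ?V) \<and> B I \<le> cn I l X' r}"
  define Li where "Li = {r. \<exists>Z W. (Z, W, r) \<in> AL I 0 \<and> (Z = ?V \<or> W = ?V) \<and> cn I 0 Z r < B I}"
  have "Ex \<subseteq> {(l, X', Y', r). (X', Y', r) \<in> AL I l \<and> (X' = ?V \<or> Y' = ?V)}" by (auto simp: Ex_def)
  hence fEx: "finite Ex" using finite_al finite_subset by blast
  have fLi: "finite Li"
  proof (rule finite_subset)
    show "Li \<subseteq> {..<R I}" using AL_VS unfolding Li_def by blast
  qed simp
  have sub: "AU w \<subseteq> (\<lambda>(l, X', Y', r). r) ` Ex \<union> Li"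
  proof
    fix r assume "r \<in> AU w"
    then obtain Z W where ZW: "(Z, W, r) \<in> AL I 0" "Z = ?V \<or> W = ?V" by (auto simp: AU_def)
    show "r \<in> (\<lambda>(l, X', Y', r). r) ` Ex \<union> Li"
    proof (cases "cn I 0 Z r < B I")
      case True
      hence "r \<in> Li" using ZW unfolding Li_def by blast
      thus ?thesis by simp
    next
      case False
      hence "(0, Z, W, r) \<in> Ex" using ZW by (auto simp: Ex_def)
      thus ?thesis by force
    qed
  qed
  show "finite (AU w)" using sub fEx fLi finite_subset by blast
  have "card (AU w) \<le> card ((\<lambda>(l, X', Y', r). r) ` Ex \<union> Li)" using fEx fLi sub by (intro card_mono) auto
  also have "\<dots> \<le> card ((\<lambda>(l, X', Y', r). r) ` Ex) + card Li" by (rule card_Un_le)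
  also have "\<dots> \<le> card Ex + card Li" using card_image_le[OF fEx] by simp
  finally have c: "card (AU w) \<le> card Ex + card Li" .
  have "B I * card Ex \<le> T I" unfolding Ex_def by (rule exh)
  moreover have "B I = 2 ^ I * (8 * 2 ^ I)" unfolding B_def by (simp flip: power_mult_distrib)
  ultimately have "2 ^ I * (8 * (2 ^ I * card Ex)) \<le> 2 ^ I * T0" by (simp add: T_def mult_ac)
  hence 1: "2 ^ I * card Ex \<le> T0" by simp
  have fVT: "finite (L.VT I 0 ?V)" and fVH: "finite (L.VH I ?V)" by (rule L.finite_VT L.finite_VH)+
  have "Li \<subseteq> (\<lambda>p. THE r. (fst p, snd p, r) \<in> AL I 0 \<and> cn I 0 (fst p) r < B I) `
      (Pair ?V ` L.VT I 0 ?V \<union> (\<lambda>Z. (Z, ?V)) ` L.VH I ?V)"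
  proof
    fix r assume "r \<in> Li"
    then obtain Z W where ZW: "(Z, W, r) \<in> AL I 0" "Z = ?V \<or> W = ?V" "cn I 0 Z r < B I"
      by (auto simp: Li_def)
    have "(THE r. (Z, W, r) \<in> AL I 0 \<and> cn I 0 Z r < B I) = r"
      using AL_I_live[OF ZW(1)] ZW by (intro the_equality) blast+
    moreover have "(Z, W) \<in> VS' I 0" using AL_VS[OF ZW(1)] by (simp add: VS'_def)
    hence "(Z, W) \<in> Pair ?V ` L.VT I 0 ?V \<union> (\<lambda>Z. (Z, ?V)) ` L.VH I ?V"
      using ZW(2) by (auto simp: L.VT_def L.VH_def)
    ultimately show "r \<in> (\<lambda>p. THE r. (fst p, snd p, r) \<in> AL I 0 \<and> cn I 0 (fst p) r < B I) `
      (Pair ?V ` L.VT I 0 ?V \<union> (\<lambda>Z. (Z, ?V)) ` L.VH I ?V)"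
      by (intro image_eqI[of _ _ "(Z, W)"]) simp_all
  qed
  hence "card Li \<le> card (Pair ?V ` L.VT I 0 ?V \<union> (\<lambda>Z. (Z, ?V)) ` L.VH I ?V)"
    using fVT fVH by (intro surj_card_le) auto
  also have "\<dots> \<le> card (Pair ?V ` L.VT I 0 ?V) + card ((\<lambda>Z. (Z, ?V)) ` L.VH I ?V)" by (rule card_Un_le)
  also have "\<dots> \<le> card (L.VT I 0 ?V) + card (L.VH I ?V)"
    by (intro add_mono card_image_le fVT fVH)
  finally have "card Li \<le> card (L.VT I 0 ?V) + card (L.VH I ?V)" .
  hence "2 ^ I * card Li \<le> 2 ^ I * card (L.VT I 0 ?V) + 2 ^ I * card (L.VH I ?V)"
    by (simp flip: distrib_left)
  hence 2: "2 ^ I * card Li \<le> 5 * T0" using L.bounds[OF order_refl, of ?V] by linarith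
  have "2 ^ I * card (AU w) \<le> 2 ^ I * (card Ex + card Li)" using c by simp
  thus "2 ^ I * card (AU w) \<le> 6 * T0" using 1 2 by (simp add: distrib_left)
qed

lemma fr_I: "\<exists>r<R I. fr a I 0 (x I) (y I) r"
proof -
  have "2 ^ I * card (AU (x I) \<union> AU (y I)) \<le> 2 ^ I * (card (AU (x I)) + card (AU (y I)))"
    by (rule mult_le_mono2[OF card_Un_le])
  also have "\<dots> \<le> 12 * T0" using card_AU[of "x I"] card_AU[of "y I"] by (simp add: distrib_left)
  also have "\<dots> < 2 ^ I * RI" using RI by (simp add: mult_ac)
  finally have "card (AU (x I) \<union> AU (y I)) < RI" by simp
  hence "\<not> {..<RI} \<subseteq> AU (x I) \<union> AU (y I)"
    using card_mono[of "AU (x I) \<union> AU (y I)" "{..<RI}"] finite_AU by auto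
  then obtain r where r: "r < R I" "r \<notin> AU (x I)" "r \<notin> AU (y I)" by (auto simp: R_def)
  have e: "ep a I w = 0" if "w \<in> {u, v}" for w using ep_lt[OF that, of I] by (simp add: epochs_def)
  have "x I \<in> {u, v}" "y I \<in> {u, v}" using xy(4)[of I] by auto
  have "\<not> ut a I 0 w r \<and> \<not> uh a I 0 w r" if "w \<in> {u, v}" "r \<notin> AU w" for w
  proof -
    have "w < n" using that uv by auto
    hence "ut a I 0 w r \<longleftrightarrow> (\<exists>Y. ((w, 0), Y, r) \<in> AL I 0)" "uh a I 0 w r \<longleftrightarrow> (\<exists>X. (X, (w, 0), r) \<in> AL I 0)"
      using ut_iff[of I 0 w r] uh_iff[of I 0 w r] r A_pos e[OF that(1)] by simp_all
    thus ?thesis using that(2) unfolding AU_def by blast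
  qed
  hence "\<not> ut a I 0 (x I) r \<and> \<not> uh a I 0 (x I) r" "\<not> ut a I 0 (y I) r \<and> \<not> uh a I 0 (y I) r"
    using xy(4)[of I] r by blast+
  thus ?thesis using r by (auto simp: fr_def mA_def)
qed

lemma I_stop: "\<not> ps a I 0 (x I) (y I)" "sl a I (x I) (y I)"
proof -
  obtain r where r: "r < R I" "fr a I 0 (x I) (y I) r" using fr_I by blast
  show n: "\<not> ps a I 0 (x I) (y I)" using r unfolding ps_def by blast
  have "so a I 0 (x I) (y I)" using r unfolding so_def by blast
  thus "sl a I (x I) (y I)" using n A_pos unfolding sl_def by blast
qed

section \<open>The level, phase and row chosen for the new edge\<close>

abbreviation "J \<equiv> js a u v"
abbreviation "l0 \<equiv> ls a u v"
abbreviation "r0 \<equiv> rs a u v"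
abbreviation "b0 \<equiv> bs a u v"

lemma xs: "xs a u v = x J" and ys: "ys a u v = y J"
  by (simp_all add: xs_def ys_def x_def y_def)

lemma J: "reach J" "J \<le> I" "sl a J (x J) (y J)"
proof -
  have sl: "sl a I (tl_of I u v) (hd_of I u v)" using I_stop(2) by (simp add: x_def y_def)
  note m = mu_eq[of I "Suc I" "\<lambda>j. sl a j (tl_of j u v) (hd_of j u v)", OF _ sl]
  have "J < Suc I" using m(1) by (simp add: js_def)
  thus "J \<le> I" by simp
  show "sl a J (x J) (y J)" using m(2) by (simp add: js_def x_def y_def)
  show "reach J" using m(3) \<open>J \<le> I\<close> by (simp add: js_def x_def y_def reach_def)
qed

lemma l0: "l0 < A" "pl J l0" "\<not> ps a J l0 (x J) (y J)" "so a J l0 (x J) (y J)"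
proof -
  from J(3) obtain l where l: "l < A" "\<forall>l'<l. ps a J l' (x J) (y J)" "\<not> ps a J l (x J) (y J)" "so a J l (x J) (y J)"
    by (auto simp: sl_def)
  note m = mu_eq[of l A "\<lambda>l. \<not> ps a J l (x J) (y J)", OF l(1,3)]
  have e: "l0 = mu A (\<lambda>l. \<not> ps a J l (x J) (y J))" by (simp add: ls_def xs ys)
  have "l0 = l" using m(2,3)[folded e] l(2,3) by (cases l0 l rule: linorder_cases) auto
  thus "l0 < A" "pl J l0" "\<not> ps a J l0 (x J) (y J)" "so a J l0 (x J) (y J)" using l by (auto simp: pl_def)
qed

lemma l0_I: "J = I \<Longrightarrow> l0 = 0"
proof (rule ccontr)
  assume "J = I" "l0 \<noteq> 0"
  thus False using l0(2) I_stop(1) by (simp add: pl_def)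
qed

lemma live_row: "live a u v \<Longrightarrow> r0 < R J \<and> lv a J l0 (x J) (y J) r0"
proof -
  assume L: "live a u v"
  then obtain r where r: "r < R J" "lv a J l0 (x J) (y J) r" by (auto simp: live_def xs ys)
  have "r0 = mu (R J) (lv a J l0 (x J) (y J))" using L by (simp add: rs_def xs ys)
  thus ?thesis using mu_eq(1,2)[of r "R J" "lv a J l0 (x J) (y J)", OF r] by simp
qed

lemma free_row: "\<not> live a u v \<Longrightarrow> r0 < R J \<and> fr a J l0 (x J) (y J) r0 \<and>
    (J < I \<longrightarrow> (\<forall>r<R J. \<not> rc a J l0 (x J) (y J) r)) \<and> (\<forall>r<R J. \<not> lv a J l0 (x J) (y J) r)"
proof -
  assume L: "\<not> live a u v"
  hence nl: "\<forall>r<R J. \<not> lv a J l0 (x J) (y J) r" by (auto simp: live_def xs ys)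
  then obtain r where r: "r < R J" "fr a J l0 (x J) (y J) r"
    and nr: "(\<forall>r<R J. \<not> rc a J l0 (x J) (y J) r) \<or> J = I" using l0(4) by (auto simp: so_def)
  have "r0 = mu (R J) (fr a J l0 (x J) (y J))" using L by (simp add: rs_def xs ys)
  thus ?thesis using mu_eq(1,2)[of r "R J" "fr a J l0 (x J) (y J)", OF r] nr nl by auto
qed

lemma r0: "r0 < R J" using live_row free_row by blast

lemma b0: "live a u v \<Longrightarrow> (X J, Y J, r0) \<in> AL J l0 \<and> b0 = cn J l0 (X J) r0 \<and> b0 < B J"
  "\<not> live a u v \<Longrightarrow> b0 = 0 \<and> (X J, Y J, r0) \<notin> AL J l0"
proof -
  assume L: "live a u v"
  from live_row[OF L] have rc: "rc a J l0 (x J) (y J) r0" "a (adr 3 J l0 (x J) r0) < B J" by (auto simp: lv_def)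
  show "(X J, Y J, r0) \<in> AL J l0 \<and> b0 = cn J l0 (X J) r0 \<and> b0 < B J"
    using rc rc_xy[of J l0 r0] ct_xy[of J l0 r0] J(2) l0(1) r0 L by (simp add: bs_def xs)
next
  assume L: "\<not> live a u v"
  from free_row[OF L] have "\<not> ut a J l0 (x J) r0" by (simp add: fr_def)
  thus "b0 = 0 \<and> (X J, Y J, r0) \<notin> AL J l0"
    using L ut_x[OF J(2) l0(1) r0] unfolding bs_def by auto
qed

end

context step
begin

section \<open>The history after the allocation\<close>

definition AL' :: "nat \<Rightarrow> nat \<Rightarrow> (vv \<times> vv \<times> nat) set" where
  "AL' j l = AL j l \<union> (if j = J \<and> l = l0 then {(X J, Y J, r0)} else {})"
definition cn' :: "nat \<Rightarrow> nat \<Rightarrow> vv \<Rightarrow> nat \<Rightarrow> nat" where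
  "cn' j l Z r = (if j = J \<and> l = l0 \<and> Z = X J \<and> r = r0 then Suc b0 else cn j l Z r)"
definition col' :: "nat \<Rightarrow> (nat \<times> nat \<times> nat \<times> nat \<times> nat) set" where
  "col' w = col w \<union> (if w \<in> {u, v} then {tup a u v} else {})"
abbreviation "a' \<equiv> nxt a u v"

lemma VS_VS': "VS j l \<subseteq> VS' j l" by (simp add: VS'_def)
lemma AL_AL': "AL j l \<subseteq> AL' j l" by (simp add: AL'_def)

lemma AL'_cases:
  assumes "(Z, W, r) \<in> AL' j l"
  obtains "(Z, W, r) \<in> AL j l" | "j = J" "l = l0" "Z = X J" "W = Y J" "r = r0"
  using assms by (auto simp: AL'_def split: if_splits)

lemma new_AL': "(X J, Y J, r0) \<in> AL' J l0" by (simp add: AL'_def)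

lemma new_VS': "(X J, Y J) \<in> VS' J l0" using J(1) l0(2) by (simp add: VS'_def)

lemma free_UT: "\<not> live a u v \<Longrightarrow> (X J, W, r0) \<notin> AL J l0"
  using free_row ut_x[OF J(2) l0(1) r0] by (auto simp: fr_def)

lemma free_UH: "\<not> live a u v \<Longrightarrow> (Z, Y J, r0) \<notin> AL J l0"
  using free_row uh_y[OF J(2) l0(1) r0] by (auto simp: fr_def)

lemma new_tail: "(X J, W, r0) \<in> AL J l0 \<Longrightarrow> W = Y J"
  using free_UT AL_tail b0(1) by blast

lemma new_head: "(Z, Y J, r0) \<in> AL J l0 \<Longrightarrow> Z = X J"
  using free_UH AL_head b0(1) by blast

lemma AL'_tail: "(Z, W, r) \<in> AL' j l \<Longrightarrow> (Z, W', r) \<in> AL' j l \<Longrightarrow> W = W'"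
  by (elim AL'_cases) (metis AL_tail new_tail)+

lemma AL'_head: "(Z, W, r) \<in> AL' j l \<Longrightarrow> (Z', W, r) \<in> AL' j l \<Longrightarrow> Z = Z'"
  by (elim AL'_cases) (metis AL_head new_head)+

text \<open>Only a live row has its old count replaced, and by a larger one. So exhaustion is
  permanent, as \<open>VS_level\<close> requires.\<close>

lemma cn_cn': assumes "(Z, W, r) \<in> AL j l" shows "cn j l Z r \<le> cn' j l Z r"
proof (cases "j = J \<and> l = l0 \<and> Z = X J \<and> r = r0")
  case True
  hence "(X J, W, r0) \<in> AL J l0" using assms by simp
  hence "live a u v" using free_UT by blast
  thus ?thesis using True b0(1) by (simp add: cn'_def)
qed (auto simp: cn'_def)

lemma AL'_VS': "(Z, W, r) \<in> AL' j l \<Longrightarrow> (Z, W) \<in> VS' j l \<and> r < R j \<and> l < A"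
proof (elim AL'_cases)
  assume "(Z, W, r) \<in> AL j l"
  thus ?thesis using AL_VS VS_VS' by blast
qed (use new_VS' r0 l0(1) in auto)

lemma blocked_mono:
  assumes "card C \<le> 2 * card (C \<inter> S)" "S \<subseteq> S'" "finite C"
  shows "card C \<le> 2 * card (C \<inter> S')"
proof -
  have "card (C \<inter> S) \<le> card (C \<inter> S')" using assms by (intro card_mono) auto
  thus ?thesis using assms(1) by linarith
qed

lemma VS'_Suc':
  assumes "j < I" "(Z, W) \<in> VS' j (Suc l)"
  shows "(Z, W) \<in> VS' j l \<and>
    card (common j Z W) \<le> 2 * card (common j Z W \<inter> {r. \<exists>W. (Z, W, r) \<in> AL' j l})"
proof -
  note s = VS'_Suc[OF assms]
  have "{r. \<exists>W. (Z, W, r) \<in> AL j l} \<subseteq> {r. \<exists>W. (Z, W, r) \<in> AL' j l}" using AL_AL' by blast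
  thus ?thesis using s blocked_mono[OF _ _ finite_common] by blast
qed

lemma AL'_common: assumes "j < I" "(Z, W, r) \<in> AL' j l" shows "r \<in> common j Z W"
  using assms(2)
proof (cases rule: AL'_cases)
  case 1
  thus ?thesis using AL_common[OF assms(1)] by blast
next
  case 2
  show ?thesis
  proof (cases "live a u v")
    case True
    thus ?thesis using b0(1) AL_common[of J "X J" "Y J" r0 l0] 2 assms(1) by blast
  next
    case False
    hence "mA a J (x J) (y J) r0" using free_row by (simp add: fr_def)
    thus ?thesis using mA_xy[of J r0] r0 2 assms(1) by simp
  qed
qed

text \<open>Suppose a new row is taken although the pair holds one in phase \<open>l'\<close>. For
  \<open>l' < l0\<close> the pair could not have passed \<open>l'\<close>. For
  \<open>l' = l0\<close> the choice of a free row excludes it. For \<open>l' > l0\<close> the pair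
  passed \<open>l0\<close> earlier, and then \<open>cov\<close> puts every common row of phase
  \<open>l0\<close>, including \<open>r0\<close>, in use at one end, so \<open>r0\<close> is not
  free.\<close>

lemma AL'_once_new:
  assumes "J < I" "(X J, Y J, r') \<in> AL J l'" shows "l' = l0 \<and> r' = r0"
proof (cases "live a u v")
  case True
  thus ?thesis using b0(1) AL_once[OF assms(1) assms(2)] by blast
next
  case False
  have r': "r' < R J" "l' < A" using AL_VS[OF assms(2)] by auto
  have rc: "rc a J l' (x J) (y J) r'" using rc_xy[OF J(2) r'(2,1)] assms(2) by simp
  show ?thesis
  proof (cases l' l0 rule: linorder_cases)
    case less
    hence "ps a J l' (x J) (y J)" using l0(2) by (simp add: pl_def)
    thus ?thesis using rc r' by (auto simp: ps_def)
  next
    case equal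
    thus ?thesis using free_row[OF False] assms(1) rc r' by auto
  next
    case greater
    have "(X J, Y J) \<in> VS J l'" using AL_VS[OF assms(2)] by simp
    hence "(X J, Y J) \<in> VS J (Suc l0)" using VS_mono[OF assms(1)] greater by (simp add: Suc_leI)
    moreover have "mA a J (x J) (y J) r0" using free_row[OF False] by (simp add: fr_def)
    hence "r0 \<in> common J (X J) (Y J)" using mA_xy[OF assms(1) r0] by simp
    ultimately have "(\<exists>W. (X J, W, r0) \<in> AL J l0) \<or> (\<exists>Z. (Z, Y J, r0) \<in> AL J l0)" by (rule cov[OF assms(1)])
    thus ?thesis using free_UT[OF False] free_UH[OF False] by blast
  qed
qed

lemma AL'_once:
  assumes "j < I" "(Z, W, r) \<in> AL' j l" "(Z, W, r') \<in> AL' j l'" shows "l = l' \<and> r = r'"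
  using assms(2,3) AL'_once_new AL_once[OF assms(1)] assms(1)
  by (elim AL'_cases) (auto simp del: split_paired_All)

lemma VS'_level':
  assumes "j < I" "(W, Z) \<in> VS' (Suc j) 0"
  shows "\<exists>X' Y'. (X', Y') \<in> VS' j 0 \<and> Z = map_prod id (\<lambda>e. e div 2) X' \<and> W = map_prod id (\<lambda>e. e div 2) Y' \<and>
       ((\<exists>l r. (X', Y', r) \<in> AL' j l \<and> B j \<le> cn' j l X' r) \<or>
        (\<exists>l. card (common j X' Y') \<le> 2 * card (common j X' Y' \<inter> {r. \<exists>X. (X, Y', r) \<in> AL' j l})) \<or>
        (X', Y') \<in> VS' j A)"
proof -
  obtain X' Y' where XY: "(X', Y') \<in> VS' j 0" "Z = map_prod id (\<lambda>e. e div 2) X'" "W = map_prod id (\<lambda>e. e div 2) Y'"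
    and c: "(\<exists>l r. (X', Y', r) \<in> AL j l \<and> B j \<le> cn j l X' r) \<or>
        (\<exists>l. card (common j X' Y') \<le> 2 * card (common j X' Y' \<inter> {r. \<exists>X. (X, Y', r) \<in> AL j l})) \<or>
        (X', Y') \<in> VS' j A"
    using VS'_level[OF assms] by blast
  from c show ?thesis
  proof (elim disjE exE conjE)
    fix l r assume 1: "(X', Y', r) \<in> AL j l" "B j \<le> cn j l X' r"
    hence "(X', Y', r) \<in> AL' j l" "B j \<le> cn' j l X' r" using AL_AL' cn_cn'[OF 1(1)] le_trans by blast+
    thus ?thesis using XY by blast
  next
    fix l assume 1: "card (common j X' Y') \<le> 2 * card (common j X' Y' \<inter> {r. \<exists>X. (X, Y', r) \<in> AL j l})"
    have "{r. \<exists>X. (X, Y', r) \<in> AL j l} \<subseteq> {r. \<exists>X. (X, Y', r) \<in> AL' j l}" using AL_AL' by blast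
    from blocked_mono[OF 1 this finite_common] show ?thesis using XY by blast
  next
    assume "(X', Y') \<in> VS' j A"
    thus ?thesis using XY by blast
  qed
qed

lemma AL'_I0: "(Z, W, r) \<in> AL' I l \<Longrightarrow> l = 0"
  by (elim AL'_cases) (use AL_I0 l0_I in auto)

lemma XY_I: "fst (X I) = x I" "fst (Y I) = y I" "X I = (x I, 0)" "Y I = (y I, 0)"
  using I_epoch[of "X I"] I_epoch[of "Y I"] XY_vv[of I] by (simp_all add: X_def Y_def)

lemma AL_I_new:
  assumes "\<not> live a u v" "J = I" "(Z, W, r0) \<in> AL I 0"
  shows "fst Z \<noteq> x I \<and> fst Z \<noteq> y I \<and> fst W \<noteq> x I \<and> fst W \<noteq> y I"
proof -
  have l: "l0 = 0" using l0_I assms(2) by simp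
  have f: "\<not> ut a I 0 w r0 \<and> \<not> uh a I 0 w r0" if "w \<in> {x I, y I}" for w
    using free_row[OF assms(1)] that assms(2) l by (auto simp: fr_def)
  have e: "ep a I w = 0" if "w \<in> {x I, y I}" for w
    using XY_I that by (auto simp: X_def Y_def)
  have n: "\<not> (\<exists>Y. ((w, 0), Y, r0) \<in> AL I 0) \<and> \<not> (\<exists>X. (X, (w, 0), r0) \<in> AL I 0)" if "w \<in> {x I, y I}" for w
    using f[OF that] e[OF that] ut_iff[of I 0 w r0] uh_iff[of I 0 w r0] A_pos r0 assms(2) that xy(1,2)[of I]
    by auto
  have "Z = (fst Z, 0)" "W = (fst W, 0)" using AL_props(4,5)[OF assms(3)] I_epoch by blast+
  thus ?thesis using n assms(3) by (metis insertI1 insertI2)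
qed

text \<open>Residues cannot separate the pairs here, as all rows are admissible at the last level.
  Instead a row counts as free only if neither endpoint uses it in either role.\<close>

lemma AL'_I:
  assumes "(Z, W, r) \<in> AL' I 0" "(Z', W', r) \<in> AL' I 0"
    "fst Z = fst Z' \<or> fst Z = fst W' \<or> fst W = fst Z' \<or> fst W = fst W'"
  shows "Z = Z' \<and> W = W'"
proof -
  have new: "Z1 = X I \<and> W1 = Y I" if "J = I" "l0 = 0" "(Z1, W1, r0) \<in> AL I 0"
    "fst Z1 = x I \<or> fst Z1 = y I \<or> fst W1 = x I \<or> fst W1 = y I" for Z1 W1
  proof -
    have "live a u v" using AL_I_new[OF _ that(1,3)] that(4) by blast
    hence "(X I, Y I, r0) \<in> AL I 0" using b0(1) that by simp
    thus ?thesis using AL_I[OF that(3)] that(4) XY_I(1,2) by metis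
  qed
  from assms(1) show ?thesis
  proof (cases rule: AL'_cases)
    case 1
    from assms(2) show ?thesis
    proof (cases rule: AL'_cases)
      assume "(Z', W', r) \<in> AL I 0"
      thus ?thesis using AL_I[OF 1] assms(3) by blast
    next
      assume 2: "I = J" "0 = l0" "Z' = X J" "W' = Y J" "r = r0"
      thus ?thesis using new[of Z W] 1 assms(3) XY_I(1,2) by auto
    qed
  next
    assume 2: "I = J" "0 = l0" "Z = X J" "W = Y J" "r = r0"
    from assms(2) show ?thesis
    proof (cases rule: AL'_cases)
      assume "(Z', W', r) \<in> AL I 0"
      thus ?thesis using new[of Z' W'] 2 assms(3) XY_I(1,2) by auto
    qed (use 2 in auto)
  qed
qed

text \<open>A further row is taken only after no live one was found, so a pair never holds two
  unexhausted rows. The count of unexhausted rows in \<open>card_AU\<close> depends on this.\<close>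

lemma AL'_I_live:
  assumes "(Z, W, r) \<in> AL' I 0" "(Z, W, r') \<in> AL' I 0" "cn' I 0 Z r < B I" "cn' I 0 Z r' < B I"
  shows "r = r'"
proof -
  have new: "r1 = r0" if "J = I" "l0 = 0" "(X I, Y I, r1) \<in> AL I 0" "cn' I 0 (X I) r1 < B I" for r1
  proof -
    have c: "cn I 0 (X I) r1 < B I" using cn_cn'[OF that(3)] that(4) by simp
    have r1: "r1 < R I" using AL_VS[OF that(3)] by simp
    have "rc a I 0 (x I) (y I) r1" using rc_xy[of I 0 r1] that(3) r1 A_pos by simp
    hence "lv a I 0 (x I) (y I) r1" using ct_xy[of I 0 r1] r1 A_pos c by (simp add: lv_def)
    hence "live a u v" using r1 that(1,2) by (auto simp: live_def xs ys)
    from b0(1)[OF this] show ?thesis using AL_I_live[OF that(3) _ c, of r0] that by simp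
  qed
  from assms(1) show ?thesis
  proof (cases rule: AL'_cases)
    case 1
    from assms(2) show ?thesis
    proof (cases rule: AL'_cases)
      assume 2: "(Z, W, r') \<in> AL I 0"
      show ?thesis by (rule AL_I_live[OF 1 2])
        (use cn_cn'[OF 1] cn_cn'[OF 2] assms(3,4) in auto)
    next
      assume 2: "I = J" "0 = l0" "Z = X J" "W = Y J" "r' = r0"
      thus ?thesis using new[of r] 1 assms(3) by auto
    qed
  next
    assume 2: "I = J" "0 = l0" "Z = X J" "W = Y J" "r = r0"
    from assms(2) show ?thesis
    proof (cases rule: AL'_cases)
      assume "(Z, W, r') \<in> AL I 0"
      thus ?thesis using new[of r'] 2 assms(4) by auto
    qed (use 2 in auto)
  qed
qed

lemma a'_v: assumes "w < n" shows "a' w = (a(u := Suc (a u), v := Suc (a v))) w"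
proof -
  have "adr f j l x r \<noteq> w" "w \<noteq> adr f j l x r" for f j l x r using adr_ge[of f j l x r] assms by auto
  thus ?thesis by (simp add: nxt_def)
qed

text \<open>If the level is \<open>J\<close> and \<open>W\<close> belongs to the chosen pair, then
  the sum and the degree within the epoch both rise by one; the sum was at most the remainder modulo
  \<open>T j\<close>, so it respects both limits. Otherwise the sum is unchanged.\<close>

lemma cnt':
  assumes j: "j \<le> I"
  shows "(\<Sum>(l, X', Y', r)\<in>{(l, X', Y', r). (X', Y', r) \<in> AL' j l \<and> (X' = W \<or> Y' = W)}. cn' j l X' r)
       \<le> min (T j) (a' (fst W) - snd W * T j)"
proof -
  let ?S = "{(l, X', Y', r). (X', Y', r) \<in> AL j l \<and> (X' = W \<or> Y' = W)}"
  let ?S' = "{(l, X', Y', r). (X', Y', r) \<in> AL' j l \<and> (X' = W \<or> Y' = W)}"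
  let ?f = "\<lambda>(l, X', Y', r). cn j l X' r" and ?f' = "\<lambda>(l, X', Y', r). cn' j l X' r"
  let ?p = "(l0, X J, Y J, r0)"
  have fS: "finite ?S" by (rule finite_al)
  have f_eq: "?f' q = ?f q" if "q \<in> ?S" "q \<noteq> ?p \<or> j \<noteq> J" for q
  proof -
    obtain l X' Y' r where q: "q = (l, X', Y', r)" by (cases q)
    have AL: "(X', Y', r) \<in> AL j l" using that(1) q by simp
    have "\<not> (j = J \<and> l = l0 \<and> X' = X J \<and> r = r0)"
    proof
      assume c: "j = J \<and> l = l0 \<and> X' = X J \<and> r = r0"
      hence "Y' = Y J" using new_tail AL by blast
      thus False using that(2) q c by simp
    qed
    thus ?thesis by (auto simp: q cn'_def)
  qed
  show ?thesis
  proof (cases "j = J \<and> (W = X J \<or> W = Y J)")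
    case False
    have "?S' = ?S" using False by (auto simp: AL'_def split: if_splits)
    moreover have "sum ?f' ?S = sum ?f ?S"
      using False by (intro sum.cong refl f_eq) auto
    moreover have "sum ?f ?S \<le> min (T j) (a' (fst W) - snd W * T j)"
    proof (cases "?S = {}")
      case True
      thus ?thesis by (simp only: sum.empty)
    next
      case False
      then obtain l X' Y' r where "(X', Y', r) \<in> AL j l" "X' = W \<or> Y' = W" by auto
      hence "fst W < n" using AL_props(7,8) by blast
      hence "a (fst W) \<le> a' (fst W)" by (simp add: a'_v)
      hence "min (T j) (a (fst W) - snd W * T j) \<le> min (T j) (a' (fst W) - snd W * T j)"
        by (intro min.mono diff_le_mono order_refl)
      thus ?thesis using cnt[OF j, of W] by (rule le_trans[rotated])
    qed
    ultimately show ?thesis by simp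
  next
    case True
    hence S': "?S' = insert ?p ?S" by (auto simp: AL'_def split: if_splits)
    have W: "fst W \<in> {u, v}" using True xy_in[of J] by (elim disjE conjE) (simp_all add: X_def Y_def)
    have W2: "snd W = a (fst W) div T j" using True by (elim disjE conjE) (simp_all add: X_def Y_def ep_def)
    have rest: "sum ?f' (?S - {?p}) = sum ?f (?S - {?p})"
      by (intro sum.cong refl f_eq) auto
    have "sum ?f' (insert ?p ?S) = ?f' ?p + sum ?f' (?S - {?p})" by (rule sum.insert_remove[OF fS])
    also have "\<dots> = Suc b0 + sum ?f (?S - {?p})" unfolding rest using True by (simp add: cn'_def)
    \<comment> \<open>A live row was already counted with \<open>b0\<close>, a fresh one starts at
      \<open>b0 = 0\<close>; the sum grows by one in both cases.\<close>
    also have "\<dots> = Suc (sum ?f ?S)"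
    proof (cases "live a u v")
      case L: True
      have "?p \<in> ?S" using b0(1)[OF L] True by auto
      from sum.remove[OF fS this, of ?f] show ?thesis using b0(1)[OF L] True by simp
    next
      case L: False
      hence "?p \<notin> ?S" using b0(2) True by auto
      thus ?thesis using b0(2)[OF L] by simp
    qed
    finally have s: "sum ?f' ?S' = Suc (sum ?f ?S)" unfolding S' .
    have "sum ?f ?S \<le> a (fst W) mod T j" using cnt[OF j, of W] by (simp add: W2 minus_div_mult_eq_mod)
    moreover have "a (fst W) mod T j < T j" using T_pos by simp
    moreover have "a' (fst W) - snd W * T j = Suc (a (fst W) mod T j)"
    proof -
      have "fst W < n" using W uv by auto
      hence "a' (fst W) = (a(u := Suc (a u), v := Suc (a v))) (fst W)" by (rule a'_v)
      also have "\<dots> = Suc (a (fst W))" using W uv by auto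
      finally have "a' (fst W) = Suc (a (fst W))" .
      thus ?thesis by (simp add: W2 Suc_diff_le minus_div_mult_eq_mod)
    qed
    ultimately show ?thesis unfolding s by simp
  qed
qed

lemma vs0': "card {Z. (W, Z) \<in> VS' 0 0 \<or> (Z, W) \<in> VS' 0 0} \<le> min T0 (a' (fst W) - snd W * T0)"
proof (cases "{Z. (W, Z) \<in> VS' 0 0 \<or> (Z, W) \<in> VS' 0 0} = {}")
  case True
  show ?thesis unfolding True by simp
next
  case False
  hence "fst W < n" by (auto simp: isvv_def dest!: VS'_vv)
  thus ?thesis using vs0_new[of W] by (simp only: a'_v)
qed

lemma ep_mono: "w < n \<Longrightarrow> ep a j w \<le> ep a' j w"
  by (auto simp: ep_def a'_v intro: div_le_mono)

lemma a'_adr: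
  assumes "j \<le> I" "l < A" "w < n" "r < R j"
  shows "a' (adr 0 j l w r) = (if j = J \<and> l = l0 \<and> w = x J \<and> r = r0 then Suc (ep a J (x J)) else a (adr 0 j l w r))"
    "a' (adr 1 j l w r) = (if j = J \<and> l = l0 \<and> w = y J \<and> r = r0 then Suc (ep a J (y J)) else a (adr 1 j l w r))"
    "a' (adr 2 j l w r) = (if j = J \<and> l = l0 \<and> w = x J \<and> r = r0 then y J else a (adr 2 j l w r))"
    "a' (adr 3 j l w r) = (if j = J \<and> l = l0 \<and> w = x J \<and> r = r0 then Suc b0 else a (adr 3 j l w r))"
proof -
  have "adr f j l w r \<noteq> u" "adr f j l w r \<noteq> v" for f using adr_ge[of f j l w r] uv by auto
  moreover have "adr f j l w r = adr f' J l0 x' r0 \<longleftrightarrow> f = f' \<and> j = J \<and> l = l0 \<and> w = x' \<and> r = r0"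
    if "f < 4" "f' < 4" "x' < n" for f f' x'
    using that assms J(2) l0(1) r0 by (intro adr_inject) auto
  ultimately show "a' (adr 0 j l w r) = (if j = J \<and> l = l0 \<and> w = x J \<and> r = r0 then Suc (ep a J (x J)) else a (adr 0 j l w r))"
    "a' (adr 1 j l w r) = (if j = J \<and> l = l0 \<and> w = y J \<and> r = r0 then Suc (ep a J (y J)) else a (adr 1 j l w r))"
    "a' (adr 2 j l w r) = (if j = J \<and> l = l0 \<and> w = x J \<and> r = r0 then y J else a (adr 2 j l w r))"
    "a' (adr 3 j l w r) = (if j = J \<and> l = l0 \<and> w = x J \<and> r = r0 then Suc b0 else a (adr 3 j l w r))"
    using xy(1,2) by (simp_all add: nxt_def xs ys)
qed

lemma R1':
  assumes v: "j \<le> I" "l < A" "w < n" "r < R j" and e: "a' (adr 0 j l w r) = Suc e"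
  shows "\<exists>Y. ((w, e), Y, r) \<in> AL' j l \<and> a' (adr 2 j l w r) = fst Y \<and> a' (adr 3 j l w r) = cn' j l (w, e) r"
proof (cases "j = J \<and> l = l0 \<and> w = x J \<and> r = r0")
  case True
  hence "e = ep a J (x J)" using e a'_adr(1)[OF v] by simp
  hence "(w, e) = X J" using True by (simp add: X_def)
  thus ?thesis using True new_AL' a'_adr[OF v] by (intro exI[of _ "Y J"]) (auto simp: Y_def cn'_def)
next
  case False
  hence "a (adr 0 j l w r) = Suc e" using e a'_adr(1)[OF v] by auto
  from R1[OF v this] obtain Z where Z: "((w, e), Z, r) \<in> AL j l" "a (adr 2 j l w r) = fst Z"
    "a (adr 3 j l w r) = cn j l (w, e) r" by blast
  have "cn' j l (w, e) r = cn j l (w, e) r" using False by (auto simp: cn'_def X_def)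
  moreover have "((w, e), Z, r) \<in> AL' j l" using Z(1) AL_AL' by blast
  ultimately show ?thesis using Z False a'_adr[OF v] by (intro exI[of _ Z]) auto
qed

lemma R3':
  assumes v: "j \<le> I" "l < A" "w < n" "r < R j" and e: "a' (adr 1 j l w r) = Suc e"
  shows "\<exists>Z. (Z, (w, e), r) \<in> AL' j l"
proof (cases "j = J \<and> l = l0 \<and> w = y J \<and> r = r0")
  case True
  hence "e = ep a J (y J)" using e a'_adr(2)[OF v] by simp
  hence "(w, e) = Y J" using True by (simp add: Y_def)
  thus ?thesis using True new_AL' by auto
next
  case False
  hence "a (adr 1 j l w r) = Suc e" using e a'_adr(2)[OF v] by auto
  from R3[OF v this] show ?thesis using AL_AL' by blast
qed

lemma R2':
  assumes "(Z, W, r) \<in> AL' j l"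
  shows "snd Z < a' (adr 0 j l (fst Z) r) \<and> snd W < a' (adr 1 j l (fst W) r) \<and>
      snd Z \<le> ep a' j (fst Z) \<and> snd W \<le> ep a' j (fst W)"
  using assms
proof (cases rule: AL'_cases)
  case 1
  note p = AL_props[OF 1] and r2 = R2[OF 1]
  show ?thesis
    using r2 a'_adr(1)[OF p(3,2,7,1)] a'_adr(2)[OF p(3,2,8,1)] ep_mono[OF p(7), of j] ep_mono[OF p(8), of j]
    by (auto intro: le_trans)
next
  case 2
  show ?thesis
    using 2 a'_adr(1)[OF J(2) l0(1) xy(1) r0, of J] a'_adr(2)[OF J(2) l0(1) xy(2) r0, of J] ep_mono[OF xy(1), of J J]
      ep_mono[OF xy(2), of J J]
    by (simp add: X_def Y_def)
qed

lemma B_mono: "j \<le> I \<Longrightarrow> B j \<le> B I"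
  by (simp add: B_def power_increasing)

lemma b0_less: "b0 < B J"
  using b0 by (cases "live a u v") (auto simp: B_def)

lemma a'_le: "a' i \<le> n + \<Delta> + B I + 1"
proof -
  have "ep a J w \<le> \<Delta>" if "w \<in> {u, v}" for w
    using that du dv div_le_dividend[of "a w" "T J"] by (auto simp: ep_def simp del: div_le_dividend)
  hence "ep a J (x J) \<le> \<Delta>" "ep a J (y J) \<le> \<Delta>" using xy_in by blast+
  moreover have "Suc b0 \<le> B I" using b0_less B_mono[OF J(2)] by simp
  ultimately show ?thesis
    using a_le[of i] du dv xy(2)[of J] by (simp add: nxt_def xs ys)
qed

lemma tup: "tup a u v = (J, l0, r0, (h (fst (X J)) r0 + snd (X J)) mod M J, b0)"
  by (simp add: tup_def cs_def xs X_def)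

lemma col'_AL':
  assumes "(j, l, r, c, b) \<in> col' w"
  shows "\<exists>Z W. (Z, W, r) \<in> AL' j l \<and> (w = fst Z \<or> w = fst W) \<and>
      c = (h (fst Z) r + snd Z) mod M j \<and> b < cn' j l Z r"
proof (cases "(j, l, r, c, b) \<in> col w")
  case True
  from col[OF this] obtain Z W where ZW: "(Z, W, r) \<in> AL j l" "w = fst Z \<or> w = fst W"
    "c = (h (fst Z) r + snd Z) mod M j" "b < cn j l Z r" by blast
  have "(Z, W, r) \<in> AL' j l" "b < cn' j l Z r" using ZW AL_AL' cn_cn'[OF ZW(1)] by auto
  thus ?thesis using ZW by blast
next
  case False
  hence w: "w \<in> {u, v}" and t: "(j, l, r, c, b) = tup a u v" using assms by (auto simp: col'_def split: if_splits)
  have "w = fst (X J) \<or> w = fst (Y J)" using w xy(4)[of J] by (auto simp: X_def Y_def)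
  thus ?thesis using t new_AL' unfolding tup by (intro exI[of _ "X J"] exI[of _ "Y J"]) (simp add: cn'_def)
qed

lemma new_hist: "hist n I K T0 A RI h \<Delta> a' VS' AL' cn' col'"
proof unfold_locales
  show "isvv j Z \<and> isvv j W \<and> fst Z \<noteq> fst W \<and> j \<le> I" if "(Z, W) \<in> VS' j l" for j l Z W by (rule VS'_vv[OF that])
  show "(Z, W, r) \<in> AL' j l \<Longrightarrow> (Z, W', r) \<in> AL' j l \<Longrightarrow> W = W'" for j l Z W W' r by (rule AL'_tail)
  show "(Z, W, r) \<in> AL' j l \<Longrightarrow> (Z', W, r) \<in> AL' j l \<Longrightarrow> Z = Z'" for j l Z Z' W r by (rule AL'_head)
  show "(\<exists>Y. (Z, Y, r) \<in> AL' j l) \<or> (\<exists>X. (X, W, r) \<in> AL' j l)"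
    if "j < I" "(Z, W) \<in> VS' j (Suc l)" "r \<in> common j Z W" for j l Z W r
    using VS'_cov[OF that] AL_AL' by blast
qed (rule AL'_VS' VS'_Suc' AL'_common AL'_once VS'_level' AL'_I0 AL'_I AL'_I_live cnt' vs0' R1' R2' R3' col'_AL' a'_le; assumption)+

text \<open>A color present at \<open>w\<close> stems from an allocation with the same row and
  residue. The residues of \<open>w\<close> are \<open>h w r + e\<close> as tail and
  \<open>h w r + e + E j\<close> as head, with \<open>e < E j\<close>, and these are distinct modulo
  \<open>2 * E j\<close>. So role and epoch coincide and the pair is the same; but of its bundle
  only positions below \<open>b0\<close> have been used, or the row is fresh.\<close>

lemma tup_new: assumes w: "w \<in> {u, v}" shows "tup a u v \<notin> col w"
proof
  assume "tup a u v \<in> col w"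
  from col[OF this[unfolded tup]] obtain Z W where ZW: "(Z, W, r0) \<in> AL J l0" "w = fst Z \<or> w = fst W"
    "(h (fst (X J)) r0 + snd (X J)) mod M J = (h (fst Z) r0 + snd Z) mod M J" "b0 < cn J l0 Z r0" by blast
  have ZW': "(Z, W, r0) \<in> AL' J l0" using ZW(1) AL_AL' by blast
  have wxy: "w = fst (X J) \<or> w = fst (Y J)" using w xy(4)[of J] by (auto simp: X_def Y_def)
  have "Z = X J \<and> W = Y J"
  proof (cases "J = I")
    case True
    hence l: "l0 = 0" by (rule l0_I)
    show ?thesis
      using AL'_I[of Z W r0 "X J" "Y J"] ZW' new_AL' ZW(2) wxy True l by auto
  next
    case False
    hence j: "J < I" using J(2) by simp
    define c where "c = (h (fst (X J)) r0 + snd (X J)) mod M J"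
    have c1: "c = (h (fst (Y J)) r0 + snd (Y J) + E J) mod M J"
      using AL'_common[OF j new_AL'] by (simp add: common_def c_def)
    have c2: "c = (h (fst Z) r0 + snd Z) mod M J" using ZW(3) by (simp add: c_def)
    have c3: "c = (h (fst W) r0 + snd W + E J) mod M J"
      using AL'_common[OF j ZW'] c2 by (simp add: common_def)
    have can: "s = s'" if "(h w r0 + s) mod M J = (h w r0 + s') mod M J" "s < M J" "s' < M J" for s s'
    proof -
      have "(s + h w r0) mod M J = (s' + h w r0) mod M J" using that(1) by (simp add: add.commute)
      hence "s mod M J = s' mod M J" by (simp only: mod_add_cancel_nat)
      thus ?thesis using that by simp
    qed
    have e: "snd (X J) < E J" "snd (Y J) < E J" "snd Z < E J" "snd W < E J"
      using XY_vv[OF J(2)] AL_props(4,5)[OF ZW(1)] by (auto simp: isvv_def)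
    show ?thesis
    proof (cases "w = fst (X J)")
      case wX: True
      show ?thesis
      proof (cases "w = fst Z")
        case True
        have "snd Z = snd (X J)" using can[of "snd Z" "snd (X J)"] c2 c_def e True wX by (simp add: M_def)
        hence "Z = X J" using True wX by (simp add: prod_eq_iff)
        thus ?thesis using AL'_tail[OF ZW'] new_AL' by auto
      next
        case False
        hence "w = fst W" using ZW(2) by simp
        hence "snd W + E J = snd (X J)" using can[of "snd W + E J" "snd (X J)"] c3 c_def e wX by (simp add: M_def add_ac)
        thus ?thesis using e by simp
      qed
    next
      case False
      hence wY: "w = fst (Y J)" using wxy by simp
      show ?thesis
      proof (cases "w = fst Z")
        case True
        have "snd Z = snd (Y J) + E J" using can[of "snd Z" "snd (Y J) + E J"] c2 c1 e True wY by (simp add: M_def add_ac)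
        thus ?thesis using e by simp
      next
        case False
        hence wW: "w = fst W" using ZW(2) by simp
        hence "snd W + E J = snd (Y J) + E J"
          using can[of "snd W + E J" "snd (Y J) + E J"] c3 c1 e wY by (simp add: M_def add_ac)
        hence "W = Y J" using wW wY by (simp add: prod_eq_iff)
        thus ?thesis using AL'_head[OF ZW'] new_AL' by auto
      qed
    qed
  qed
  hence "(X J, Y J, r0) \<in> AL J l0" "b0 < cn J l0 (X J) r0" using ZW by auto
  thus False using b0 by (cases "live a u v") auto
qed

end

section \<open>The algorithm as a list of terms\<close>

abbreviation "tadd \<equiv> TB Plus"
abbreviation "tsub \<equiv> TB Minus"
abbreviation "tmul \<equiv> TB Times"
abbreviation "tdiv \<equiv> TB Div"
abbreviation "tmod \<equiv> TB Mod"
abbreviation "tlt \<equiv> TB Less"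
abbreviation "teq \<equiv> TB Equal"
abbreviation tnot :: "tm \<Rightarrow> tm" where "tnot t \<equiv> teq t (TN 0)"
abbreviation tor :: "tm \<Rightarrow> tm \<Rightarrow> tm" where "tor s t \<equiv> tlt (TN 0) (tadd s t)"
abbreviation tif :: "tm \<Rightarrow> tm \<Rightarrow> tm \<Rightarrow> tm" where "tif c s t \<equiv> tadd (tmul c s) (tmul (tnot c) t)"
abbreviation tex :: "nat \<Rightarrow> tm \<Rightarrow> tm \<Rightarrow> tm" where "tex x b t \<equiv> tlt (TN 0) (TS x b t)"
abbreviation tall :: "nat \<Rightarrow> tm \<Rightarrow> tm \<Rightarrow> tm" where "tall x b t \<equiv> tnot (TS x b (tnot t))"
definition tmu :: "nat \<Rightarrow> nat \<Rightarrow> tm \<Rightarrow> tm \<Rightarrow> tm" where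
  "tmu i k b t = TS i b (tall k (tadd (TX i) (TN 1)) (tnot t))"

lemma ev_tif: "ev q a (tif c t1 t2) s = (if P then ev q a t1 s else ev q a t2 s)"
  if "ev q a c s = of_bool P"
  using that by simp

lemma sum_of_bool: "(\<Sum>i<b. of_bool (P i)) = card {i. i < b \<and> P i}" for b :: nat
proof -
  have "(\<Sum>i<b. of_bool (P i)) = (\<Sum>i\<in>{i. i < b \<and> P i}. 1)"
    by (rule sum.mono_neutral_cong_right) auto
  also have "\<dots> = card {i. i < b \<and> P i}" by simp
  finally show ?thesis .
qed

lemma ev_count:
  assumes "\<And>i. i < ev q a b s \<Longrightarrow> ev q a t (s(x := i)) = of_bool (P i)"
  shows "ev q a (TS x b t) s = card {i. i < ev q a b s \<and> P i}"
  using assms by (simp add: sum_of_bool[symmetric])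

lemma ev_tex:
  assumes "\<And>i. i < ev q a b s \<Longrightarrow> ev q a t (s(x := i)) = of_bool (P i)"
  shows "ev q a (tex x b t) s = of_bool (\<exists>i<ev q a b s. P i)"
proof -
  have "finite {i. i < ev q a b s \<and> P i}" by simp
  hence "0 < card {i. i < ev q a b s \<and> P i} \<longleftrightarrow> (\<exists>i<ev q a b s. P i)"
    by (auto simp: card_gt_0_iff)
  thus ?thesis using ev_count[OF assms] by (simp del: ev.simps(6))
qed

lemma ev_tall:
  assumes "\<And>i. i < ev q a b s \<Longrightarrow> ev q a t (s(x := i)) = of_bool (P i)"
  shows "ev q a (tall x b t) s = of_bool (\<forall>i<ev q a b s. P i)"
proof -
  have "ev q a (TS x b (tnot t)) s = card {i. i < ev q a b s \<and> \<not> P i}"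
    by (rule ev_count) (simp add: assms)
  moreover have "card {i. i < ev q a b s \<and> \<not> P i} = 0 \<longleftrightarrow> (\<forall>i<ev q a b s. P i)"
    by auto
  ultimately show ?thesis by (simp del: ev.simps(6))
qed

lemma ev_tmu:
  assumes "\<And>i' k'. i' < ev q a b s \<Longrightarrow> k' \<le> i' \<Longrightarrow> ev q a t (s(i := i', k := k')) = of_bool (P k')"
  shows "ev q a (tmu i k b t) s = mu (ev q a b s) P"
  unfolding tmu_def mu_def
proof (rule ev_count)
  fix i' assume i': "i' < ev q a b s"
  have "ev q a (tall k (tadd (TX i) (TN 1)) (tnot t)) (s(i := i')) =
      of_bool (\<forall>k'<ev q a (tadd (TX i) (TN 1)) (s(i := i')). \<not> P k')"
    using assms[OF i'] by (intro ev_tall) simp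
  thus "ev q a (tall k (tadd (TX i) (TN 1)) (tnot t)) (s(i := i')) = of_bool (\<forall>k<Suc i'. \<not> P k)"
    by (simp del: ev.simps(6))
qed

text \<open>The variables are 0 for the cap of exponents, 1 for \<open>n\<close>, 2 for \<open>\<Delta>\<close>, 3 and 4 for the endpoints of the
  edge, 5 to 10 for \<open>K\<close>, \<open>I\<close>, \<open>T0\<close>, \<open>A\<close>, the encoding \<open>H\<close> of the table \<open>h\<close>, and \<open>RI\<close>.\<close>

definition "tE j = TP (tsub (TX 6) j)"
definition "tM j = tmul (TN 2) (tE j)"
definition "tR j = tif (tlt j (TX 6)) (tmul (tM j) (TX 5)) (TX 10)"
definition "tBd j = tmul (TN 8) (TP (tmul (TN 2) j))"
definition "tT j = tmul (TX 7) (TP j)"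
definition "tep j x = tdiv (TA x) (tT j)"
definition "tR0 = tmul (TN 2) (tmul (TP (TX 6)) (TX 5))"
text \<open>The stride \<open>tR0\<close> bounds the number of rows of every level: all levels read
  the same table, each an initial segment of its rows.\<close>

definition "th x r = tdiv (TX 9) (TP (tmul (tadd (TX 6) (TN 1)) (tadd (tmul x tR0) r)))"
definition "tOF j = tmul (TN 4) (tmul (TX 5) (tsub (TP (TX 6)) (tE j)))"
definition "tadr f j l x r =
  tadd (TX 1) (tadd (tmul (tadd (tmul (tadd (tmul (tadd (tOF j) r) (TX 8)) l) (TN 4)) (TN f)) (TX 1)) x)"
definition "tmA j x y r = tor (teq j (TX 6))
  (teq (tmod (tadd (th x r) (tep j x)) (tM j)) (tmod (tadd (tadd (th y r) (tep j y)) (tE j)) (tM j)))"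
definition "tut j l x r = teq (TA (tadr 0 j l x r)) (tadd (tep j x) (TN 1))"
definition "tuh j l x r = teq (TA (tadr 1 j l x r)) (tadd (tep j x) (TN 1))"
definition "tfr j l x y r = tmul (tmul (tmA j x y r) (tmul (tnot (tut j l x r)) (tnot (tuh j l y r))))
   (tor (tnot (teq j (TX 6))) (tmul (tnot (tuh j l x r)) (tnot (tut j l y r))))"
definition "trc j l x y r = tmul (tmA j x y r) (tmul (tut j l x r) (teq (TA (tadr 2 j l x r)) y))"
definition "tlv j l x y r = tmul (trc j l x y r) (tlt (TA (tadr 3 j l x r)) (tBd j))"
definition "tmin = tif (tlt (TX 3) (TX 4)) (TX 3) (TX 4)"
definition "tmax = tif (tlt (TX 3) (TX 4)) (TX 4) (TX 3)"
definition "ttl j = tif (tnot (tmod j (TN 2))) tmin tmax"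
definition "thd j = tif (tnot (tmod j (TN 2))) tmax tmin"
text \<open>In the terms of the decision, variable 30 runs over rows, 32 and 35 over phases and 31
  over levels, so that nested sums do not capture each other's variables.\<close>

definition "tps j l = (let J = TX j; L = TX l; x = ttl J; y = thd J in
   tmul (tmul (tall 30 (tR J) (tnot (trc J L x y (TX 30)))) (tall 30 (tR J) (tnot (tfr J L x y (TX 30)))))
    (tnot (tlt (tmul (TN 2) (TS 30 (tR J) (tmul (tmA J x y (TX 30)) (tut J L x (TX 30)))))
      (TS 30 (tR J) (tmA J x y (TX 30))))))"
definition "tlive j l = (let J = TX j; L = TX l; x = ttl J; y = thd J in tex 30 (tR J) (tlv J L x y (TX 30)))"
definition "tso j l = (let J = TX j; L = TX l; x = ttl J; y = thd J in
   tor (tlive j l) (tmul (tor (tall 30 (tR J) (tnot (trc J L x y (TX 30)))) (teq J (TX 6)))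
     (tex 30 (tR J) (tfr J L x y (TX 30)))))"
definition "tsl j = tex 35 (TX 8) (tmul (tall 32 (TX 35) (tps j 32)) (tmul (tnot (tps j 35)) (tso j 35)))"

text \<open>Variable 37 codes a set of rows by its binary digits. The disjunction is the implication
  in \<open>spread\<close>, with the smallness of the set negated.\<close>

definition "tgood_in = tor (tlt (tmul (tM (TX 31)) (TX 5))
     (tmul (TN 10) (TS 30 (tmul (tM (TX 31)) (TX 5)) (tmod (tdiv (TX 37) (TP (TX 30))) (TN 2)))))
   (tnot (tlt (TS 30 (tmul (tM (TX 31)) (TX 5)) (tmod (tdiv (TX 37) (TP (TX 30))) (TN 2)))
    (tmul (TN 32) (TS 38 (TX 1) (TS 39 (tM (TX 31)) (tmul (tnot (teq (TX 36) (TX 38))) (tnot (tlt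
       (tmul (TN 2) (TS 30 (tmul (tM (TX 31)) (TX 5)) (tmul (teq (tmod (th (TX 36) (TX 30)) (tM (TX 31)))
        (tmod (tadd (th (TX 38) (TX 30)) (TX 39)) (tM (TX 31)))) (tmod (tdiv (TX 37) (TP (TX 30))) (TN 2)))))
       (TS 30 (tmul (tM (TX 31)) (TX 5)) (teq (tmod (th (TX 36) (TX 30)) (tM (TX 31)))
        (tmod (tadd (th (TX 38) (TX 30)) (TX 39)) (tM (TX 31)))))))))))))"
definition "tgood = tall 31 (TX 6) (tall 36 (TX 1) (tall 37 (TP (tmul (tM (TX 31)) (TX 5))) tgood_in))"

text \<open>Entries are only used modulo divisors of \<open>2 ^ (I + 1)\<close>, so the higher digits of \<open>H\<close> do not matter.\<close>

definition hH :: "nat \<Rightarrow> nat \<Rightarrow> nat \<Rightarrow> nat \<Rightarrow> nat \<Rightarrow> nat" where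
  "hH I K H v r = H div 2 ^ ((I + 1) * (v * (2 * 2 ^ I * K) + r))"

text \<open>By \<open>cap\<close> no exponent below is cut off in a way that matters: the largest
  one addresses the last entry of the table, and it also exceeds the number of rows, the exponent in
  the enumeration of sets of rows.\<close>

locale cbase =
  fixes n I K G :: nat and q :: "nat list" and a :: "nat \<Rightarrow> nat"
  assumes cap: "(I + 1) * (n * (2 * 2 ^ I * K)) \<le> G" and K: "K \<ge> 1" and n: "n \<ge> 1"
begin

definition okb :: "(nat \<Rightarrow> nat) \<Rightarrow> bool" where
  "okb s \<longleftrightarrow> s 0 = G \<and> s 1 = n \<and> s 5 = K \<and> s 6 = I"

abbreviation evq where "evq \<equiv> ev q a"

lemma okbD: "okb s \<Longrightarrow> s 0 = G" "okb s \<Longrightarrow> s (Suc 0) = n" "okb s \<Longrightarrow> s 5 = K" "okb s \<Longrightarrow> s 6 = I"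
  by (simp_all add: okb_def)

lemma cap2: "2 * I + 2 \<le> G"
proof -
  have "(I + 1) * (1 * (2 * 1 * 1)) \<le> (I + 1) * (n * (2 * 2 ^ I * K))"
    using K n by (intro mult_le_mono order_refl) auto
  thus ?thesis using cap by simp
qed

lemma cap_R: "2 * 2 ^ I * K \<le> G"
proof -
  have "1 * (1 * (2 * 2 ^ I * K)) \<le> (I + 1) * (n * (2 * 2 ^ I * K))"
    using n by (intro mult_le_mono order_refl) auto
  thus ?thesis using cap by simp
qed

lemma ev_E: "okb s \<Longrightarrow> evq (tE j) s = epochs I (evq j s)"
  using cap2 by (simp add: tE_def epochs_def okbD min_absorb1)

lemma ev_M: "okb s \<Longrightarrow> evq (tM j) s = 2 * epochs I (evq j s)"
  by (simp add: tM_def ev_E)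

lemma ev_h: "okb s \<Longrightarrow> evq x s < n \<Longrightarrow> evq r s < 2 * 2 ^ I * K \<Longrightarrow> evq (th x r) s = hH I K (s 9) (evq x s) (evq r s)"
proof -
  assume ok: "okb s" and x: "evq x s < n" and r: "evq r s < 2 * 2 ^ I * K"
  have "Suc (evq x s) * (2 * 2 ^ I * K) \<le> n * (2 * 2 ^ I * K)" using x by (intro mult_le_mono1) simp
  hence "evq x s * (2 * 2 ^ I * K) + evq r s \<le> n * (2 * 2 ^ I * K)" using r by simp
  hence "(I + 1) * (evq x s * (2 * 2 ^ I * K) + evq r s) \<le> (I + 1) * (n * (2 * 2 ^ I * K))" by (rule mult_le_mono2)
  hence le: "(I + 1) * (evq x s * (2 * 2 ^ I * K) + evq r s) \<le> G" using cap by linarith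
  have R0: "evq tR0 s = 2 * 2 ^ I * K" using ok cap2 by (simp add: tR0_def okbD min_absorb1)
  have "evq (th x r) s = s 9 div 2 ^ min ((I + 1) * (evq x s * evq tR0 s + evq r s)) G"
    using ok by (simp add: th_def okbD)
  thus ?thesis unfolding R0 using le by (simp only: min_absorb1 hH_def)
qed

text \<open>The quantifier over sets of rows becomes a bounded loop over their codes via
  \<open>set_encode\<close> and \<open>set_decode\<close>. The blocked partners are counted by two
  nested sums, which \<open>card_SigmaI\<close> turns into one cardinality.\<close>

lemma ev_good:
  assumes ok: "okb s"
  shows "evq tgood s = of_bool (\<forall>j<I. spread n (2 * epochs I j) (2 * epochs I j * K) (hH I K (s 9)))"
proof -
  define Q where "Q j u x \<longleftrightarrow> (let M = 2 * epochs I j; R = M * K; U = set_decode x \<inter> {..<R} in R < 10 * card U \<or>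
     32 * card {(v, d). v < n \<and> v \<noteq> u \<and> d < M \<and> card (agree M R (hH I K (s 9) u) (hH I K (s 9) v) d) \<le>
       2 * card (agree M R (hH I K (s 9) u) (hH I K (s 9) v) d \<inter> U)} \<le> card U)" for j u x
  have Rj: "2 * epochs I j * K \<le> 2 * 2 ^ I * K" for j
    by (intro mult_le_mono1 mult_le_mono2) (simp add: epochs_def power_increasing)
  have RG: "2 * epochs I j * K \<le> G" for j using le_trans[OF Rj cap_R] .
  have inner: "evq tgood_in (s(31 := j, 36 := u, 37 := x)) = of_bool (Q j u x)" if j: "j < I" "u < n" for j u x
  proof -
    let ?M = "2 * epochs I j" let ?R = "?M * K" let ?h = "hH I K (s 9)"
    define U where "U = set_decode x \<inter> {..<?R}"
    let ?s = "s(31 := j, 36 := u, 37 := x)"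
    have bit: "evq (tmod (tdiv (TX 37) (TP (TX 30))) (TN 2)) s' = of_bool (r \<in> set_decode x)"
      if "okb s'" "s' 37 = x" "s' 30 = r" "r < ?R" for s' r
    proof -
      have "min r G = r" using that(4) RG[of j] by simp
      thus ?thesis using that by (simp add: okbD set_decode_def mod_2_eq_odd)
    qed
    have okU: "okb (?s(y := i))" if "y > 6" for y i using ok that by (simp add: okb_def)
    have okU2: "okb (?s(38 := v, 39 := d, 30 := r))" "okb (?s(38 := v, 39 := d))" "okb (?s(38 := v))" "okb ?s" for v d r
      using ok by (simp_all add: okb_def)
    have cU: "evq (TS 30 (tmul (tM (TX 31)) (TX 5)) (tmod (tdiv (TX 37) (TP (TX 30))) (TN 2))) ?s = card U"
    proof -
      have "evq (TS 30 (tmul (tM (TX 31)) (TX 5)) (tmod (tdiv (TX 37) (TP (TX 30))) (TN 2))) ?s =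
         card {r. r < evq (tmul (tM (TX 31)) (TX 5)) ?s \<and> r \<in> set_decode x}"
        by (rule ev_count, rule bit) (simp_all add: okU2 okU ev_M okbD[OF ok])
      also have "evq (tmul (tM (TX 31)) (TX 5)) ?s = ?R" by (simp add: okU2 ev_M okbD[OF ok])
      also have "{r. r < ?R \<and> r \<in> set_decode x} = U" by (auto simp: U_def)
      finally show ?thesis .
    qed
    have ag: "evq (teq (tmod (th (TX 36) (TX 30)) (tM (TX 31))) (tmod (tadd (th (TX 38) (TX 30)) (TX 39)) (tM (TX 31))))
        (?s(38 := v, 39 := d, 30 := r)) = of_bool (r \<in> agree ?M ?R (?h u) (?h v) d)"
      if "v < n" "r < ?R" for v d r
    proof -
      have r: "r < 2 * 2 ^ I * K" using that(2) Rj[of j] by (rule less_le_trans)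
      have "evq (th (TX 36) (TX 30)) (?s(38 := v, 39 := d, 30 := r)) = ?h u r"
        "evq (th (TX 38) (TX 30)) (?s(38 := v, 39 := d, 30 := r)) = ?h v r"
        using ev_h[OF okU2(1), of "TX 36" v d r "TX 30"] ev_h[OF okU2(1), of "TX 38" v d r "TX 30"] r that(1) j(2)
        by simp_all
      thus ?thesis using that(2) by (simp add: okU2 ev_M agree_def)
    qed
    have cZ: "evq (TS 30 (tmul (tM (TX 31)) (TX 5)) (teq (tmod (th (TX 36) (TX 30)) (tM (TX 31)))
        (tmod (tadd (th (TX 38) (TX 30)) (TX 39)) (tM (TX 31))))) (?s(38 := v, 39 := d)) = card (agree ?M ?R (?h u) (?h v) d)"
      if "v < n" for v d
    proof -
      have b: "evq (tmul (tM (TX 31)) (TX 5)) (?s(38 := v, 39 := d)) = ?R" by (simp add: okU2 ev_M okbD[OF ok])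
      have "{r. r < ?R \<and> r \<in> agree ?M ?R (?h u) (?h v) d} = agree ?M ?R (?h u) (?h v) d" by (auto simp: agree_def)
      thus ?thesis using ev_count[of q a "tmul (tM (TX 31)) (TX 5)" "?s(38 := v, 39 := d)" _ 30
          "\<lambda>r. r \<in> agree ?M ?R (?h u) (?h v) d", unfolded b, OF ag[OF that]] by simp
    qed
    have cZU: "evq (TS 30 (tmul (tM (TX 31)) (TX 5)) (tmul (teq (tmod (th (TX 36) (TX 30)) (tM (TX 31)))
        (tmod (tadd (th (TX 38) (TX 30)) (TX 39)) (tM (TX 31)))) (tmod (tdiv (TX 37) (TP (TX 30))) (TN 2))))
        (?s(38 := v, 39 := d)) = card (agree ?M ?R (?h u) (?h v) d \<inter> U)"
      if "v < n" for v d
    proof -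
      have b: "evq (tmul (tM (TX 31)) (TX 5)) (?s(38 := v, 39 := d)) = ?R" by (simp add: okU2 ev_M okbD[OF ok])
      have se: "{r. r < ?R \<and> (r \<in> agree ?M ?R (?h u) (?h v) d \<and> r \<in> set_decode x)} = agree ?M ?R (?h u) (?h v) d \<inter> U"
        by (auto simp: agree_def U_def)
      have e: "evq (tmul (teq (tmod (th (TX 36) (TX 30)) (tM (TX 31)))
        (tmod (tadd (th (TX 38) (TX 30)) (TX 39)) (tM (TX 31)))) (tmod (tdiv (TX 37) (TP (TX 30))) (TN 2)))
        (?s(38 := v, 39 := d, 30 := r)) = of_bool (r \<in> agree ?M ?R (?h u) (?h v) d \<and> r \<in> set_decode x)" if "r < ?R" for r
        using ag[OF \<open>v < n\<close> that, of d] bit[of "?s(38 := v, 39 := d, 30 := r)" r, OF okU2(1) _ _ that]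
        by (simp only: ev.simps(5) binop_val.simps) simp
      show ?thesis
        by (rule ev_count[of q a "tmul (tM (TX 31)) (TX 5)" "?s(38 := v, 39 := d)" _ 30
          "\<lambda>r. r \<in> agree ?M ?R (?h u) (?h v) d \<and> r \<in> set_decode x", unfolded b, OF e, unfolded se])
    qed
    have cB: "evq (TS 38 (TX 1) (TS 39 (tM (TX 31)) (tmul (tnot (teq (TX 36) (TX 38))) (tnot (tlt
       (tmul (TN 2) (TS 30 (tmul (tM (TX 31)) (TX 5)) (tmul (teq (tmod (th (TX 36) (TX 30)) (tM (TX 31)))
        (tmod (tadd (th (TX 38) (TX 30)) (TX 39)) (tM (TX 31)))) (tmod (tdiv (TX 37) (TP (TX 30))) (TN 2)))))
       (TS 30 (tmul (tM (TX 31)) (TX 5)) (teq (tmod (th (TX 36) (TX 30)) (tM (TX 31)))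
        (tmod (tadd (th (TX 38) (TX 30)) (TX 39)) (tM (TX 31)))))))))) ?s =
      card {(v, d). v < n \<and> v \<noteq> u \<and> d < ?M \<and> card (agree ?M ?R (?h u) (?h v) d) \<le> 2 * card (agree ?M ?R (?h u) (?h v) d \<inter> U)}"
      (is "evq (TS 38 (TX 1) (TS 39 _ ?t)) ?s = card ?S")
    proof -
      have t: "evq ?t (?s(38 := v, 39 := d)) = of_bool (v \<noteq> u \<and>
          card (agree ?M ?R (?h u) (?h v) d) \<le> 2 * card (agree ?M ?R (?h u) (?h v) d \<inter> U))" if "v < n" for v d
        using cZ[OF that, of d] cZU[OF that, of d] by (simp only: ev.simps(1,2,5) binop_val.simps) (auto simp: not_less)
      have "evq (TS 38 (TX 1) (TS 39 (tM (TX 31)) ?t)) ?s = (\<Sum>v<n. evq (TS 39 (tM (TX 31)) ?t) (?s(38 := v)))"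
        by (simp add: okU2 okbD[OF ok] del: ev.simps(5))
      also have "\<dots> = (\<Sum>v<n. card {d. d < ?M \<and> v \<noteq> u \<and>
          card (agree ?M ?R (?h u) (?h v) d) \<le> 2 * card (agree ?M ?R (?h u) (?h v) d \<inter> U)})"
      proof (rule sum.cong)
        fix v assume "v \<in> {..<n}"
        hence v: "v < n" by simp
        have b: "evq (tM (TX 31)) (?s(38 := v)) = ?M" by (simp add: okU2 ev_M)
        show "evq (TS 39 (tM (TX 31)) ?t) (?s(38 := v)) = card {d. d < ?M \<and> v \<noteq> u \<and>
          card (agree ?M ?R (?h u) (?h v) d) \<le> 2 * card (agree ?M ?R (?h u) (?h v) d \<inter> U)}"
          by (rule ev_count[of q a "tM (TX 31)" "?s(38 := v)" ?t 39 "\<lambda>d. v \<noteq> u \<and>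
            card (agree ?M ?R (?h u) (?h v) d) \<le> 2 * card (agree ?M ?R (?h u) (?h v) d \<inter> U)", unfolded b, OF t[OF v]])
      qed simp
      also have "\<dots> = card (SIGMA v:{..<n}. {d. d < ?M \<and> v \<noteq> u \<and>
          card (agree ?M ?R (?h u) (?h v) d) \<le> 2 * card (agree ?M ?R (?h u) (?h v) d \<inter> U)})"
        by (rule card_SigmaI[symmetric]) auto
      also have "(SIGMA v:{..<n}. {d. d < ?M \<and> v \<noteq> u \<and>
          card (agree ?M ?R (?h u) (?h v) d) \<le> 2 * card (agree ?M ?R (?h u) (?h v) d \<inter> U)}) = ?S" by auto
      finally show ?thesis .
    qed
    have b: "evq (tmul (tM (TX 31)) (TX 5)) ?s = ?R" by (simp add: okU2 ev_M okbD[OF ok])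
    show ?thesis
      unfolding tgood_in_def Q_def Let_def U_def[symmetric]
      using cU cB b by (simp only: ev.simps(1,5) binop_val.simps) (auto simp: not_less)
  qed
  have "evq tgood s = of_bool (\<forall>j<I. \<forall>u<n. \<forall>x<2 ^ (2 * epochs I j * K). Q j u x)"
  proof -
    have 3: "evq (tall 37 (TP (tmul (tM (TX 31)) (TX 5))) tgood_in) (s(31 := j, 36 := u)) =
        of_bool (\<forall>x<2 ^ (2 * epochs I j * K). Q j u x)" if "j < I" "u < n" for j u
    proof -
      have b: "evq (TP (tmul (tM (TX 31)) (TX 5))) (s(31 := j, 36 := u)) = 2 ^ (2 * epochs I j * K)"
        using ok RG[of j] by (simp add: ev_M okb_def min_absorb1)
      show ?thesis
        by (rule ev_tall[of q a "TP (tmul (tM (TX 31)) (TX 5))" "s(31 := j, 36 := u)" tgood_in 37 "Q j u",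
          unfolded b, OF inner[OF that]])
    qed
    have 2: "evq (tall 36 (TX 1) (tall 37 (TP (tmul (tM (TX 31)) (TX 5))) tgood_in)) (s(31 := j)) =
        of_bool (\<forall>u<n. \<forall>x<2 ^ (2 * epochs I j * K). Q j u x)" if "j < I" for j
    proof -
      have b: "evq (TX 1) (s(31 := j)) = n" by (simp add: okbD[OF ok])
      show ?thesis
        by (rule ev_tall[of q a "TX 1" "s(31 := j)" "tall 37 (TP (tmul (tM (TX 31)) (TX 5))) tgood_in" 36
          "\<lambda>u. \<forall>x<2 ^ (2 * epochs I j * K). Q j u x", unfolded b, OF 3[OF that]])
    qed
    have b: "evq (TX 6) s = I" by (simp add: okbD[OF ok])
    show ?thesis unfolding tgood_def
      by (rule ev_tall[of q a "TX 6" s "tall 36 (TX 1) (tall 37 (TP (tmul (tM (TX 31)) (TX 5))) tgood_in)" 31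
          "\<lambda>j. \<forall>u<n. \<forall>x<2 ^ (2 * epochs I j * K). Q j u x", unfolded b, OF 2])
  qed
  also have "(\<forall>j<I. \<forall>u<n. \<forall>x<2 ^ (2 * epochs I j * K). Q j u x) \<longleftrightarrow>
      (\<forall>j<I. spread n (2 * epochs I j) (2 * epochs I j * K) (hH I K (s 9)))"
  proof -
    have "(\<forall>x<2 ^ (2 * epochs I j * K). Q j u x) \<longleftrightarrow> (\<forall>U\<subseteq>{..<2 * epochs I j * K}. 10 * card U \<le> 2 * epochs I j * K \<longrightarrow>
       32 * card {(v, d). v < n \<and> v \<noteq> u \<and> d < 2 * epochs I j \<and> card (agree (2 * epochs I j) (2 * epochs I j * K) (hH I K (s 9) u) (hH I K (s 9) v) d) \<le>
       2 * card (agree (2 * epochs I j) (2 * epochs I j * K) (hH I K (s 9) u) (hH I K (s 9) v) d \<inter> U)} \<le> card U)"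
      (is "?L \<longleftrightarrow> ?R") for j u
    proof
      assume L: ?L
      show ?R
      proof (intro allI impI)
        fix U assume U: "U \<subseteq> {..<2 * epochs I j * K}" "10 * card U \<le> 2 * epochs I j * K"
        have fU: "finite U" using U(1) finite_subset by blast
        have "set_encode U < 2 ^ (2 * epochs I j * K)"
        proof -
          have "set_encode U \<le> set_encode {..<2 * epochs I j * K}"
            unfolding set_encode_def by (rule sum_mono2) (use U in auto)
          also have "\<dots> < 2 ^ (2 * epochs I j * K)"
            by (simp add: set_encode_def lessThan_atLeast0 sum_power2)
          finally show ?thesis .
        qed
        with L have "Q j u (set_encode U)" by blast
        moreover have "set_decode (set_encode U) \<inter> {..<2 * epochs I j * K} = U" using fU U by auto
        ultimately show "32 * card {(v, d). v < n \<and> v \<noteq> u \<and> d < 2 * epochs I j \<and> card (agree (2 * epochs I j) (2 * epochs I j * K) (hH I K (s 9) u) (hH I K (s 9) v) d) \<le>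
       2 * card (agree (2 * epochs I j) (2 * epochs I j * K) (hH I K (s 9) u) (hH I K (s 9) v) d \<inter> U)} \<le> card U"
          using U(2) by (simp add: Q_def Let_def)
      qed
    next
      assume R: ?R
      show ?L
      proof (intro allI impI)
        fix x :: nat
        let ?U = "set_decode x \<inter> {..<2 * epochs I j * K}"
        show "Q j u x" unfolding Q_def Let_def using R[rule_format, of ?U, OF Int_lower2] leI by blast
      qed
    qed
    thus ?thesis by (simp add: spread_def)
  qed
  finally show ?thesis .
qed

end

locale code = algo n I K T0 A RI "hH I K H" \<Delta> + cbase n I K G q a
  for n I K T0 A RI \<Delta> H G :: nat and q :: "nat list" and a :: "nat \<Rightarrow> nat" +
  fixes u v :: nat
  assumes RI_le: "RI \<le> 2 * 2 ^ I * K" and uv: "u < n" "v < n" "u \<noteq> v"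
begin

definition ok :: "(nat \<Rightarrow> nat) \<Rightarrow> bool" where
  "ok s \<longleftrightarrow> okb s \<and> s 3 = u \<and> s 4 = v \<and> s 7 = T0 \<and> s 8 = A \<and> s 9 = H \<and> s 10 = RI"

lemma ok_upd: "ok s \<Longrightarrow> x > 10 \<Longrightarrow> ok (s(x := i))"
  by (simp add: ok_def okb_def)

lemma okD: "ok s \<Longrightarrow> s 3 = u" "ok s \<Longrightarrow> s 4 = v"
  "ok s \<Longrightarrow> s 7 = T0" "ok s \<Longrightarrow> s 8 = A" "ok s \<Longrightarrow> s 9 = H" "ok s \<Longrightarrow> s 10 = RI"
  "ok s \<Longrightarrow> okb s" "ok s \<Longrightarrow> s 0 = G" "ok s \<Longrightarrow> s (Suc 0) = n" "ok s \<Longrightarrow> s 5 = K" "ok s \<Longrightarrow> s 6 = I"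
  by (simp_all add: ok_def okb_def)

lemma ev_M': "ok s \<Longrightarrow> evq (tM j) s = M (evq j s)"
  by (simp add: M_def ev_M okD)

lemma ev_R: "ok s \<Longrightarrow> evq (tR j) s = R (evq j s)"
  by (simp add: tR_def R_def ev_M' okD)

lemma ev_Bd: "ok s \<Longrightarrow> evq j s \<le> I \<Longrightarrow> evq (tBd j) s = B (evq j s)"
  using cap2 by (simp add: tBd_def B_def okD min_absorb1 power_mult)

lemma ev_ep: "ok s \<Longrightarrow> evq j s \<le> I \<Longrightarrow> evq (tep j x) s = ep a (evq j s) (evq x s)"
  using cap2 by (simp add: tep_def ep_def T_def tT_def okD min_absorb1)

lemma ev_OF: "ok s \<Longrightarrow> evq (tOF j) s = OF (evq j s)"
  using cap2 by (simp add: tOF_def OF_def ev_E okD epochs_def min_absorb1)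

lemma ev_adr: "ok s \<Longrightarrow> evq (tadr f j l x r) s = adr f (evq j s) (evq l s) (evq x s) (evq r s)"
  by (simp add: tadr_def adr_def ev_OF okD)

lemma R_R0: "j \<le> I \<Longrightarrow> R j \<le> 2 * 2 ^ I * K"
proof (cases "j < I")
  case True
  have "2 * (2::nat) ^ (I - j) * K \<le> 2 * 2 ^ I * K"
    by (intro mult_le_mono1 mult_le_mono2 power_increasing) auto
  thus ?thesis using True by (simp add: R_def M_def epochs_def)
qed (use RI_le in \<open>auto simp: R_def\<close>)

definition okj :: "(nat \<Rightarrow> nat) \<Rightarrow> tm \<Rightarrow> tm \<Rightarrow> tm \<Rightarrow> tm \<Rightarrow> bool" where
  "okj s j x y r \<longleftrightarrow> ok s \<and> evq j s \<le> I \<and> evq x s < n \<and> evq y s < n \<and> evq r s < R (evq j s)"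

lemma okjD: "okj s j x y r \<Longrightarrow> ok s" "okj s j x y r \<Longrightarrow> evq j s \<le> I" "okj s j x y r \<Longrightarrow> evq x s < n"
  "okj s j x y r \<Longrightarrow> evq y s < n" "okj s j x y r \<Longrightarrow> evq r s < 2 * 2 ^ I * K"
  using R_R0 by (auto simp: okj_def intro: less_le_trans)

lemma ev_mA: "okj s j x y r \<Longrightarrow> evq (tmA j x y r) s = of_bool (mA a (evq j s) (evq x s) (evq y s) (evq r s))"
  using okjD[of s j x y r] by (simp add: tmA_def mA_def ev_h ev_ep ev_M' ev_E okD)

lemma ev_ut: "ok s \<Longrightarrow> evq j s \<le> I \<Longrightarrow> evq (tut j l x r) s = of_bool (ut a (evq j s) (evq l s) (evq x s) (evq r s))"
  by (simp add: tut_def ut_def ev_adr ev_ep)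

lemma ev_uh: "ok s \<Longrightarrow> evq j s \<le> I \<Longrightarrow> evq (tuh j l x r) s = of_bool (uh a (evq j s) (evq l s) (evq x s) (evq r s))"
  by (simp add: tuh_def uh_def ev_adr ev_ep)

lemma ev_fr: "okj s j x y r \<Longrightarrow> evq (tfr j l x y r) s = of_bool (fr a (evq j s) (evq l s) (evq x s) (evq y s) (evq r s))"
  using okjD[of s j x y r] by (simp add: tfr_def fr_def ev_mA ev_ut ev_uh okD)

lemma ev_rc: "okj s j x y r \<Longrightarrow> evq (trc j l x y r) s = of_bool (rc a (evq j s) (evq l s) (evq x s) (evq y s) (evq r s))"
  using okjD[of s j x y r] by (simp add: trc_def rc_def ev_mA ev_ut ev_adr)

lemma ev_lv: "okj s j x y r \<Longrightarrow> evq (tlv j l x y r) s = of_bool (lv a (evq j s) (evq l s) (evq x s) (evq y s) (evq r s))"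
  using okjD[of s j x y r] by (simp add: tlv_def lv_def ev_rc ev_adr ev_Bd)

lemma ev_tl: "ok s \<Longrightarrow> evq (ttl j) s = tl_of (evq j s) u v"
  by (simp add: ttl_def tmin_def tmax_def tl_of_def okD even_iff_mod_2_eq_zero min_def max_def)

lemma ev_hd: "ok s \<Longrightarrow> evq (thd j) s = hd_of (evq j s) u v"
  by (simp add: thd_def tmin_def tmax_def hd_of_def okD even_iff_mod_2_eq_zero min_def max_def)

lemma tl_hd_lt: "tl_of j u v < n" "hd_of j u v < n"
  using uv by (auto simp: tl_of_def hd_of_def)

lemma okj_row: "ok s \<Longrightarrow> j \<noteq> 30 \<Longrightarrow> s j \<le> I \<Longrightarrow> r < R (s j) \<Longrightarrow>
   okj (s(30 := r)) (TX j) (ttl (TX j)) (thd (TX j)) (TX 30)"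
  by (simp add: okj_def ok_upd ev_tl ev_hd tl_hd_lt)

lemma ev_rows:
  assumes "ok s" "j \<noteq> 30" "l \<noteq> 30" "s j \<le> I" "r < R (s j)"
  shows "evq (trc (TX j) (TX l) (ttl (TX j)) (thd (TX j)) (TX 30)) (s(30 := r)) =
      of_bool (rc a (s j) (s l) (tl_of (s j) u v) (hd_of (s j) u v) r)"
    "evq (tfr (TX j) (TX l) (ttl (TX j)) (thd (TX j)) (TX 30)) (s(30 := r)) =
      of_bool (fr a (s j) (s l) (tl_of (s j) u v) (hd_of (s j) u v) r)"
    "evq (tlv (TX j) (TX l) (ttl (TX j)) (thd (TX j)) (TX 30)) (s(30 := r)) =
      of_bool (lv a (s j) (s l) (tl_of (s j) u v) (hd_of (s j) u v) r)"
    "evq (tmA (TX j) (ttl (TX j)) (thd (TX j)) (TX 30)) (s(30 := r)) =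
      of_bool (mA a (s j) (tl_of (s j) u v) (hd_of (s j) u v) r)"
    "evq (tut (TX j) (TX l) (ttl (TX j)) (TX 30)) (s(30 := r)) =
      of_bool (ut a (s j) (s l) (tl_of (s j) u v) r)"
  using okj_row[OF assms(1,2,4,5)] assms
  by (simp_all add: ev_rc ev_fr ev_lv ev_mA ev_ut ok_upd ev_tl ev_hd)

lemma ev_tRx: "ok s \<Longrightarrow> evq (tR (TX j)) s = R (s j)" by (simp add: ev_R)

lemma ev_live:
  assumes "ok s" "j \<noteq> 30" "l \<noteq> 30" "s j \<le> I"
  shows "evq (tlive j l) s = of_bool (\<exists>r<R (s j). lv a (s j) (s l) (tl_of (s j) u v) (hd_of (s j) u v) r)"
  unfolding tlive_def Let_def
  using ev_tex[of q a "tR (TX j)" s _ 30, unfolded ev_tRx[OF assms(1)], OF ev_rows(3)[OF assms]] .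

lemma ev_ps:
  assumes "ok s" "j \<noteq> 30" "l \<noteq> 30" "s j \<le> I"
  shows "evq (tps j l) s = of_bool (ps a (s j) (s l) (tl_of (s j) u v) (hd_of (s j) u v))"
proof -
  let ?x = "tl_of (s j) u v" and ?y = "hd_of (s j) u v"
  note R = ev_tRx[OF assms(1), of j]
  have 1: "evq (tall 30 (tR (TX j)) (tnot (trc (TX j) (TX l) (ttl (TX j)) (thd (TX j)) (TX 30)))) s =
      of_bool (\<forall>r<R (s j). \<not> rc a (s j) (s l) ?x ?y r)"
    using ev_tall[of q a "tR (TX j)" s "tnot (trc (TX j) (TX l) (ttl (TX j)) (thd (TX j)) (TX 30))" 30
       "\<lambda>r. \<not> rc a (s j) (s l) ?x ?y r"] ev_rows(1)[OF assms] R by (simp del: ev.simps(6))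
  have 2: "evq (tall 30 (tR (TX j)) (tnot (tfr (TX j) (TX l) (ttl (TX j)) (thd (TX j)) (TX 30)))) s =
      of_bool (\<forall>r<R (s j). \<not> fr a (s j) (s l) ?x ?y r)"
    using ev_tall[of q a "tR (TX j)" s "tnot (tfr (TX j) (TX l) (ttl (TX j)) (thd (TX j)) (TX 30))" 30
       "\<lambda>r. \<not> fr a (s j) (s l) ?x ?y r"] ev_rows(2)[OF assms] R by (simp del: ev.simps(6))
  have 3: "evq (TS 30 (tR (TX j)) (tmA (TX j) (ttl (TX j)) (thd (TX j)) (TX 30))) s =
      card {r. r < R (s j) \<and> mA a (s j) ?x ?y r}"
    using ev_count[of q a "tR (TX j)" s "tmA (TX j) (ttl (TX j)) (thd (TX j)) (TX 30)" 30
       "\<lambda>r. mA a (s j) ?x ?y r"] ev_rows(4)[OF assms] R by (simp del: ev.simps(6))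
  have 4: "evq (TS 30 (tR (TX j)) (tmul (tmA (TX j) (ttl (TX j)) (thd (TX j)) (TX 30)) (tut (TX j) (TX l) (ttl (TX j)) (TX 30)))) s =
      card {r. r < R (s j) \<and> (mA a (s j) ?x ?y r \<and> ut a (s j) (s l) ?x r)}"
    using ev_count[of q a "tR (TX j)" s "tmul (tmA (TX j) (ttl (TX j)) (thd (TX j)) (TX 30)) (tut (TX j) (TX l) (ttl (TX j)) (TX 30))" 30
       "\<lambda>r. mA a (s j) ?x ?y r \<and> ut a (s j) (s l) ?x r"] ev_rows(4,5)[OF assms] R by (simp del: ev.simps(6))
  show ?thesis unfolding tps_def Let_def ps_def
    using 1 2 3 4 by (simp only: ev.simps(1,5) binop_val.simps) (auto simp: not_less)
qed

lemma ev_so: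
  assumes "ok s" "j \<noteq> 30" "l \<noteq> 30" "s j \<le> I"
  shows "evq (tso j l) s = of_bool (so a (s j) (s l) (tl_of (s j) u v) (hd_of (s j) u v))"
proof -
  let ?x = "tl_of (s j) u v" and ?y = "hd_of (s j) u v"
  note R = ev_tRx[OF assms(1), of j]
  have 1: "evq (tall 30 (tR (TX j)) (tnot (trc (TX j) (TX l) (ttl (TX j)) (thd (TX j)) (TX 30)))) s =
      of_bool (\<forall>r<R (s j). \<not> rc a (s j) (s l) ?x ?y r)"
    using ev_tall[of q a "tR (TX j)" s "tnot (trc (TX j) (TX l) (ttl (TX j)) (thd (TX j)) (TX 30))" 30
       "\<lambda>r. \<not> rc a (s j) (s l) ?x ?y r"] ev_rows(1)[OF assms] R by (simp del: ev.simps(6))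
  have 2: "evq (tex 30 (tR (TX j)) (tfr (TX j) (TX l) (ttl (TX j)) (thd (TX j)) (TX 30))) s =
      of_bool (\<exists>r<R (s j). fr a (s j) (s l) ?x ?y r)"
    using ev_tex[of q a "tR (TX j)" s "tfr (TX j) (TX l) (ttl (TX j)) (thd (TX j)) (TX 30)" 30
       "\<lambda>r. fr a (s j) (s l) ?x ?y r"] ev_rows(2)[OF assms] R by (simp del: ev.simps(6))
  have 3: "evq (TX 6) s = I" using assms(1) by (simp add: okD)
  show ?thesis unfolding tso_def Let_def so_def
    using 1 2 3 ev_live[OF assms] by (simp only: ev.simps(1,2,5) binop_val.simps) auto
qed

text \<open>The hypothesis on \<open>j\<close> keeps the level out of the variables 30, 32 and 35,
  which the term binds.\<close>

lemma ev_sl: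
  assumes "ok s" "j = 31 \<or> j = 11" "s j \<le> I"
  shows "evq (tsl j) s = of_bool (sl a (s j) (tl_of (s j) u v) (hd_of (s j) u v))"
proof -
  let ?x = "tl_of (s j) u v" and ?y = "hd_of (s j) u v"
  have inner: "evq (tmul (tall 32 (TX 35) (tps j 32)) (tmul (tnot (tps j 35)) (tso j 35))) (s(35 := l)) =
    of_bool ((\<forall>l'<l. ps a (s j) l' ?x ?y) \<and> \<not> ps a (s j) l ?x ?y \<and> so a (s j) l ?x ?y)" for l
  proof -
    have j: "(s(35 := l)) j = s j" "(s(35 := l, 32 := l')) j = s j" "j \<noteq> 30" for l' using assms(2) by auto
    have okl: "ok (s(35 := l))" "ok (s(35 := l, 32 := l'))" for l' using assms(1) by (simp_all add: ok_upd)
    have 1: "evq (tall 32 (TX 35) (tps j 32)) (s(35 := l)) = of_bool (\<forall>l'<l. ps a (s j) l' ?x ?y)"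
      using ev_tall[of q a "TX 35" "s(35 := l)" "tps j 32" 32 "\<lambda>l'. ps a (s j) l' ?x ?y"]
        ev_ps[OF okl(2) j(3), of 32] j assms(3) by (simp del: ev.simps(6))
    show ?thesis
      using 1 ev_ps[OF okl(1) j(3), of 35] ev_so[OF okl(1) j(3), of 35] j assms(3)
      by (simp only: ev.simps(1,5) binop_val.simps) auto
  qed
  have b: "evq (TX 8) s = A" using assms(1) by (simp add: okD)
  have "evq (tsl j) s = of_bool (\<exists>l<evq (TX 8) s. (\<forall>l'<l. ps a (s j) l' ?x ?y) \<and> \<not> ps a (s j) l ?x ?y \<and> so a (s j) l ?x ?y)"
    unfolding tsl_def by (rule ev_tex) (rule inner)
  thus ?thesis unfolding b sl_def .
qed

end

text \<open>Counts the powers of two up to \<open>t\<close>, recognized as the positive numbers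
  without an odd divisor other than 1. Capped powers are not yet available at the first use, which
  computes the cap itself.\<close>

definition "tflog t = TS 30 (tadd t (TN 1)) (tmul (tlt (TN 0) (TX 30)) (tall 31 (tadd (TX 30) (TN 1))
   (tor (tor (tnot (tmod (TX 31) (TN 2))) (teq (TX 31) (TN 1))) (tmod (TX 30) (TX 31)))))"

definition "tpr x y = tadd (tmul (tadd x y) (tadd x y)) y"

text \<open>Variable 0 is first \<open>L\<close>, which suffices for finding the small parameters,
  and then \<open>G\<close>, which the search for the table needs.\<close>

definition params :: "(nat \<times> tm) list" where
  "params = [(1, TI 0), (2, TI 1), (3, TI 2), (4, TI 3), (0, tflog (tmul (TX 1) (TX 2))),
  (5, tmul (TN 1024) (TX 0)),
  (6, TS 30 (TX 0) (tlt (tmul (TP (tmul (TN 2) (TX 30))) (TX 5)) (tmul (TN 40) (TX 2)))),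
  (7, tadd (tdiv (TX 2) (TP (TX 6))) (TN 1)), (8, tflog (TX 2)),
  (10, tadd (tdiv (tmul (TN 12) (TX 7)) (TP (TX 6))) (TN 1)),
  (0, tmul (tadd (TX 6) (TN 1)) (tmul (TX 1) tR0)), (9, tmu 40 9 (TP (TX 0)) tgood)]"

text \<open>All addresses and values are computed before anything is written, so they refer to the
  old array. Variable 27 assembles the color from the innermost pair outwards.\<close>

definition decide :: "(nat \<times> tm) list" where
  "decide = [(11, tmu 34 31 (tadd (TX 6) (TN 1)) (tsl 31)), (12, ttl (TX 11)), (13, thd (TX 11)),
  (14, tmu 35 32 (TX 8) (tnot (tps 11 32))), (15, tlive 11 14),
  (16, tif (TX 15) (tmu 36 30 (tR (TX 11)) (tlv (TX 11) (TX 14) (ttl (TX 11)) (thd (TX 11)) (TX 30)))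
     (tmu 36 30 (tR (TX 11)) (tfr (TX 11) (TX 14) (ttl (TX 11)) (thd (TX 11)) (TX 30)))),
  (17, tmul (TX 15) (TA (tadr 3 (TX 11) (TX 14) (TX 12) (TX 16)))),
  (18, tadr 0 (TX 11) (TX 14) (TX 12) (TX 16)), (19, tadd (tep (TX 11) (TX 12)) (TN 1)),
  (20, tadr 1 (TX 11) (TX 14) (TX 13) (TX 16)), (21, tadd (tep (TX 11) (TX 13)) (TN 1)),
  (22, tadr 2 (TX 11) (TX 14) (TX 12) (TX 16)), (23, tadr 3 (TX 11) (TX 14) (TX 12) (TX 16)),
  (24, tadd (TX 17) (TN 1)), (25, tadd (TA (TX 3)) (TN 1)), (26, tadd (TA (TX 4)) (TN 1)),
  (27, tmod (tadd (th (TX 12) (TX 16)) (tep (TX 11) (TX 12))) (tM (TX 11))),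
  (27, tpr (TX 27) (TX 17)), (27, tpr (TX 16) (TX 27)), (27, tpr (TX 14) (TX 27)), (27, tpr (TX 11) (TX 27))]"

definition writes :: "(nat \<times> nat) list" where
  "writes = [(18, 19), (20, 21), (22, 13), (23, 24), (3, 25), (4, 26)]"

text \<open>Splitting off the largest power of two leaves an odd divisor, which must be 1.
  Conversely, a divisor of \<open>2 ^ i\<close> is a power of two, hence odd only if it is
  1.\<close>

lemma power_of_two_iff:
  fixes x :: nat
  assumes "x > 0" shows "(\<forall>d<Suc x. even d \<or> d = 1 \<or> x mod d > 0) \<longleftrightarrow> (\<exists>i. x = 2 ^ i)"
proof
  assume *: "\<forall>d<Suc x. even d \<or> d = 1 \<or> x mod d > 0"
  obtain d where d: "x = 2 ^ multiplicity 2 x * d" "\<not> 2 dvd d"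
    using multiplicity_decompose'[of x 2] assms by auto
  have "d dvd x" using d(1) by (metis dvd_triv_right)
  hence "d < Suc x" "x mod d = 0" using assms by (auto dest: dvd_imp_le)
  hence "d = 1" using * d(2) by auto
  thus "\<exists>i. x = 2 ^ i" using d(1) by auto
next
  assume "\<exists>i. x = 2 ^ i"
  then obtain i where i: "x = 2 ^ i" by blast
  show "\<forall>d<Suc x. even d \<or> d = 1 \<or> x mod d > 0"
  proof (intro allI impI)
    fix d assume "d < Suc x"
    show "even d \<or> d = 1 \<or> x mod d > 0"
    proof (rule ccontr)
      assume "\<not> ?thesis"
      hence "odd d" "d \<noteq> 1" "d dvd 2 ^ i" using i by (auto simp: mod_eq_0_iff_dvd)
      then obtain k where "d = 2 ^ k" by (auto simp: divides_primepow_nat)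
      thus False using \<open>odd d\<close> \<open>d \<noteq> 1\<close> by (cases k) auto
    qed
  qed
qed

lemma card_powers_of_two: "t > 0 \<Longrightarrow> card {x. x < Suc t \<and> 0 < x \<and> (\<exists>i. x = 2 ^ i)} = floorlog 2 t"
proof -
  assume t: "t > 0"
  note b = floorlog_bounds[OF t, of 2, simplified]
  have "{x. x < Suc t \<and> 0 < x \<and> (\<exists>i. x = 2 ^ i)} = (\<lambda>i. 2 ^ i) ` {..<floorlog 2 t}"
  proof (intro equalityI subsetI)
    fix x assume "x \<in> {x. x < Suc t \<and> 0 < x \<and> (\<exists>i. x = 2 ^ i)}"
    then obtain i where i: "x = 2 ^ i" "2 ^ i \<le> t" by auto
    have "(2::nat) ^ i < 2 ^ floorlog 2 t" using i(2) b by linarith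
    thus "x \<in> (\<lambda>i. 2 ^ i) ` {..<floorlog 2 t}" using i by auto
  next
    fix x :: nat assume "x \<in> (\<lambda>i. 2 ^ i) ` {..<floorlog 2 t}"
    then obtain i where i: "x = 2 ^ i" "i < floorlog 2 t" by auto
    have "(2::nat) ^ i \<le> 2 ^ (floorlog 2 t - Suc 0)" using i(2) by (intro power_increasing) auto
    hence "2 ^ i \<le> t" using b by linarith
    thus "x \<in> {x. x < Suc t \<and> 0 < x \<and> (\<exists>i. x = 2 ^ i)}" using i by auto
  qed
  moreover have "inj_on (\<lambda>i. (2::nat) ^ i) {..<floorlog 2 t}" by (auto intro!: inj_onI)
  ultimately show ?thesis by (simp add: card_image)
qed

lemma ev_flog:
  assumes "ev q a t s > 0" shows "ev q a (tflog t) s = floorlog 2 (ev q a t s)"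
proof -
  have 1: "ev q a (tall 31 (tadd (TX 30) (TN 1)) (tor (tor (tnot (tmod (TX 31) (TN 2))) (teq (TX 31) (TN 1)))
     (tmod (TX 30) (TX 31)))) (s(30 := x)) = of_bool (\<forall>d<ev q a (tadd (TX 30) (TN 1)) (s(30 := x)). even d \<or> d = 1 \<or> x mod d > 0)" for x
    by (rule ev_tall) (auto simp: even_iff_mod_2_eq_zero)
  have "ev q a (tflog t) s = card {x. x < ev q a (tadd t (TN 1)) s \<and> (0 < x \<and> (\<forall>d<Suc x. even d \<or> d = 1 \<or> x mod d > 0))}"
    unfolding tflog_def
  proof (rule ev_count)
    fix x
    show "ev q a (tmul (tlt (TN 0) (TX 30)) (tall 31 (tadd (TX 30) (TN 1))
       (tor (tor (tnot (tmod (TX 31) (TN 2))) (teq (TX 31) (TN 1))) (tmod (TX 30) (TX 31))))) (s(30 := x)) =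
       of_bool (0 < x \<and> (\<forall>d<Suc x. even d \<or> d = 1 \<or> x mod d > 0))"
      using 1[of x] by (simp del: ev.simps(6))
  qed
  also have "{x. x < ev q a (tadd t (TN 1)) s \<and> (0 < x \<and> (\<forall>d<Suc x. even d \<or> d = 1 \<or> x mod d > 0))} =
      {x. x < Suc (ev q a t s) \<and> 0 < x \<and> (\<exists>i. x = 2 ^ i)}"
  proof -
    have "0 < x \<and> (\<forall>d<Suc x. even d \<or> d = 1 \<or> x mod d > 0) \<longleftrightarrow> 0 < x \<and> (\<exists>i. x = 2 ^ i)" for x
    proof (cases "0 < x")
      case True
      thus ?thesis by (simp only: power_of_two_iff[OF True])
    qed (simp only: simp_thms)
    thus ?thesis by (simp only: ev.simps binop_val.simps Suc_eq_plus1)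
  qed
  also have "card \<dots> = floorlog 2 (ev q a t s)" by (rule card_powers_of_two[OF assms])
  finally show ?thesis .
qed

section \<open>Choice of the parameters\<close>

definition LL :: "nat \<Rightarrow> nat \<Rightarrow> nat" where "LL n \<Delta> = floorlog 2 (n * \<Delta>)"
definition KK :: "nat \<Rightarrow> nat \<Rightarrow> nat" where "KK n \<Delta> = 1024 * LL n \<Delta>"
text \<open>The least \<open>i\<close> with \<open>4 ^ i * K \<ge> 40 * \<Delta>\<close>, found by
  counting the smaller ones. It balances the epoch length, about \<open>\<Delta> / 2 ^ I\<close>,
  against the \<open>K * 2 ^ I\<close> rows that such an epoch needs.\<close>

definition II :: "nat \<Rightarrow> nat \<Rightarrow> nat" where
  "II n \<Delta> = card {i. i < LL n \<Delta> \<and> 2 ^ (2 * i) * KK n \<Delta> < 40 * \<Delta>}"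
definition TT :: "nat \<Rightarrow> nat \<Rightarrow> nat" where "TT n \<Delta> = \<Delta> div 2 ^ II n \<Delta> + 1"
definition AA :: "nat \<Rightarrow> nat" where "AA \<Delta> = floorlog 2 \<Delta>"
definition RR :: "nat \<Rightarrow> nat \<Rightarrow> nat" where "RR n \<Delta> = 12 * TT n \<Delta> div 2 ^ II n \<Delta> + 1"
definition GG :: "nat \<Rightarrow> nat \<Rightarrow> nat" where "GG n \<Delta> = (II n \<Delta> + 1) * (n * (2 * 2 ^ II n \<Delta> * KK n \<Delta>))"
text \<open>The least code of a good table. Being canonical, it comes out the same at every arrival,
  so the table need not be kept between arrivals.\<close>

definition HH :: "nat \<Rightarrow> nat \<Rightarrow> nat" where
  "HH n \<Delta> = mu (2 ^ GG n \<Delta>) (\<lambda>H. \<forall>j<II n \<Delta>. spread n (2 * epochs (II n \<Delta>) j)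
     (2 * epochs (II n \<Delta>) j * KK n \<Delta>) (hH (II n \<Delta>) (KK n \<Delta>) H))"

section \<open>Inequalities between the parameters\<close>

locale sizes =
  fixes n \<Delta> :: nat
  assumes n: "n \<ge> 2" and \<Delta>: "\<Delta> \<ge> 2"
begin

abbreviation "L \<equiv> LL n \<Delta>"
abbreviation "K \<equiv> KK n \<Delta>"
abbreviation "I \<equiv> II n \<Delta>"
abbreviation "T0 \<equiv> TT n \<Delta>"

lemma L_bounds: "n * \<Delta> < 2 ^ L" "2 ^ (L - 1) \<le> n * \<Delta>"
  using floorlog_bounds[of "n * \<Delta>" 2] n \<Delta> by (auto simp: LL_def)

lemma n_lt: "n < 2 ^ L" and \<Delta>_lt: "\<Delta> < 2 ^ L"
proof -
  have "n * 1 \<le> n * \<Delta>" "1 * \<Delta> \<le> n * \<Delta>" using n \<Delta> by (intro mult_le_mono; simp)+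
  thus "n < 2 ^ L" "\<Delta> < 2 ^ L" using L_bounds by linarith+
qed

lemma L_ge: "L \<ge> 3"
proof (rule ccontr)
  assume "\<not> ?thesis"
  hence "(2::nat) ^ L \<le> 2 ^ 2" by (intro power_increasing) auto
  moreover have "2 * 2 \<le> n * \<Delta>" using n \<Delta> by (rule mult_le_mono)
  ultimately show False using L_bounds by simp
qed

lemma I_set: "{i. i < L \<and> 2 ^ (2 * i) * K < 40 * \<Delta>} = {..<I}"
proof -
  let ?S = "{i. i < L \<and> 2 ^ (2 * i) * K < 40 * \<Delta>}"
  have down: "j \<in> ?S" if "i \<in> ?S" "j \<le> i" for i j
  proof -
    have "(2::nat) ^ (2 * j) * K \<le> 2 ^ (2 * i) * K" using that(2) by (intro mult_le_mono1 power_increasing) auto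
    moreover have "2 ^ (2 * i) * K < 40 * \<Delta>" using that by blast
    ultimately have "2 ^ (2 * j) * K < 40 * \<Delta>" by (rule le_less_trans)
    moreover have "j < L" using that by simp
    ultimately show ?thesis by blast
  qed
  have fin: "finite ?S" by simp
  show ?thesis
  proof (intro equalityI subsetI)
    fix i assume i: "i \<in> ?S"
    hence "{..i} \<subseteq> ?S" using down by auto
    hence "card {..i} \<le> card ?S" by (rule card_mono[OF fin])
    thus "i \<in> {..<I}" by (simp add: II_def)
  next
    fix i assume i: "i \<in> {..<I}"
    show "i \<in> ?S"
    proof (rule ccontr)
      assume "i \<notin> ?S"
      hence "?S \<subseteq> {..<i}" using down by (meson lessThan_iff not_less subsetI)
      hence "card ?S \<le> i" using card_mono[of "{..<i}" ?S] by simp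
      thus False using i by (simp add: II_def)
    qed
  qed
qed

lemma I_le_L: "I \<le> L"
proof -
  have "{i. i < L \<and> 2 ^ (2 * i) * K < 40 * \<Delta>} \<subseteq> {..<L}" by (rule subsetI) simp
  thus ?thesis unfolding I_set by simp
qed

lemma K_large: "K \<ge> 3072" and K_pos: "K > 0" using L_ge by (simp_all add: KK_def)

lemma four_I: "40 * \<Delta> \<le> 4 ^ I * K"
proof (cases "I = L")
  case True
  have "(2::nat) ^ L \<le> 4 ^ L" by (rule power_mono) simp_all
  hence d: "\<Delta> \<le> 4 ^ L" using \<Delta>_lt by linarith
  have "40 \<le> K" using K_large by linarith
  from mult_le_mono[OF d this] show ?thesis unfolding True by (simp only: mult.commute)
next
  case False
  have "I \<notin> {i. i < L \<and> 2 ^ (2 * i) * K < 40 * \<Delta>}" unfolding I_set by simp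
  thus ?thesis using False I_le_L by (simp add: power_mult)
qed

lemma four_I_less: "I \<ge> 1 \<Longrightarrow> 4 ^ I * K < 160 * \<Delta>"
proof -
  assume "I \<ge> 1"
  hence "I - 1 \<in> {i. i < L \<and> 2 ^ (2 * i) * K < 40 * \<Delta>}" unfolding I_set by simp
  hence "4 ^ (I - 1) * K < 40 * \<Delta>" by (simp add: power_mult)
  moreover have "(4::nat) ^ I = 4 * 4 ^ (I - 1)" using \<open>I \<ge> 1\<close> by (cases I) auto
  hence "4 ^ I * K = 4 * (4 ^ (I - 1) * K)" by (simp only: mult.assoc)
  ultimately show ?thesis by linarith
qed

lemma T0_le: "T0 * 2 ^ I \<le> \<Delta> + 2 ^ I"
  using div_times_less_eq_dividend[of \<Delta> "2 ^ I"] by (simp add: TT_def)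

text \<open>One half of \<open>4 ^ I * K\<close> absorbs \<open>20 * \<Delta>\<close> by
  \<open>four_I\<close>, the other half the rounding error \<open>20 * 2 ^ I\<close>, since
  \<open>K \<ge> 40\<close>.\<close>

lemma T0K: "20 * T0 \<le> K * 2 ^ I"
proof -
  have "20 * T0 * 2 ^ I \<le> 20 * \<Delta> + 20 * 2 ^ I" using T0_le by simp
  also have "20 * (2::nat) ^ I \<le> 20 * 4 ^ I" by (simp add: power_mono)
  also have "20 * \<Delta> + 20 * 4 ^ I \<le> 4 ^ I * K"
  proof -
    have "40 * 4 ^ I \<le> 4 ^ I * K" using K_large by simp
    thus ?thesis using four_I by linarith
  qed
  also have "\<dots> = K * 2 ^ I * 2 ^ I" by (simp flip: power_mult_distrib)
  finally show ?thesis by simp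
qed

lemma T0_gt: "\<Delta> < T0 * 2 ^ I"
proof -
  have "\<Delta> = \<Delta> div 2 ^ I * 2 ^ I + \<Delta> mod 2 ^ I" by (rule div_mult_mod_eq[symmetric])
  moreover have "\<Delta> mod 2 ^ I < 2 ^ I" by simp
  moreover have "T0 * 2 ^ I = \<Delta> div 2 ^ I * 2 ^ I + 2 ^ I" by (simp add: TT_def)
  ultimately show ?thesis by linarith
qed

lemma A_bounds: "\<Delta> < 2 ^ AA \<Delta>" "2 ^ (AA \<Delta> - 1) \<le> \<Delta>" "AA \<Delta> \<ge> 1"
proof -
  show "\<Delta> < 2 ^ AA \<Delta>" "2 ^ (AA \<Delta> - 1) \<le> \<Delta>" using floorlog_bounds[of \<Delta> 2] \<Delta> by (auto simp: AA_def)
  thus "AA \<Delta> \<ge> 1" using \<Delta> by (cases "AA \<Delta>") auto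
qed

lemma T0A: "T0 < 32 ^ AA \<Delta>"
proof -
  have "T0 \<le> \<Delta> + 1" by (simp add: TT_def)
  also have "\<dots> \<le> 2 ^ AA \<Delta>" using A_bounds by simp
  also have "\<dots> < 32 ^ AA \<Delta>" using A_bounds by (intro power_strict_mono) auto
  finally show ?thesis .
qed

lemma RI_gt: "12 * T0 < RR n \<Delta> * 2 ^ I"
proof -
  have "12 * T0 = 12 * T0 div 2 ^ I * 2 ^ I + 12 * T0 mod 2 ^ I" by (rule div_mult_mod_eq[symmetric])
  moreover have "12 * T0 mod 2 ^ I < 2 ^ I" by simp
  moreover have "RR n \<Delta> * 2 ^ I = 12 * T0 div 2 ^ I * 2 ^ I + 2 ^ I" by (simp add: RR_def)
  ultimately show ?thesis by linarith
qed

lemma RI_le_K: "RR n \<Delta> \<le> K"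
proof -
  have "12 * T0 \<le> K * 2 ^ I * 12 div 20" using T0K by simp
  hence "12 * T0 div 2 ^ I \<le> (K * 12 div 20 + 1)"
  proof -
    have "12 * T0 * 20 \<le> 12 * K * 2 ^ I" using T0K by simp
    hence "(12 * T0 div 2 ^ I) * 2 ^ I * 20 \<le> 12 * K * 2 ^ I"
      using div_times_less_eq_dividend[of "12 * T0" "2 ^ I"] by (meson le_trans mult_le_mono1)
    hence "(12 * T0 div 2 ^ I) * 20 * 2 ^ I \<le> 12 * K * 2 ^ I" by (simp add: mult_ac)
    hence "(12 * T0 div 2 ^ I) * 20 \<le> 12 * K" by simp
    thus ?thesis by linarith
  qed
  thus ?thesis using K_large by (simp add: RR_def)
qed

lemma RI_le: "RR n \<Delta> \<le> 2 * 2 ^ I * K"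
proof -
  have "1 * K \<le> 2 * 2 ^ I * K" by (intro mult_le_mono1) simp
  hence "K \<le> 2 * 2 ^ I * K" by (simp only: mult_1)
  with RI_le_K show ?thesis by (rule le_trans)
qed

lemma digits:
  fixes g :: "nat \<Rightarrow> nat" and b :: nat
  assumes "\<And>i. i < N \<Longrightarrow> g i < b"
  shows "(\<Sum>i<N. g i * b ^ i) < b ^ N \<and> (\<forall>i<N. (\<Sum>i<N. g i * b ^ i) div b ^ i mod b = g i)"
  using assms
proof (induction N)
  case (Suc N)
  let ?S = "\<Sum>i<N. g i * b ^ i"
  have IH: "?S < b ^ N" "\<forall>i<N. ?S div b ^ i mod b = g i" using Suc by auto
  have gN: "g N < b" using Suc.prems by simp
  hence b: "b > 0" by simp
  have "?S + g N * b ^ N < Suc (g N) * b ^ N" using IH by simp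
  also have "\<dots> \<le> b * b ^ N" using gN by (intro mult_le_mono1) simp
  finally have 1: "?S + g N * b ^ N < b ^ Suc N" by simp
  have "(?S + g N * b ^ N) div b ^ i mod b = g i" if "i < Suc N" for i
  proof (cases "i = N")
    case True
    have "(?S + g N * b ^ N) div b ^ N = g N" using IH(1) b by simp
    thus ?thesis using True gN by simp
  next
    case False
    hence i: "i < N" using that by simp
    have "b ^ N = b ^ i * (b * b ^ (N - Suc i))" using i by (simp flip: power_Suc power_add)
    hence e: "?S + g N * b ^ N = ?S + (b * (g N * b ^ (N - Suc i))) * b ^ i" by (simp add: mult_ac)
    have "(?S + g N * b ^ N) div b ^ i = b * (g N * b ^ (N - Suc i)) + ?S div b ^ i"
      unfolding e using b by (intro div_mult_self1) simp
    thus ?thesis using IH(2) i by simp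
  qed
  thus ?case using 1 by simp
qed simp

text \<open>All factors are rounded up to powers of two. Their exponents add up to
  \<open>70 * L + 365\<close>, of which \<open>64 * L\<close> comes from the 32 rows per blocked
  partner. The exponential gives \<open>409 * L\<close>, as \<open>0.4 * 1024 > 409\<close> and
  \<open>exp 1 \<ge> 2\<close>.\<close>

lemma small_aux:
  "real I * real n * real (2 * 2 ^ I * K + 1) * (real (2 * 2 ^ I * K) ^ 32 * real n * 2 ^ (I + 1)) * exp (- 0.4 * real K) < 1"
proof -
  define Q where "Q = 2 * 2 ^ I * K"
  have LI: "real I \<le> 2 ^ L"
  proof -
    have "I < 2 ^ L" using I_le_L less_exp[of L] by linarith
    hence "real I < real (2 ^ L)" by (simp only: of_nat_less_iff)
    thus ?thesis by simp
  qed
  have Ln: "real n \<le> 2 ^ L"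
  proof -
    have "real n < real (2 ^ L)" using n_lt by (simp only: of_nat_less_iff)
    thus ?thesis by simp
  qed
  have R: "Q \<le> 2 ^ (2 * L + 11)"
  proof -
    have "L \<le> 2 ^ L" by (rule less_imp_le[OF less_exp])
    hence "1024 * L \<le> 2 ^ 10 * 2 ^ L" by (intro mult_le_mono) simp_all
    hence K: "K \<le> 2 ^ 10 * 2 ^ L" unfolding KK_def .
    have I: "(2::nat) ^ I \<le> 2 ^ L" using I_le_L by (rule power_increasing) simp
    have "Q \<le> 2 ^ 1 * 2 ^ L * (2 ^ 10 * 2 ^ L)"
      unfolding Q_def power_one_right by (rule mult_le_mono[OF mult_le_mono2[OF I] K])
    also have "\<dots> = 2 ^ (1 + L + (10 + L))" by (simp only: power_add)
    also have "1 + L + (10 + L) = 2 * L + 11" by simp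
    finally show ?thesis .
  qed
  have R1: "real Q \<le> 2 ^ (2 * L + 11)"
  proof -
    have "real Q \<le> real (2 ^ (2 * L + 11))" using R by (simp only: of_nat_le_iff)
    thus ?thesis by (simp only: of_nat_power of_nat_numeral)
  qed
  have R2: "real (Q + 1) \<le> 2 ^ (2 * L + 12)"
  proof -
    have "(1::real) \<le> 2 ^ (2 * L + 11)" by (rule one_le_power) simp
    hence "real Q + 1 \<le> 2 * 2 ^ (2 * L + 11)" using R1 by linarith
    thus ?thesis by (simp only: power_Suc[symmetric] of_nat_add of_nat_1 add_Suc_right[symmetric]) simp
  qed
  have "real Q ^ 32 \<le> (2 ^ (2 * L + 11)) ^ 32" using R1 by (rule power_mono) simp
  also have "\<dots> = 2 ^ ((2 * L + 11) * 32)" by (rule power_mult[symmetric])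
  finally have R3: "real Q ^ 32 \<le> 2 ^ ((2 * L + 11) * 32)" .
  have R4: "(2::real) ^ (I + 1) \<le> 2 ^ (L + 1)" using I_le_L by (intro power_increasing) auto
  have "real I * real n * real (Q + 1) * (real Q ^ 32 * real n * 2 ^ (I + 1)) \<le>
      2 ^ L * 2 ^ L * 2 ^ (2 * L + 12) * (2 ^ ((2 * L + 11) * 32) * 2 ^ L * 2 ^ (L + 1))"
    by (intro mult_mono LI Ln R2 R3 R4 mult_nonneg_nonneg zero_le_power) simp_all
  also have "\<dots> = 2 ^ (L + L + (2 * L + 12) + ((2 * L + 11) * 32 + L + (L + 1)))" by (simp only: power_add)
  also have "L + L + (2 * L + 12) + ((2 * L + 11) * 32 + L + (L + 1)) = 70 * L + 365" by simp
  finally have 1: "real I * real n * real (Q + 1) * (real Q ^ 32 * real n * 2 ^ (I + 1)) \<le> 2 ^ (70 * L + 365)" .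
  have "exp (- 0.4 * real K) \<le> exp (real (409 * L) * (- 1))"
    by (simp add: KK_def)
  also have "\<dots> = exp (- 1) ^ (409 * L)" by (rule exp_of_nat_mult)
  also have "\<dots> \<le> (1 / 2) ^ (409 * L)"
  proof (rule power_mono)
    have "2 \<le> exp (1::real)" using exp_ge_add_one_self[of 1] by simp
    thus "exp (- 1) \<le> (1 / 2 :: real)" by (simp add: exp_minus field_simps)
  qed simp
  finally have 2: "exp (- 0.4 * real K) \<le> (1 / 2) ^ (409 * L)" .
  have "real I * real n * real (Q + 1) * (real Q ^ 32 * real n * 2 ^ (I + 1)) * exp (- 0.4 * real K) \<le>
      2 ^ (70 * L + 365) * (1 / 2) ^ (409 * L)"
    by (rule mult_mono[OF 1 2]) simp_all
  also have "\<dots> = 2 ^ (70 * L + 365) / 2 ^ (409 * L)" by (simp only: power_divide power_one) simp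
  also have "\<dots> < 1"
  proof -
    have "70 * L + 365 < 409 * L" using L_ge by simp
    hence "(2::real) ^ (70 * L + 365) < 2 ^ (409 * L)" by (rule power_strict_increasing) simp
    moreover have "(0::real) < 2 ^ (409 * L)" by (rule zero_less_power) simp
    ultimately show ?thesis by (simp only: divide_less_eq_1_pos)
  qed
  finally show ?thesis unfolding Q_def .
qed

text \<open>A good table is packed as a number with digits in base \<open>2 ^ (I + 1)\<close>.
  Reading an entry by \<open>hH\<close> is exact only up to multiples of the base; these are
  multiples of every modulus, so \<open>agree\<close> does not notice. Since some code is good, the
  least one is.\<close>

lemma HH_good: "\<forall>j<I. spread n (2 * epochs I j) (2 * epochs I j * K) (hH I K (HH n \<Delta>))"
proof -
  let ?R0 = "2 * 2 ^ I * K"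
  obtain h where h: "\<forall>v<n. \<forall>r<?R0. h v r < 2 ^ (I + 1)"
    "\<forall>j<I. spread n (2 * epochs I j) (2 * epochs I j * K) h"
    using spread_exists[OF _ K_pos small_aux] n by auto
  define b where "b = (2::nat) ^ (I + 1)"
  define g where "g i = h (i div ?R0) (i mod ?R0)" for i
  define H where "H = (\<Sum>i<n * ?R0. g i * b ^ i)"
  have R0: "?R0 > 0" using K_pos by simp
  have g: "g i < b" if "i < n * ?R0" for i
    using that h(1) R0 by (simp add: g_def b_def less_mult_imp_div_less)
  note dg = digits[of "n * ?R0" g b, OF g, folded H_def]
  have HG: "H < 2 ^ GG n \<Delta>" 
  proof -
    have "b ^ (n * ?R0) = 2 ^ GG n \<Delta>" by (simp only: b_def GG_def power_mult)
    thus ?thesis using dg by simp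
  qed
  have hm: "hH I K H v r mod b = h v r" if "v < n" "r < ?R0" for v r
  proof -
    have "Suc v * ?R0 \<le> n * ?R0" using that by (intro mult_le_mono1) simp
    hence "v * ?R0 + r < n * ?R0" using that by simp
    hence "H div b ^ (v * ?R0 + r) mod b = g (v * ?R0 + r)" using dg by blast
    also have "g (v * ?R0 + r) = h v r"
    proof -
      have "(v * q + r) div q = v" "(v * q + r) mod q = r" if "r < q" for q using that by auto
      thus ?thesis unfolding g_def using that(2) by metis
    qed
    finally show ?thesis unfolding hH_def b_def by (simp only: power_mult)
  qed
  have "spread n (2 * epochs I j) (2 * epochs I j * K) (hH I K H)" if j: "j < I" for j
  proof -
    let ?M = "2 * epochs I j"
    have "b = ?M * 2 ^ j" using j by (simp add: b_def epochs_def flip: power_add)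
    hence md: "x mod b mod ?M = x mod ?M" for x by (simp add: mod_mod_cancel)
    have le: "?M * K \<le> ?R0" by (intro mult_le_mono1 mult_le_mono2) (simp add: epochs_def power_increasing)
    have e: "hH I K H v r mod ?M = h v r mod ?M" if "v < n" "r < ?M * K" for v r
      using md[of "hH I K H v r"] hm[OF that(1), of r] that(2) le by simp
    have ag: "agree ?M (?M * K) (hH I K H u) (hH I K H v) d = agree ?M (?M * K) (h u) (h v) d" if "u < n" "v < n" for u v d
      unfolding agree_def using e[OF that(1)] e[OF that(2)] by (metis (no_types, lifting) mod_add_left_eq)
    have "{(v, d). v < n \<and> v \<noteq> u \<and> d < ?M \<and> card (agree ?M (?M * K) (hH I K H u) (hH I K H v) d) \<le>
        2 * card (agree ?M (?M * K) (hH I K H u) (hH I K H v) d \<inter> U)} =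
      {(v, d). v < n \<and> v \<noteq> u \<and> d < ?M \<and> card (agree ?M (?M * K) (h u) (h v) d) \<le>
        2 * card (agree ?M (?M * K) (h u) (h v) d \<inter> U)}" if "u < n" for u U
      using ag[OF that] by auto
    thus ?thesis using h(2) j unfolding spread_def by simp
  qed
  hence "\<forall>j<I. spread n (2 * epochs I j) (2 * epochs I j * K) (hH I K H)" by blast
  from mu_eq(2)[of H _ "\<lambda>H. \<forall>j<I. spread n (2 * epochs I j) (2 * epochs I j * K) (hH I K H)", OF HG this]
  show ?thesis unfolding HH_def .
qed

lemma cbase: "cbase n I K (GG n \<Delta>)"
  using n K_pos by unfold_locales (simp_all add: GG_def)

lemma algo: "algo n I K T0 (AA \<Delta>) (RR n \<Delta>) (hH I K (HH n \<Delta>)) \<Delta>"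
  by unfold_locales (use T0K T0A HH_good T0_gt RI_gt in auto)

end

lemma evs_append: "evs q a (as @ bs) s = evs q a bs (evs q a as s)"
  by (induction as arbitrary: s) auto

lemma caps_le_append: "caps_le G q a as s \<Longrightarrow> caps_le G q a bs (evs q a as s) \<Longrightarrow> caps_le G q a (as @ bs) s"
  by (induction as arbitrary: s) auto

lemma caps_le_const: "\<forall>p\<in>set as. fst p \<noteq> 0 \<Longrightarrow> s 0 \<le> G \<Longrightarrow> caps_le G q a as s"
  by (induction as arbitrary: s) auto

context sizes
begin

section \<open>Evaluation of the parameter terms\<close>

lemma L_le_GG: "L \<le> GG n \<Delta>"
proof -
  have "L \<le> K" by (simp add: KK_def)
  also have "K \<le> 2 * 2 ^ I * K" using mult_le_mono1[of 1 "2 * 2 ^ I" K] by simp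
  also have "\<dots> \<le> GG n \<Delta>" using cbase.cap_R[OF cbase] .
  finally show ?thesis .
qed

lemma ev_params:
  fixes a :: "nat \<Rightarrow> nat" and q :: "nat list"
  assumes q: "lookup q 0 = n" "lookup q 1 = \<Delta>" "lookup q 2 = u" "lookup q 3 = v"
  defines "s \<equiv> evs q a params (\<lambda>_. 0)"
  shows "s 0 = GG n \<Delta> \<and> s 1 = n \<and> s 3 = u \<and> s 4 = v \<and> s 5 = K \<and> s 6 = I \<and> s 7 = T0 \<and>
      s 8 = AA \<Delta> \<and> s 9 = HH n \<Delta> \<and> s 10 = RR n \<Delta>"
    and "caps_le (GG n \<Delta>) q a params (\<lambda>_. 0)"
proof -
  define s4 :: "nat \<Rightarrow> nat" where "s4 = (\<lambda>_. 0)(1 := n, 2 := \<Delta>, 3 := u, 4 := v)"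
  define s5 where "s5 = s4(0 := L)"
  define s6 where "s6 = s5(5 := K)"
  define s7 where "s7 = s6(6 := I)"
  define s8 where "s8 = s7(7 := T0)"
  define s9 where "s9 = s8(8 := AA \<Delta>)"
  define s10 where "s10 = s9(10 := RR n \<Delta>)"
  define s11 where "s11 = s10(0 := GG n \<Delta>)"
  note sd = s4_def s5_def s6_def s7_def s8_def s9_def s10_def s11_def
  have e0: "ev q a (tflog (tmul (TX 1) (TX 2))) s4 = L"
    using ev_flog[of q a "tmul (TX 1) (TX 2)" s4] n \<Delta> by (simp add: s4_def LL_def)
  have e5: "ev q a (tmul (TN 1024) (TX 0)) s5 = K" by (simp add: s5_def KK_def)
  have e6: "ev q a (TS 30 (TX 0) (tlt (tmul (TP (tmul (TN 2) (TX 30))) (TX 5)) (tmul (TN 40) (TX 2)))) s6 = I"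
  proof -
    have b: "ev q a (TX 0) s6 = L" by (simp add: sd)
    have "ev q a (tlt (tmul (TP (tmul (TN 2) (TX 30))) (TX 5)) (tmul (TN 40) (TX 2))) (s6(30 := i)) =
      of_bool (2 ^ (2 * i) * K < 40 * \<Delta>)" if "i < L" for i
    proof (cases "2 * i \<le> L")
      case True
      thus ?thesis by (simp add: sd min_absorb1)
    next
      case False
      \<comment> \<open>Here the cap \<open>L\<close> cuts off the exponent, but the comparison
        fails for the capped as well as for the true value.\<close>
      have "\<not> 2 ^ L * K < 40 * \<Delta>"
      proof -
        have "\<Delta> * 40 \<le> 2 ^ L * K" using \<Delta>_lt K_large by (intro mult_le_mono) auto
        thus ?thesis by simp
      qed
      moreover have "2 ^ L * K \<le> 2 ^ (2 * i) * K" using False by (intro mult_le_mono1 power_increasing) auto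
      ultimately have "\<not> 2 ^ (2 * i) * K < 40 * \<Delta>" "\<not> 2 ^ L * K < 40 * \<Delta>" by linarith+
      thus ?thesis using False by (simp add: sd min_absorb2)
    qed
    from ev_count[of q a "TX 0" s6, unfolded b, OF this] show ?thesis by (simp only: II_def)
  qed
  have e7: "ev q a (tadd (tdiv (TX 2) (TP (TX 6))) (TN 1)) s7 = T0"
    using I_le_L by (simp add: sd TT_def min_absorb1)
  have e8: "ev q a (tflog (TX 2)) s8 = AA \<Delta>"
    using ev_flog[of q a "TX 2" s8] \<Delta> by (simp add: sd AA_def)
  have e10: "ev q a (tadd (tdiv (tmul (TN 12) (TX 7)) (TP (TX 6))) (TN 1)) s9 = RR n \<Delta>"
    using I_le_L by (simp add: sd RR_def min_absorb1)
  have eG: "ev q a (tmul (tadd (TX 6) (TN 1)) (tmul (TX 1) tR0)) s10 = GG n \<Delta>"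
    using I_le_L by (simp add: sd GG_def tR0_def min_absorb1)
  interpret cbase n I K "GG n \<Delta>" q a by (rule cbase)
  have eH: "ev q a (tmu 40 9 (TP (TX 0)) tgood) s11 = HH n \<Delta>"
  proof -
    have b: "ev q a (TP (TX 0)) s11 = 2 ^ GG n \<Delta>" by (simp add: s11_def)
    have "ev q a tgood (s11(40 := i, 9 := k)) =
      of_bool (\<forall>j<I. spread n (2 * epochs I j) (2 * epochs I j * K) (hH I K k))" for i k
      using ev_good[of "s11(40 := i, 9 := k)"] by (simp add: okb_def sd)
    from ev_tmu[of q a "TP (TX 0)" s11 tgood 40 9, unfolded b, OF this] show ?thesis by (simp only: HH_def)
  qed
  have q4: "((((\<lambda>_. 0)(1 := ev q a (TI 0) (\<lambda>_. 0)))(2 := ev q a (TI 1) ((\<lambda>_. 0)(1 := ev q a (TI 0) (\<lambda>_. 0)))))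
     (3 := lookup q 2))(4 := lookup q 3) = s4"
    using q by (simp add: s4_def)
  have step4: "evs q a params (\<lambda>_. 0) = evs q a (drop 4 params) s4"
    "caps_le (GG n \<Delta>) q a params (\<lambda>_. 0) = caps_le (GG n \<Delta>) q a (drop 4 params) s4"
    by (simp_all add: params_def s4_def q[simplified])
  have d4: "drop 4 params = [(0, tflog (tmul (TX 1) (TX 2))),
    (5, tmul (TN 1024) (TX 0)),
    (6, TS 30 (TX 0) (tlt (tmul (TP (tmul (TN 2) (TX 30))) (TX 5)) (tmul (TN 40) (TX 2)))),
    (7, tadd (tdiv (TX 2) (TP (TX 6))) (TN 1)), (8, tflog (TX 2)),
    (10, tadd (tdiv (tmul (TN 12) (TX 7)) (TP (TX 6))) (TN 1)),
    (0, tmul (tadd (TX 6) (TN 1)) (tmul (TX 1) tR0)), (9, tmu 40 9 (TP (TX 0)) tgood)]"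
    by (simp add: params_def)
  have "s = s11(9 := HH n \<Delta>)"
    unfolding s_def step4 d4 evs.simps fst_conv snd_conv e0 s5_def[symmetric] e5 s6_def[symmetric] e6 s7_def[symmetric]
      e7 s8_def[symmetric] e8 s9_def[symmetric] e10 s10_def[symmetric] eG s11_def[symmetric] eH ..
  thus "s 0 = GG n \<Delta> \<and> s 1 = n \<and> s 3 = u \<and> s 4 = v \<and> s 5 = K \<and> s 6 = I \<and> s 7 = T0 \<and>
      s 8 = AA \<Delta> \<and> s 9 = HH n \<Delta> \<and> s 10 = RR n \<Delta>"
    by (simp add: sd)
  have z: "s4 0 = 0" "s5 0 = L" "s6 0 = L" "s7 0 = L" "s8 0 = L" "s9 0 = L" "s10 0 = L" "s11 0 = GG n \<Delta>"
    "(s11(9 := HH n \<Delta>)) 0 = GG n \<Delta>" by (simp_all add: sd)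
  show "caps_le (GG n \<Delta>) q a params (\<lambda>_. 0)"
    unfolding step4 d4 caps_le.simps fst_conv snd_conv e0 s5_def[symmetric] e5 s6_def[symmetric] e6 s7_def[symmetric]
      e7 s8_def[symmetric] e8 s9_def[symmetric] e10 s10_def[symmetric] eG s11_def[symmetric] eH z
    using L_le_GG by simp
qed

end

context code
begin

section \<open>Evaluation of the decision terms\<close>

lemma tpr_ev: "evq (tpr t1 t2) s = pr (evq t1 s) (evq t2 s)"
  by (simp add: tpr_def pr_def power2_eq_square)

lemma ev_decide:
  assumes ok: "ok s" and JI: "js a u v \<le> I" and rR: "rs a u v < R (js a u v)"
  defines "s' \<equiv> evs q a decide s"
  shows "s' 27 = color (tup a u v)" "put_all s' writes a = nxt a u v"
    "s' 3 = u" "s' 4 = v" "s' 13 = ys a u v"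
    "s' 18 = adr 0 (js a u v) (ls a u v) (xs a u v) (rs a u v)" "s' 19 = Suc (ep a (js a u v) (xs a u v))"
    "s' 20 = adr 1 (js a u v) (ls a u v) (ys a u v) (rs a u v)" "s' 21 = Suc (ep a (js a u v) (ys a u v))"
    "s' 22 = adr 2 (js a u v) (ls a u v) (xs a u v) (rs a u v)"
    "s' 23 = adr 3 (js a u v) (ls a u v) (xs a u v) (rs a u v)" "s' 24 = Suc (bs a u v)"
    "s' 25 = Suc (a u)" "s' 26 = Suc (a v)"
    "caps_le G q a decide s"
proof -
  let ?J = "js a u v" and ?l = "ls a u v" and ?r = "rs a u v" and ?x = "xs a u v" and ?y = "ys a u v" and ?b = "bs a u v"
  define s11 where "s11 = s(11 := ?J)"
  define s12 where "s12 = s11(12 := ?x)"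
  define s13 where "s13 = s12(13 := ?y)"
  define s14 where "s14 = s13(14 := ?l)"
  define s15 where "s15 = s14(15 := of_bool (live a u v))"
  define s16 where "s16 = s15(16 := ?r)"
  define s17 where "s17 = s16(17 := ?b)"
  define s18 where "s18 = s17(18 := adr 0 ?J ?l ?x ?r)"
  define s19 where "s19 = s18(19 := Suc (ep a ?J ?x))"
  define s20 where "s20 = s19(20 := adr 1 ?J ?l ?y ?r)"
  define s21 where "s21 = s20(21 := Suc (ep a ?J ?y))"
  define s22 where "s22 = s21(22 := adr 2 ?J ?l ?x ?r)"
  define s23 where "s23 = s22(23 := adr 3 ?J ?l ?x ?r)"
  define s24 where "s24 = s23(24 := Suc ?b)"
  define s25 where "s25 = s24(25 := Suc (a u))"
  define s26 where "s26 = s25(26 := Suc (a v))"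
  define s27 where "s27 = s26(27 := cs a u v)"
  define s28 where "s28 = s27(27 := pr (cs a u v) ?b)"
  define s29 where "s29 = s28(27 := pr ?r (pr (cs a u v) ?b))"
  define s30 where "s30 = s29(27 := pr ?l (pr ?r (pr (cs a u v) ?b)))"
  note sd = s11_def s12_def s13_def s14_def s15_def s16_def s17_def s18_def s19_def s20_def s21_def s22_def s23_def
    s24_def s25_def s26_def s27_def s28_def s29_def s30_def
  have oks: "ok s11" "ok s12" "ok s13" "ok s14" "ok s15" "ok s16" "ok s17" "ok s18" "ok s19" "ok s20" "ok s21" "ok s22"
    "ok s23" "ok s24" "ok s25" "ok s26" "ok s27" "ok s28" "ok s29" "ok s30"
    by (simp_all add: sd ok ok_upd)
  have xy: "?x < n" "?y < n" using tl_hd_lt by (simp_all add: xs_def ys_def)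
  have r0: "?r < 2 * 2 ^ I * K" using less_le_trans[OF rR R_R0[OF JI]] .
  have e11: "evq (tmu 34 31 (tadd (TX 6) (TN 1)) (tsl 31)) s = ?J"
  proof -
    have b: "evq (tadd (TX 6) (TN 1)) s = Suc I" using ok by (simp add: okD)
    have "evq (tsl 31) (s(34 := i, 31 := k)) = of_bool (sl a k (tl_of k u v) (hd_of k u v))"
      if "i < Suc I" "k \<le> i" for i k
      using ev_sl[of "s(34 := i, 31 := k)" 31] that ok by (simp add: ok_upd)
    from ev_tmu[of q a "tadd (TX 6) (TN 1)" s "tsl 31" 34 31, unfolded b, OF this] show ?thesis by (simp only: js_def)
  qed
  have e12: "evq (ttl (TX 11)) s11 = ?x" by (simp add: ev_tl oks xs_def) (simp add: s11_def)
  have e13: "evq (thd (TX 11)) s12 = ?y" by (simp add: ev_hd oks ys_def) (simp add: s12_def s11_def)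
  have e14: "evq (tmu 35 32 (TX 8) (tnot (tps 11 32))) s13 = ?l"
  proof -
    have b: "evq (TX 8) s13 = A" using oks(3) by (simp add: okD)
    have "evq (tnot (tps 11 32)) (s13(35 := i, 32 := k)) = of_bool (\<not> ps a ?J k ?x ?y)" for i k
    proof -
      have "ok (s13(35 := i, 32 := k))" using oks by (simp add: ok_upd)
      moreover have "(s13(35 := i, 32 := k)) 11 = ?J" "(s13(35 := i, 32 := k)) 32 = k" by (simp_all add: sd)
      ultimately show ?thesis
        using ev_ps[of "s13(35 := i, 32 := k)" 11 32] JI by (simp add: xs_def ys_def del: fun_upd_apply)
    qed
    from ev_tmu[of q a "TX 8" s13 "tnot (tps 11 32)" 35 32, unfolded b, OF this] show ?thesis by (simp only: ls_def)
  qed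
  have e15: "evq (tlive 11 14) s14 = of_bool (live a u v)"
  proof -
    have "s14 11 = ?J" "s14 14 = ?l" by (simp_all add: sd)
    thus ?thesis using ev_live[of s14 11 14] oks JI by (simp add: live_def xs_def ys_def)
  qed
  have v15: "(s15(36 := i)) 11 = ?J" "(s15(36 := i)) 14 = ?l" for i by (simp_all add: sd)
  have ok15: "ok (s15(36 := i))" for i using oks by (simp add: ok_upd)
  have b15: "evq (tR (TX 11)) s15 = R ?J" using ev_tRx[of s15 11] oks v15(1)[of 0] by (simp add: sd)
  have e16l: "evq (tmu 36 30 (tR (TX 11)) (tlv (TX 11) (TX 14) (ttl (TX 11)) (thd (TX 11)) (TX 30))) s15 =
      mu (R ?J) (lv a ?J ?l ?x ?y)"
  proof -
    have "evq (tlv (TX 11) (TX 14) (ttl (TX 11)) (thd (TX 11)) (TX 30)) (s15(36 := i, 30 := k)) = of_bool (lv a ?J ?l ?x ?y k)"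
      if "i < R ?J" "k \<le> i" for i k
      using ev_rows(3)[OF ok15[of i], of 11 14 k] that JI v15[of i] by (simp add: xs_def ys_def del: fun_upd_apply)
    from ev_tmu[of q a "tR (TX 11)" s15 _ 36 30, unfolded b15, OF this] show ?thesis .
  qed
  have e16f: "evq (tmu 36 30 (tR (TX 11)) (tfr (TX 11) (TX 14) (ttl (TX 11)) (thd (TX 11)) (TX 30))) s15 =
      mu (R ?J) (fr a ?J ?l ?x ?y)"
  proof -
    have "evq (tfr (TX 11) (TX 14) (ttl (TX 11)) (thd (TX 11)) (TX 30)) (s15(36 := i, 30 := k)) = of_bool (fr a ?J ?l ?x ?y k)"
      if "i < R ?J" "k \<le> i" for i k
      using ev_rows(2)[OF ok15[of i], of 11 14 k] that JI v15[of i] by (simp add: xs_def ys_def del: fun_upd_apply)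
    from ev_tmu[of q a "tR (TX 11)" s15 _ 36 30, unfolded b15, OF this] show ?thesis .
  qed
  have e16: "evq (tif (TX 15) (tmu 36 30 (tR (TX 11)) (tlv (TX 11) (TX 14) (ttl (TX 11)) (thd (TX 11)) (TX 30)))
     (tmu 36 30 (tR (TX 11)) (tfr (TX 11) (TX 14) (ttl (TX 11)) (thd (TX 11)) (TX 30)))) s15 = ?r"
  proof -
    have "evq (TX 15) s15 = of_bool (live a u v)" by (simp add: s15_def)
    show ?thesis unfolding ev_tif[of q a, OF \<open>evq (TX 15) s15 = of_bool (live a u v)\<close>] e16l e16f rs_def ..
  qed
  have v: "s16 11 = ?J" "s16 14 = ?l" "s16 12 = ?x" "s16 13 = ?y" "s16 16 = ?r" "s16 15 = of_bool (live a u v)" by (simp_all add: sd)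
  have e17: "evq (tmul (TX 15) (TA (tadr 3 (TX 11) (TX 14) (TX 12) (TX 16)))) s16 = ?b"
    using v by (simp add: ev_adr oks bs_def)
  have e18: "evq (tadr 0 (TX 11) (TX 14) (TX 12) (TX 16)) s17 = adr 0 ?J ?l ?x ?r"
    by (simp add: ev_adr oks) (simp add: sd)
  have e19: "evq (tadd (tep (TX 11) (TX 12)) (TN 1)) s18 = Suc (ep a ?J ?x)"
    using ev_ep[of s18 "TX 11" "TX 12"] oks JI by (simp add: sd)
  have e20: "evq (tadr 1 (TX 11) (TX 14) (TX 13) (TX 16)) s19 = adr 1 ?J ?l ?y ?r"
    by (simp add: ev_adr oks) (simp add: sd)
  have e21: "evq (tadd (tep (TX 11) (TX 13)) (TN 1)) s20 = Suc (ep a ?J ?y)"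
    using ev_ep[of s20 "TX 11" "TX 13"] oks JI by (simp add: sd)
  have e22: "evq (tadr 2 (TX 11) (TX 14) (TX 12) (TX 16)) s21 = adr 2 ?J ?l ?x ?r"
    by (simp add: ev_adr oks) (simp add: sd)
  have e23: "evq (tadr 3 (TX 11) (TX 14) (TX 12) (TX 16)) s22 = adr 3 ?J ?l ?x ?r"
    by (simp add: ev_adr oks) (simp add: sd)
  have e24: "evq (tadd (TX 17) (TN 1)) s23 = Suc ?b" by (simp add: sd)
  have e25: "evq (tadd (TA (TX 3)) (TN 1)) s24 = Suc (a u)" using oks(14) by (simp add: okD)
  have e26: "evq (tadd (TA (TX 4)) (TN 1)) s25 = Suc (a v)" using oks(15) by (simp add: okD)
  have e27: "evq (tmod (tadd (th (TX 12) (TX 16)) (tep (TX 11) (TX 12))) (tM (TX 11))) s26 = cs a u v"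
  proof -
    have w: "s26 11 = ?J" "s26 12 = ?x" "s26 16 = ?r" by (simp_all add: sd)
    have "evq (th (TX 12) (TX 16)) s26 = hH I K H ?x ?r"
      using ev_h[of s26 "TX 12" "TX 16"] oks(16) xy r0 w by (simp add: okD)
    moreover have "evq (tep (TX 11) (TX 12)) s26 = ep a ?J ?x"
      using ev_ep[of s26 "TX 11" "TX 12"] oks(16) w JI by simp
    moreover have "evq (tM (TX 11)) s26 = M ?J" using ev_M'[of s26 "TX 11"] oks(16) w by simp
    ultimately show ?thesis by (simp add: cs_def)
  qed
  have e28: "evq (tpr (TX 27) (TX 17)) s27 = pr (cs a u v) ?b" by (simp add: tpr_ev sd)
  have e29: "evq (tpr (TX 16) (TX 27)) s28 = pr ?r (pr (cs a u v) ?b)" by (simp add: tpr_ev sd)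
  have e30: "evq (tpr (TX 14) (TX 27)) s29 = pr ?l (pr ?r (pr (cs a u v) ?b))" by (simp add: tpr_ev sd)
  have e31: "evq (tpr (TX 11) (TX 27)) s30 = pr ?J (pr ?l (pr ?r (pr (cs a u v) ?b)))" by (simp add: tpr_ev sd)
  have s': "s' = s30(27 := pr ?J (pr ?l (pr ?r (pr (cs a u v) ?b))))"
    unfolding s'_def decide_def evs.simps fst_conv snd_conv e11 s11_def[symmetric] e12 s12_def[symmetric]
      e13 s13_def[symmetric] e14 s14_def[symmetric] e15 s15_def[symmetric] e16 s16_def[symmetric] e17 s17_def[symmetric]
      e18 s18_def[symmetric] e19 s19_def[symmetric] e20 s20_def[symmetric] e21 s21_def[symmetric] e22 s22_def[symmetric]
      e23 s23_def[symmetric] e24 s24_def[symmetric] e25 s25_def[symmetric] e26 s26_def[symmetric] e27 s27_def[symmetric]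
      e28 s28_def[symmetric] e29 s29_def[symmetric] e30 s30_def[symmetric] e31 ..
  have s34: "s 3 = u" "s 4 = v" using ok by (simp_all add: okD)
  show a1: "s' 27 = color (tup a u v)" by (simp add: s' color_def tup_def)
  show a2: "s' 3 = u" "s' 4 = v" "s' 13 = ys a u v"
    "s' 18 = adr 0 (js a u v) (ls a u v) (xs a u v) (rs a u v)" "s' 19 = Suc (ep a (js a u v) (xs a u v))"
    "s' 20 = adr 1 (js a u v) (ls a u v) (ys a u v) (rs a u v)" "s' 21 = Suc (ep a (js a u v) (ys a u v))"
    "s' 22 = adr 2 (js a u v) (ls a u v) (xs a u v) (rs a u v)"
    "s' 23 = adr 3 (js a u v) (ls a u v) (xs a u v) (rs a u v)" "s' 24 = Suc (bs a u v)"
    "s' 25 = Suc (a u)" "s' 26 = Suc (a v)"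
    by (simp_all add: s' s34 sd)
  show "put_all s' writes a = nxt a u v"
    unfolding writes_def put_all.simps a2 nxt_def ..
  show "caps_le G q a decide s"
    using ok by (intro caps_le_const) (simp_all add: okD decide_def)
qed

end

section \<open>Size bounds\<close>

context sizes
begin

abbreviation "lgn \<equiv> log 2 (real n)"
abbreviation "lg\<Delta> \<equiv> log 2 (real \<Delta>)"

lemma log_ge_1: "1 \<le> lgn" "1 \<le> lg\<Delta>"
  using n \<Delta> by (simp_all add: le_log_iff)

text \<open>Both logarithms are at least 1, so their sum is replaced by their product; all later
  bounds can then be monomials.\<close>

lemma L_le_log: "real L \<le> 3 * (lgn * lg\<Delta>)"
proof -
  have "real (2 ^ (L - 1)) \<le> real (n * \<Delta>)" using L_bounds(2) by (simp only: of_nat_le_iff)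
  hence "real (L - 1) \<le> log 2 (real (n * \<Delta>))"
    using n \<Delta> by (subst le_log_iff) (simp_all add: powr_realpow)
  also have "\<dots> = lgn + lg\<Delta>" using n \<Delta> by (simp add: log_mult)
  finally have "real L \<le> lgn + lg\<Delta> + 1" using L_ge by simp
  moreover have "lgn * 1 \<le> lgn * lg\<Delta>" "1 * lg\<Delta> \<le> lgn * lg\<Delta>" "1 * 1 \<le> lgn * lg\<Delta>"
    using log_ge_1 by (intro mult_mono; simp)+
  ultimately show ?thesis by simp
qed

lemma AA_le_log: "real (AA \<Delta>) \<le> 2 * lg\<Delta>"
proof -
  have "real (2 ^ (AA \<Delta> - 1)) \<le> real \<Delta>" using A_bounds(2) by (simp only: of_nat_le_iff)
  hence "real (AA \<Delta> - 1) \<le> lg\<Delta>"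
    using \<Delta> by (subst le_log_iff) (simp_all add: powr_realpow)
  thus ?thesis using log_ge_1(2) A_bounds(3) by simp
qed

lemma four_I_le: "4 ^ I \<le> \<Delta>"
proof (cases "I \<ge> 1")
  case True
  have "4 ^ I * 160 \<le> 4 ^ I * K" using K_large by (intro mult_le_mono2) simp
  thus ?thesis using four_I_less[OF True] by linarith
next
  case False
  hence "I = 0" by simp
  thus ?thesis using \<Delta> by simp
qed

lemma I_le_log: "real I \<le> lg\<Delta>"
proof -
  have "(2::nat) ^ I \<le> 4 ^ I" by (intro power_mono) auto
  hence "real (2 ^ I) \<le> real \<Delta>" using four_I_le by (simp only: of_nat_le_iff)
  thus ?thesis using \<Delta> by (simp add: le_log_iff powr_realpow)
qed

text \<open>\<open>10640 = 2 * 32 * 160 + 16 * 25\<close>. The first part belongs to the levels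
  below the last, which exist only for \<open>I \<ge> 1\<close>, when
  \<open>4 ^ I * K < 160 * \<Delta>\<close>; the second part is the last level.\<close>

lemma colors_le:
  "real (I * (AA \<Delta> * (32 * (4 ^ I * K))) + RR n \<Delta> * (2 * (8 * 4 ^ I))) \<le> 10640 * (real \<Delta> * lg\<Delta> ^ 2)"
proof -
  have 1: "real (I * (AA \<Delta> * (32 * (4 ^ I * K)))) \<le> lg\<Delta> * (2 * lg\<Delta> * (32 * (160 * real \<Delta>)))"
  proof (cases "I \<ge> 1")
    case True
    have "real (4 ^ I * K) \<le> real (160 * \<Delta>)" using four_I_less[OF True] by (simp only: of_nat_le_iff)
    hence "real I * (real (AA \<Delta>) * (32 * real (4 ^ I * K))) \<le> lg\<Delta> * (2 * lg\<Delta> * (32 * (160 * real \<Delta>)))"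
      using log_ge_1 by (intro mult_mono I_le_log AA_le_log) auto
    thus ?thesis by simp
  next
    case False
    hence "I = 0" by simp
    thus ?thesis using log_ge_1 by simp
  qed
  have "RR n \<Delta> * 4 ^ I \<le> 25 * \<Delta>"
  proof -
    have four: "(4::nat) ^ I = 2 ^ I * 2 ^ I" by (simp add: power_mult_distrib[symmetric])
    have "(12 * T0 div 2 ^ I) * 2 ^ I \<le> 12 * T0" by simp
    hence "(12 * T0 div 2 ^ I) * 2 ^ I * 2 ^ I \<le> 12 * T0 * 2 ^ I" by (rule mult_le_mono1)
    also have "\<dots> \<le> 12 * (\<Delta> + 2 ^ I)" using mult_le_mono2[OF T0_le, of 12] by (simp only: mult.assoc)
    finally have "(12 * T0 div 2 ^ I) * 4 ^ I \<le> 12 * \<Delta> + 12 * 2 ^ I"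
      unfolding four by (simp only: mult.assoc add_mult_distrib2)
    moreover have "(2::nat) ^ I \<le> 4 ^ I" by (intro power_mono) auto
    ultimately show ?thesis using four_I_le unfolding RR_def add_mult_distrib mult_1 by linarith
  qed
  hence "real (RR n \<Delta> * 4 ^ I) \<le> real (25 * \<Delta>)" by (simp only: of_nat_le_iff)
  hence 2: "real (RR n \<Delta> * (2 * (8 * 4 ^ I))) \<le> 400 * real \<Delta>" by simp
  have "real \<Delta> * 1 \<le> real \<Delta> * lg\<Delta> ^ 2" using log_ge_1 by (intro mult_left_mono) (auto simp: one_le_power)
  thus ?thesis using 1 2 unfolding of_nat_add power2_eq_square by (simp add: algebra_simps)
qed

definition bnd :: real where "bnd = sqrt \<Delta> * lgn powr 2.5 * lg\<Delta> ^ 3"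

lemma bnd_eq: "bnd = sqrt \<Delta> * (lgn ^ 2 * sqrt lgn) * lg\<Delta> ^ 3"
proof -
  have p: "0 < lgn" using log_ge_1(1) by linarith
  have "lgn powr 2.5 = lgn powr (2 + 1/2)" by simp
  also have "\<dots> = lgn powr 2 * lgn powr (1/2)" by (rule powr_add)
  also have "lgn powr (1/2) = sqrt lgn" using p by (intro powr_half_sqrt) (rule less_imp_le)
  also have "lgn powr 2 = lgn ^ 2" using powr_realpow[OF p, of 2] by (simp only: of_nat_numeral)
  finally show ?thesis by (simp only: bnd_def)
qed

lemma bnd_ge:
  assumes "0 \<le> s" "s \<le> sqrt \<Delta>" "0 \<le> x" "x \<le> lgn ^ 2 * sqrt lgn" "k \<le> 3"
  shows "s * x * lg\<Delta> ^ k \<le> bnd"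
proof -
  have D: "lg\<Delta> ^ k \<le> lg\<Delta> ^ 3" "0 \<le> lg\<Delta> ^ k" using assms(5) log_ge_1(2) by (simp_all add: power_increasing)
  have r: "0 \<le> lgn ^ 2 * sqrt lgn" using assms(3,4) by linarith
  have "s * x \<le> sqrt \<Delta> * (lgn ^ 2 * sqrt lgn)" by (rule mult_mono[OF assms(2,4) _ assms(3)]) simp
  moreover have "0 \<le> sqrt \<Delta> * (lgn ^ 2 * sqrt lgn)" by (rule mult_nonneg_nonneg[OF _ r]) simp
  ultimately show ?thesis unfolding bnd_eq using D by - (rule mult_mono)
qed

lemma sqrt_ge_1: "1 \<le> sqrt \<Delta>" "1 \<le> sqrt lgn" using \<Delta> log_ge_1 by simp_all

lemma L_le_bnd: "real L \<le> 3 * bnd"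
proof -
  have "1 * lgn * lg\<Delta> ^ 1 \<le> bnd"
  proof (rule bnd_ge)
    have "lgn * 1 \<le> lgn ^ 2 * sqrt lgn" using log_ge_1 sqrt_ge_1 by (intro mult_mono) (auto simp: power2_eq_square)
    thus "lgn \<le> lgn ^ 2 * sqrt lgn" by simp
  qed (use log_ge_1 sqrt_ge_1 in auto)
  thus ?thesis using L_le_log by simp
qed

lemma bnd_ge_1: "1 \<le> bnd"
proof -
  have "1 * 1 * lg\<Delta> ^ 0 \<le> bnd"
  proof (rule bnd_ge)
    have "1 * 1 \<le> lgn ^ 2 * sqrt lgn" using log_ge_1 sqrt_ge_1 by (intro mult_mono) (auto simp: one_le_power)
    thus "1 \<le> lgn ^ 2 * sqrt lgn" by simp
  qed (use sqrt_ge_1 in auto)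
  thus ?thesis by simp
qed

text \<open>The square of \<open>2 ^ I * K\<close> is \<open>4 ^ I * K\<close> times
  \<open>K\<close>, hence \<Delta> times logarithms; this is where the square roots of \<Delta> and
  of \<open>lgn\<close> arise. The constant is \<open>656100 = 810 ^ 2\<close>.\<close>

lemma KI_le: assumes "I \<ge> 1" shows "real (2 ^ I * K) \<le> 810 * (sqrt \<Delta> * sqrt lgn * lg\<Delta>)"
proof -
  have "real (4 ^ I * K) \<le> real (160 * \<Delta>)" using four_I_less[OF assms] by (simp only: of_nat_le_iff)
  hence "real (4 ^ I * K) * real K \<le> 160 * real \<Delta> * real K" by (intro mult_right_mono) simp_all
  also have "\<dots> = 163840 * real \<Delta> * real L" by (simp add: KK_def)
  also have "\<dots> \<le> 163840 * real \<Delta> * (3 * (lgn * lg\<Delta>))" by (intro mult_left_mono L_le_log) simp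
  also have "\<dots> \<le> 163840 * real \<Delta> * (4 * (lgn * (lg\<Delta> * lg\<Delta>)))"
    using log_ge_1 by (intro mult_left_mono mult_mono) auto
  also have "\<dots> \<le> 656100 * real \<Delta> * (lgn * (lg\<Delta> * lg\<Delta>))"
    using log_ge_1 by simp
  also have "\<dots> = (810 * (sqrt \<Delta> * sqrt lgn * lg\<Delta>))\<^sup>2"
    using log_ge_1 by (simp add: power_mult_distrib power2_eq_square[of lg\<Delta>])
  also have "real (4 ^ I * K) * real K = (real (2 ^ I * K))\<^sup>2"
    by (simp add: power2_eq_square power_mult_distrib[symmetric] mult.left_commute mult.assoc flip: of_nat_mult)
  finally show ?thesis by (rule power2_le_imp_le) (use log_ge_1 in simp)
qed

lemma cap_le: "real ((I + 1) * (2 ^ I * K)) \<le> 25000 * bnd"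
proof (cases "I \<ge> 1")
  case True
  have "real (I + 1) * real (2 ^ I * K) \<le> (2 * lg\<Delta>) * (810 * (sqrt \<Delta> * sqrt lgn * lg\<Delta>))"
    using log_ge_1 I_le_log by (intro mult_mono KI_le True) auto
  also have "\<dots> = 1620 * (sqrt \<Delta> * sqrt lgn * lg\<Delta> ^ 2)" by (simp add: power2_eq_square)
  also have "1620 * (sqrt \<Delta> * sqrt lgn * lg\<Delta> ^ 2) \<le> 1620 * bnd"
  proof (intro mult_left_mono bnd_ge)
    have "1 * sqrt lgn \<le> lgn ^ 2 * sqrt lgn" using log_ge_1 by (intro mult_right_mono) (auto simp: one_le_power)
    thus "sqrt lgn \<le> lgn ^ 2 * sqrt lgn" by simp
  qed (use log_ge_1 in auto)
  finally show ?thesis using bnd_ge_1 by (simp only: of_nat_mult[symmetric])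
next
  case False
  hence "I = 0" by simp
  thus ?thesis using L_le_bnd bnd_ge_1 by (simp add: KK_def)
qed

text \<open>For \<open>I \<ge> 1\<close> the power of \<open>lgn\<close> is 1.5, one from the length
  of an entry and half from \<open>KI_le\<close>. For \<open>I = 0\<close> there is no gain from the
  square root: the at most \<open>K\<close> rows of the last level contribute a full logarithm, and
  the power is 2.\<close>

lemma rows_le: "real (AA \<Delta> * L * (4 * K * (2 ^ I - 1) + RR n \<Delta>)) \<le> 25000 * bnd"
proof (cases "I \<ge> 1")
  case True
  have "4 * K * (2 ^ I - 1) \<le> 4 * K * 2 ^ I" by (intro mult_le_mono2) simp
  moreover have "K * 1 \<le> K * 2 ^ I" by (intro mult_le_mono2) simp
  ultimately have "4 * K * (2 ^ I - 1) + RR n \<Delta> \<le> 5 * (2 ^ I * K)" using RI_le_K by (simp add: algebra_simps)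
  hence "real (4 * K * (2 ^ I - 1) + RR n \<Delta>) \<le> real (5 * (2 ^ I * K))" by (simp only: of_nat_le_iff)
  also have "\<dots> = 5 * real (2 ^ I * K)" by simp
  also have "\<dots> \<le> 5 * (810 * (sqrt \<Delta> * sqrt lgn * lg\<Delta>))" by (intro mult_left_mono KI_le True) simp
  finally have "real (AA \<Delta>) * real L * real (4 * K * (2 ^ I - 1) + RR n \<Delta>) \<le>
     (2 * lg\<Delta>) * (3 * (lgn * lg\<Delta>)) * (5 * (810 * (sqrt \<Delta> * sqrt lgn * lg\<Delta>)))"
    using log_ge_1 by (intro mult_mono AA_le_log L_le_log) auto
  also have "\<dots> = 24300 * (sqrt \<Delta> * (lgn * sqrt lgn) * lg\<Delta> ^ 3)" by (simp add: power3_eq_cube)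
  also have "24300 * (sqrt \<Delta> * (lgn * sqrt lgn) * lg\<Delta> ^ 3) \<le> 24300 * bnd"
    by (intro mult_left_mono bnd_ge) (use log_ge_1 in \<open>auto intro!: mult_right_mono simp: power2_eq_square\<close>)
  finally show ?thesis using bnd_ge_1 by (simp only: of_nat_mult[symmetric])
next
  case False
  have "real (RR n \<Delta>) \<le> 1024 * real L" using RI_le_K by (simp add: KK_def)
  also have "\<dots> \<le> 1024 * (3 * (lgn * lg\<Delta>))" by (intro mult_left_mono L_le_log) simp
  finally have "real (AA \<Delta>) * real L * real (RR n \<Delta>) \<le> (2 * lg\<Delta>) * (3 * (lgn * lg\<Delta>)) * (1024 * (3 * (lgn * lg\<Delta>)))"
    using log_ge_1 by (intro mult_mono AA_le_log L_le_log) auto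
  also have "\<dots> = 18432 * (1 * lgn ^ 2 * lg\<Delta> ^ 3)" by (simp add: power3_eq_cube power2_eq_square)
  also have "18432 * (1 * lgn ^ 2 * lg\<Delta> ^ 3) \<le> 18432 * bnd"
  proof (intro mult_left_mono bnd_ge)
    have "lgn ^ 2 * 1 \<le> lgn ^ 2 * sqrt lgn" using sqrt_ge_1 by (intro mult_left_mono) auto
    thus "lgn ^ 2 \<le> lgn ^ 2 * sqrt lgn" by simp
  qed (use sqrt_ge_1 in auto)
  finally have "real (AA \<Delta>) * real L * real (RR n \<Delta>) \<le> 25000 * bnd" using bnd_ge_1 by simp
  moreover have "I = 0" using False by simp
  ultimately show ?thesis by simp
qed

text \<open>Values of length \<open>V\<close>, of order \<open>GG n \<Delta>\<close>, are paid for
  only \<open>bs + 12\<close> times. The array has many more cells, but each has only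
  \<open>4 * L\<close> bits.\<close>

lemma space_le:
  fixes bs w :: nat
  shows "real (Smax bs (GG n \<Delta> * w + bs) (4 * L) (n + (4 * K * (2 ^ I - 1) + RR n \<Delta>) * AA \<Delta> * 4 * n)) \<le>
     ((bs + 12) * (50000 * w + bs + 1) + 500015) * (n * bnd)"
proof -
  let ?z = "4 * K * (2 ^ I - 1) + RR n \<Delta>"
  have "real (GG n \<Delta>) = 2 * n * real ((I + 1) * (2 ^ I * K))" by (simp add: GG_def algebra_simps)
  also have "\<dots> \<le> 2 * n * (25000 * bnd)" by (intro mult_left_mono cap_le) simp
  finally have G: "real (GG n \<Delta>) \<le> 50000 * (n * bnd)" by simp
  have one: "1 * 1 \<le> n * bnd" using n bnd_ge_1 by (intro mult_mono) auto
  have "real (GG n \<Delta>) * w + (bs + 1) * 1 \<le> 50000 * (n * bnd) * w + (bs + 1) * (n * bnd)"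
    using one by (intro add_mono mult_right_mono mult_left_mono G) auto
  hence V: "real (GG n \<Delta> * w + bs + 1) \<le> (50000 * w + bs + 1) * (n * bnd)" by (simp add: algebra_simps)
  have "(n + ?z * AA \<Delta> * 4 * n) * (4 * L + 1) \<le> (n + ?z * AA \<Delta> * 4 * n) * (5 * L)"
    using L_ge by (intro mult_le_mono2) simp
  also have "\<dots> = n * (5 * L + 20 * (AA \<Delta> * L * ?z))" by (simp add: algebra_simps)
  finally have "real ((n + ?z * AA \<Delta> * 4 * n) * (4 * L + 1)) \<le> real (n * (5 * L + 20 * (AA \<Delta> * L * ?z)))"
    by (simp only: of_nat_le_iff)
  also have "\<dots> = n * (5 * real L + 20 * real (AA \<Delta> * L * ?z))" by simp
  also have "\<dots> \<le> n * (5 * (3 * bnd) + 20 * (25000 * bnd))"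
    by (intro mult_left_mono add_mono L_le_bnd rows_le) auto
  also have "\<dots> = 500015 * (n * bnd)" by simp
  finally have m: "real ((n + ?z * AA \<Delta> * 4 * n) * (4 * L + 1)) \<le> 500015 * (n * bnd)" .
  let ?c = "GG n \<Delta> * w + bs + 1" and ?m = "(n + ?z * AA \<Delta> * 4 * n) * (4 * L + 1)"
  have "Smax bs (GG n \<Delta> * w + bs) (4 * L) (n + ?z * AA \<Delta> * 4 * n) = (bs + 12) * ?c + ?m"
    unfolding Smax_def by (simp only: add_mult_distrib add.assoc add.commute add.left_commute)
  hence "real (Smax bs (GG n \<Delta> * w + bs) (4 * L) (n + ?z * AA \<Delta> * 4 * n)) = real (bs + 12) * real ?c + real ?m"
    by (simp only: of_nat_add of_nat_mult)
  also have "\<dots> \<le> real (bs + 12) * (real (50000 * w + bs + 1) * (n * bnd)) + 500015 * (n * bnd)"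
    by (intro add_mono mult_left_mono V m) simp
  also have "\<dots> = real ((bs + 12) * (50000 * w + bs + 1) + 500015) * (n * bnd)"
    by (simp only: of_nat_add[of _ 500015] of_nat_mult[of "bs + 12"] of_nat_numeral distrib_right[where 'a=real] mult.assoc)
  finally show ?thesis .
qed

end

section \<open>Correctness along a stream\<close>

lemma degree_snoc:
  "degree (es @ [(u, v)]) w = degree es w + of_bool (w \<in> {u, v})"
  by (simp add: degree_def ends_def)

lemma edge_stream_snoc:
  assumes "edge_stream n \<Delta> (es @ [(u, v)])"
  shows "edge_stream n \<Delta> es" "u < n" "v < n" "u \<noteq> v" "degree es u < \<Delta>" "degree es v < \<Delta>"
proof -
  have d: "degree (es @ [(u, v)]) x \<le> \<Delta>" if "x < n" for x using assms that by (simp add: edge_stream_def)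
  show uv: "u < n" "v < n" "u \<noteq> v" using assms by (auto simp: edge_stream_def)
  show "degree es u < \<Delta>" "degree es v < \<Delta>" using d[OF uv(1)] d[OF uv(2)] by (auto simp: degree_snoc)
  have "degree es x \<le> \<Delta>" if "x < n" for x using d[OF that] by (simp add: degree_snoc)
  thus "edge_stream n \<Delta> es" using assms by (simp add: edge_stream_def)
qed

text \<open>This and the next two constants are read off the program text. They do not depend on the
  input, so they affect only the constant factor of the space bound.\<close>

definition cells :: nat where
  "cells = Max (insert 28 ((\<lambda>p. max (Suc (fst p)) (mv (snd p))) ` set (params @ decide)))"
definition base :: nat where
  "base = cells + Max ((\<lambda>p. dep (snd p)) ` set (params @ decide))"
definition wgt :: nat where "wgt = Suc (pks (params @ decide) (\<lambda>_. 1))"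
definition arrive :: prog where
  "arrive = program cells base (params @ decide) writes 27"

lemma cells_ge: "28 \<le> cells"
  unfolding cells_def by (rule Max_ge) auto

lemma wf_arrive:
  assumes "p \<in> set (params @ decide)"
  shows "wf_tm (snd p)" "mv (snd p) \<le> cells" "fst p < cells" "cells + dep (snd p) \<le> base"
proof -
  have "max (Suc (fst p)) (mv (snd p)) \<le> cells"
    unfolding cells_def by (rule Max_ge) (use assms in auto)
  thus "mv (snd p) \<le> cells" "fst p < cells" by auto
  show "cells + dep (snd p) \<le> base"
    unfolding base_def by (intro add_left_mono Max_ge) (use assms in auto)
  have "\<forall>p\<in>set params. wf_tm (snd p)"
    by (simp add: params_def tflog_def tpr_def tmu_def tE_def tM_def tR_def tR0_def th_def tgood_def tgood_in_def)
  moreover have "\<forall>p\<in>set decide. wf_tm (snd p)"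
    by (simp add: decide_def tpr_def tmu_def tE_def tM_def tR_def tBd_def tT_def tep_def tR0_def th_def tOF_def
      tadr_def tmA_def tut_def tuh_def tfr_def trc_def tlv_def tmin_def tmax_def ttl_def thd_def tps_def tlive_def
      tso_def tsl_def Let_def)
  ultimately show "wf_tm (snd p)" using assms by auto
qed

lemma writes_bounds: "\<forall>(i, j)\<in>set writes. i < cells \<and> j < cells"
  using cells_ge by (auto simp: writes_def)

context sizes
begin

section \<open>One arrival, with its space\<close>

interpretation alg: algo n I K T0 "AA \<Delta>" "RR n \<Delta>" "hH I K (HH n \<Delta>)" \<Delta>
  by (rule algo)

lemma hist_init: "hist n I K T0 (AA \<Delta>) (RR n \<Delta>) (hH I K (HH n \<Delta>)) \<Delta> (\<lambda>_. 0) (\<lambda>_ _. {}) (\<lambda>_ _. {}) (\<lambda>_ _ _ _. 0) (\<lambda>_. {})"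
  by unfold_locales auto

abbreviation "W \<equiv> 4 * L"
abbreviation "V \<equiv> GG n \<Delta> * wgt + base"
abbreviation "peak \<equiv> Smax base V W alg.NA"

lemma two_L_le: "x \<le> 9 * L \<Longrightarrow> (2::nat) ^ x \<le> 2 ^ GG n \<Delta>"
proof -
  assume "x \<le> 9 * L"
  also have "9 * L \<le> K" by (simp add: KK_def)
  also have "K \<le> 2 * 2 ^ I * K" using mult_le_mono1[of 1 "2 * 2 ^ I" K] by simp
  also have "\<dots> \<le> GG n \<Delta>" using cbase.cap_R[OF cbase] .
  finally show ?thesis by (intro power_increasing) auto
qed

lemma W_le_GG: "W \<le> GG n \<Delta>"
proof -
  have "W \<le> K" by (simp add: KK_def)
  also have "K \<le> 2 * 2 ^ I * K" using mult_le_mono1[of 1 "2 * 2 ^ I" K] by simp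
  also have "\<dots> \<le> GG n \<Delta>" using cbase.cap_R[OF cbase] .
  finally show ?thesis .
qed

lemma AA_le_L: "AA \<Delta> \<le> L"
  unfolding AA_def LL_def by (rule floorlog_mono) (use n in simp)

lemma OF_I_le: "alg.OF I + RR n \<Delta> \<le> 5 * (K * 2 ^ I)"
proof -
  have "K * 1 \<le> K * 2 ^ I" by (intro mult_le_mono2) simp
  moreover have "alg.OF I \<le> 4 * K * 2 ^ I" unfolding alg.OF_def by (intro mult_le_mono2) simp
  ultimately show ?thesis using RI_le_K unfolding mult_1_right mult.assoc by linarith
qed

lemma NA_le: "alg.NA \<le> n * (1 + 20 * (L * (K * 2 ^ I)))"
proof -
  have "(alg.OF I + RR n \<Delta>) * AA \<Delta> \<le> 5 * (K * 2 ^ I) * L"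
    by (rule mult_le_mono[OF OF_I_le AA_le_L])
  hence "(alg.OF I + RR n \<Delta>) * AA \<Delta> * 4 * n \<le> 5 * (K * 2 ^ I) * L * 4 * n"
    by (intro mult_le_mono1)
  thus ?thesis by (simp add: alg.NA_def algebra_simps)
qed

lemma NA_lt: "alg.NA < 2 ^ GG n \<Delta>"
proof -
  have l: "L < 2 ^ L" by (rule less_exp)
  have aux: "1 + 20 * x \<le> 2 ^ 5 * y" if "x \<le> y" "1 \<le> y" for x y :: nat using that by simp
  have "K \<le> 2 ^ 10 * 2 ^ L" unfolding KK_def using l by (intro mult_le_mono) simp_all
  moreover have "(2::nat) ^ I \<le> 2 ^ L" using I_le_L by (rule power_increasing) simp
  ultimately have "K * 2 ^ I \<le> 2 ^ 10 * 2 ^ L * 2 ^ L" by (rule mult_le_mono)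
  hence "L * (K * 2 ^ I) \<le> 2 ^ L * (2 ^ 10 * 2 ^ L * 2 ^ L)" by (rule mult_le_mono[OF less_imp_le[OF l]])
  moreover have "1 \<le> 2 ^ L * (2 ^ 10 * 2 ^ L * 2 ^ L :: nat)" by simp
  ultimately have "1 + 20 * (L * (K * 2 ^ I)) \<le> 2 ^ 5 * (2 ^ L * (2 ^ 10 * 2 ^ L * 2 ^ L))"
    by (rule aux)
  hence "n * (1 + 20 * (L * (K * 2 ^ I))) < 2 ^ L * (2 ^ 5 * (2 ^ L * (2 ^ 10 * 2 ^ L * 2 ^ L)))"
    by (intro mult_less_le_imp_less n_lt) auto
  also have "\<dots> = 2 ^ (L + (5 + (L + (10 + L + L))))" by (simp only: power_add)
  also have "\<dots> \<le> 2 ^ GG n \<Delta>" using L_ge by (intro two_L_le) simp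
  finally show ?thesis using NA_le by simp
qed

text \<open>Array entries are vertices, degrees, successors of epochs, or color counts; the last
  dominate with \<open>B I = 8 * 4 ^ I\<close>, which fits since \<open>I \<le> L\<close>.\<close>

lemma bound_lt: "x \<le> n + \<Delta> + alg.B I + 2 \<Longrightarrow> x < 2 ^ W"
proof -
  assume x: "x \<le> n + \<Delta> + alg.B I + 2"
  have "(4::nat) ^ I \<le> 4 ^ L" using I_le_L by (intro power_increasing) auto
  moreover have "(2::nat) ^ L \<le> 4 ^ L" by (intro power_mono) auto
  moreover have "(1::nat) \<le> 4 ^ L" by simp
  ultimately have "x < 16 * 4 ^ L" using x n_lt \<Delta>_lt unfolding alg.B_def by linarith
  also have "\<dots> = 2 ^ (4 + 2 * L)" by (simp add: power_add power_mult)
  also have "\<dots> \<le> 2 ^ W" using L_ge by (intro power_increasing) auto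
  finally show ?thesis .
qed

text \<open>The invariant \<open>hist\<close> bounds the old entries as well as the values to be
  written, so the same peak is valid for every arrival.\<close>

lemma arrival:
  assumes h: "hist n I K T0 (AA \<Delta>) (RR n \<Delta>) (hH I K (HH n \<Delta>)) \<Delta> a VS AL cn col"
    and uv: "u < n" "v < n" "u \<noteq> v" and d: "a u < \<Delta>" "a v < \<Delta>"
    and r: "mrep base V alg.NA a f \<mu>"
  obtains t s \<mu>' f' where "exec ([n, \<Delta>, u, v], z) arrive \<mu> t s [alg.color (alg.tup a u v)] \<mu>'"
    "s \<le> peak" "mrep base V alg.NA (alg.nxt a u v) f' \<mu>'"
proof -
  let ?q = "[n, \<Delta>, u, v]" and ?G = "GG n \<Delta>"
  have q: "lookup ?q 0 = n" "lookup ?q 1 = \<Delta>" "lookup ?q 2 = u" "lookup ?q 3 = v"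
    by (simp_all add: lookup_def)
  interpret hist n I K T0 "AA \<Delta>" "RR n \<Delta>" "hH I K (HH n \<Delta>)" \<Delta> a VS AL cn col by (rule h)
  interpret step n I K T0 "AA \<Delta>" "RR n \<Delta>" "hH I K (HH n \<Delta>)" \<Delta> a VS AL cn col u v
    by unfold_locales (use uv d in auto)
  interpret cb: cbase n I K ?G ?q a by (rule cbase)
  interpret cd: code n I K T0 "AA \<Delta>" "RR n \<Delta>" \<Delta> "HH n \<Delta>" ?G ?q a u v
    by unfold_locales (use RI_le uv in auto)
  define s1 where "s1 = evs ?q a params (\<lambda>_. 0)"
  have ok: "cd.ok s1"
    using ev_params(1)[OF q, of a] by (simp add: cd.ok_def cb.okb_def s1_def)
  note dec = cd.ev_decide[OF ok J(2) r0]
  let ?s = "evs ?q a (params @ decide) (\<lambda>_. 0)"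
  have s: "?s = evs ?q a decide s1" by (simp add: evs_append s1_def)
  have a_lt: "a i < 2 ^ W" for i using a_le[of i] by (intro bound_lt) simp
  have BJ: "alg.B J \<le> alg.B I" by (rule B_mono[OF J(2)])
  have ep: "alg.ep a j w \<le> n + \<Delta> + alg.B I + 1" for j w
    using a_le[of w] div_le_dividend[of "a w" "alg.T j"] by (simp add: alg.ep_def del: div_le_dividend)
  have adr: "alg.adr f J l0 w r0 < alg.NA" if "f < 4" "w < n" for f w
    by (rule alg.adr_lt[OF that(1) l0(1) that(2) r0 J(2)])
  have nNA: "n \<le> alg.NA" by (simp add: alg.NA_def)
  have xy': "alg.xs a u v < n" "alg.ys a u v < n" using xy(1,2) by (simp_all add: xs ys)
  have q_lt: "lookup ?q i < 2 ^ ?G" for i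
  proof -
    have "lookup ?q i \<le> max n \<Delta>"
      using uv by (auto simp: lookup_def nth_Cons split: nat.split)
    also have "\<dots> < 2 ^ L" using n_lt \<Delta>_lt by simp
    also have "\<dots> \<le> 2 ^ ?G" by (rule two_L_le) simp
    finally show ?thesis .
  qed
  have caps: "caps_le ?G ?q a (params @ decide) (\<lambda>_. 0)"
    using ev_params(2)[OF q, of a] dec(15) by (simp add: caps_le_append s1_def)
  have put: "\<forall>(i, j)\<in>set writes. ?s i < alg.NA \<and> ?s j < 2 ^ W"
  proof -
    have "?s 18 < alg.NA" "?s 20 < alg.NA" "?s 22 < alg.NA" "?s 23 < alg.NA"
      using dec(6,8,10,11) xy' adr unfolding s by simp_all
    moreover have "?s 3 < alg.NA" "?s 4 < alg.NA"
      using dec(3,4) uv nNA unfolding s by simp_all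
    moreover have "?s 19 < 2 ^ W"
      unfolding s dec(7) using ep by (intro bound_lt) simp
    moreover have "?s 21 < 2 ^ W"
      unfolding s dec(9) using ep by (intro bound_lt) simp
    moreover have "?s 13 < 2 ^ W"
      unfolding s dec(5) using xy'(2) by (intro bound_lt) simp
    moreover have "?s 24 < 2 ^ W"
      unfolding s dec(12) using b0_less BJ by (intro bound_lt) simp
    moreover have "?s 25 < 2 ^ W" "?s 26 < 2 ^ W"
      unfolding s dec(13,14) using d by (intro bound_lt; simp)+
    ultimately show ?thesis by (simp add: writes_def)
  qed
  have "\<exists>\<mu>' f'. runs (?q, z) (program cells base (params @ decide) writes 27) \<mu> (Smax base V W alg.NA) [?s 27] \<mu>' \<and>
    mrep base V alg.NA (put_all ?s writes a) f' \<mu>' \<and> (\<forall>i. put_all ?s writes a i < 2 ^ W)"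
  proof (rule program_runs)
    show "\<forall>p\<in>set (params @ decide). wf_tm (snd p) \<and> mv (snd p) \<le> cells \<and> fst p < cells \<and> cells + dep (snd p) \<le> base"
      using wf_arrive by blast
    show "27 < cells" using cells_ge by simp
    show "cells \<le> base" by (simp add: base_def)
    show "1 \<le> ?G" using W_le_GG L_ge by simp
  qed (fact writes_bounds q_lt W_le_GG a_lt NA_lt caps put r | simp add: wgt_def)+
  thus ?thesis using that unfolding runs_def arrive_def[symmetric] s dec(1,2) by blast
qed

text \<open>At the last level only phase 0 occurs. At all earlier levels rows, residues and bundle
  positions multiply to \<open>32 * 4 ^ I * K\<close>: with each level the numbers of rows and
  residues halve and the bundles grow fourfold.\<close>

definition palette :: "(nat \<times> nat \<times> nat \<times> nat \<times> nat) set" where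
  "palette = (SIGMA j:{..I}. {..<if j < I then AA \<Delta> else 1} \<times> {..<alg.R j} \<times> {..<alg.M j} \<times> {..<alg.B j})"

definition colors :: nat where
  "colors = I * (AA \<Delta> * (32 * (4 ^ I * K))) + RR n \<Delta> * (2 * (8 * 4 ^ I))"

lemma finite_palette: "finite palette"
  unfolding palette_def by (intro finite_SigmaI) auto

lemma card_palette: "card palette = colors"
proof -
  have "card palette = (\<Sum>j\<le>I. (if j < I then AA \<Delta> else 1) * (alg.R j * (alg.M j * alg.B j)))"
    unfolding palette_def by (subst card_SigmaI) (auto simp: card_cartesian_product intro!: sum.cong)
  also have "\<dots> = (\<Sum>j<I. AA \<Delta> * (alg.R j * (alg.M j * alg.B j))) + alg.R I * (alg.M I * alg.B I)"
    by (simp add: lessThan_Suc_atMost[symmetric])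
  also have "(\<Sum>j<I. AA \<Delta> * (alg.R j * (alg.M j * alg.B j))) = (\<Sum>j<I. AA \<Delta> * (32 * (4 ^ I * K)))"
  proof (rule sum.cong[OF refl])
    fix j assume "j \<in> {..<I}"
    hence j: "j < I" by simp
    have "(4::nat) ^ I = 4 ^ (I - j) * 4 ^ j" using j by (simp add: power_add[symmetric])
    also have "(4::nat) ^ (I - j) = 2 ^ (I - j) * 2 ^ (I - j)" by (simp add: power_mult_distrib[symmetric])
    finally show "AA \<Delta> * (alg.R j * (alg.M j * alg.B j)) = AA \<Delta> * (32 * (4 ^ I * K))"
      using j by (simp add: alg.R_def alg.M_def alg.B_def epochs_def)
  qed
  finally show ?thesis by (simp add: colors_def alg.R_def alg.M_def alg.B_def epochs_def)
qed

text \<open>The history lives in the proof only: it is existentially quantified, and each arrival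
  extends it, while the memory keeps nothing but the array. Colors are handled as tuples, since
  \<open>color\<close> is injective.\<close>

lemma run:
  assumes "edge_stream n \<Delta> es"
  shows "\<exists>ts \<mu> s a VS AL cn col f. online_run (Skip, arrive) n \<Delta> z es (map alg.color ts) \<mu> s \<and> s \<le> peak \<and>
    mrep base V alg.NA a f \<mu> \<and>
    hist n I K T0 (AA \<Delta>) (RR n \<Delta>) (hH I K (HH n \<Delta>)) \<Delta> a VS AL cn col \<and> (\<forall>w<n. a w = degree es w) \<and>
    length ts = length es \<and> set ts \<subseteq> palette \<and> (\<forall>i<length es. \<forall>w\<in>ends (es ! i). ts ! i \<in> col w) \<and>
    (\<forall>i j. i < j \<and> j < length es \<and> ends (es ! i) \<inter> ends (es ! j) \<noteq> {} \<longrightarrow> ts ! i \<noteq> ts ! j)"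
  using assms
proof (induction es rule: rev_induct)
  case Nil
  have "exec ([n, \<Delta>], z) Skip [] 1 (footprint []) [] []" by (rule exec.Skip)
  hence "online_run (Skip, arrive) n \<Delta> z [] (map alg.color []) [] 0"
    by (simp add: footprint_def online_run.Start)
  \<comment> \<open>The empty memory represents the zero array, in which no row is in use; hence
    \<open>Skip\<close> as initialization.\<close>
  moreover have "mrep base V alg.NA (\<lambda>_. 0) (\<lambda>_. 0) []" by (simp add: mrep_def lookup_def)
  moreover have "\<forall>w<n. (\<lambda>_. 0) w = degree [] w" by (simp add: degree_def)
  ultimately show ?case using hist_init by (intro exI conjI) (assumption | simp)+
next
  case (snoc e es)
  obtain u v where e: "e = (u, v)" by (cases e)
  note es = edge_stream_snoc[OF snoc.prems[unfolded e]]
  from snoc.IH[OF es(1)] obtain ts \<mu> s a VS AL cn col f where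
    run: "online_run (Skip, arrive) n \<Delta> z es (map alg.color ts) \<mu> s" "s \<le> peak" and
    mem: "mrep base V alg.NA a f \<mu>" and
    h: "hist n I K T0 (AA \<Delta>) (RR n \<Delta>) (hH I K (HH n \<Delta>)) \<Delta> a VS AL cn col" and
    deg: "\<forall>w<n. a w = degree es w" and
    ts: "length ts = length es" "set ts \<subseteq> palette" "\<forall>i<length es. \<forall>w\<in>ends (es ! i). ts ! i \<in> col w"
     "\<forall>i j. i < j \<and> j < length es \<and> ends (es ! i) \<inter> ends (es ! j) \<noteq> {} \<longrightarrow> ts ! i \<noteq> ts ! j"
    by (elim exE conjE) (rule that; assumption)
  have d: "a u < \<Delta>" "a v < \<Delta>" using deg es by auto
  interpret hist n I K T0 "AA \<Delta>" "RR n \<Delta>" "hH I K (HH n \<Delta>)" \<Delta> a VS AL cn col by (rule h)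
  interpret step n I K T0 "AA \<Delta>" "RR n \<Delta>" "hH I K (HH n \<Delta>)" \<Delta> a VS AL cn col u v
    by unfold_locales (use es d in auto)
  let ?t = "alg.tup a u v"
  obtain t s' \<mu>' f' where ar: "exec ([n, \<Delta>, u, v], z) arrive \<mu> t s' [alg.color ?t] \<mu>'"
    "s' \<le> peak" "mrep base V alg.NA (alg.nxt a u v) f' \<mu>'"
    by (rule arrival[OF h es(2-4) d mem])
  have "online_run (Skip, arrive) n \<Delta> z (es @ [(u, v)]) (map alg.color ts @ [alg.color ?t]) \<mu>' (max s s')"
    by (rule online_run.Arrival[OF run(1)]) (use ar(1) in simp)
  hence r: "online_run (Skip, arrive) n \<Delta> z (es @ [e]) (map alg.color (ts @ [?t])) \<mu>' (max s s')"
    by (simp add: e)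
  have deg': "\<forall>w<n. alg.nxt a u v w = degree (es @ [e]) w"
    using deg es(4) by (simp add: a'_v e degree_snoc)
  have M: "x mod alg.M J < alg.M J" for x by (simp add: alg.M_def epochs_def)
  have "?t \<in> palette"
    using J(2) l0(1) l0_I r0 b0_less M by (auto simp: palette_def tup)
  hence pal: "set (ts @ [?t]) \<subseteq> palette" using ts(2) by simp
  have ends_e: "ends e = {u, v}" by (simp add: e ends_def)
  have in_col: "\<forall>i<length (es @ [e]). \<forall>w\<in>ends ((es @ [e]) ! i). (ts @ [?t]) ! i \<in> col' w"
    using ts(1,3) by (auto simp: nth_append col'_def ends_e less_Suc_eq)
  have dist: "\<forall>i j. i < j \<and> j < length (es @ [e]) \<and> ends ((es @ [e]) ! i) \<inter> ends ((es @ [e]) ! j) \<noteq> {} \<longrightarrow>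
     (ts @ [?t]) ! i \<noteq> (ts @ [?t]) ! j"
  proof (intro allI impI)
    fix i j assume ij: "i < j \<and> j < length (es @ [e]) \<and> ends ((es @ [e]) ! i) \<inter> ends ((es @ [e]) ! j) \<noteq> {}"
    show "(ts @ [?t]) ! i \<noteq> (ts @ [?t]) ! j"
    proof (cases "j < length es")
      case True
      hence i: "i < length es" using ij by simp
      have n: "(es @ [e]) ! k = es ! k" "(ts @ [?t]) ! k = ts ! k" if "k < length es" for k
        using that ts(1) by (simp_all add: nth_append)
      show ?thesis using ij ts(4) True unfolding n[OF i] n[OF True] by blast
    next
      case False
      hence j: "j = length es" "i < length es" using ij by auto
      then obtain w where w: "w \<in> ends (es ! i)" "w \<in> {u, v}" using ij ends_e by (auto simp: nth_append)
      have "ts ! i \<in> col w" using ts(3) j(2) w(1) by blast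
      moreover have "?t \<notin> col w" by (rule tup_new[OF w(2)])
      ultimately show ?thesis using j ts(1) by (auto simp: nth_append)
    qed
  qed
  show ?case
    by (intro exI conjI, rule r, use run(2) ar(2) in simp, rule ar(3), rule new_hist, rule deg',
      use ts(1) in simp, rule pal, rule in_col, rule dist)
qed

lemma space_ok: "runs_in_space (Skip, arrive) n \<Delta> z peak"
  unfolding runs_in_space_def using run[of _ z] by blast

lemma coloring_ok: "edge_stream n \<Delta> es \<Longrightarrow> colors_stream (Skip, arrive) n \<Delta> z colors es"
proof -
  assume "edge_stream n \<Delta> es"
  from run[OF this, of z] obtain ts \<mu> s where ts: "online_run (Skip, arrive) n \<Delta> z es (map alg.color ts) \<mu> s"
    "length ts = length es" "set ts \<subseteq> palette"
    "\<forall>i j. i < j \<and> j < length es \<and> ends (es ! i) \<inter> ends (es ! j) \<noteq> {} \<longrightarrow> ts ! i \<noteq> ts ! j"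
    by (elim exE conjE) (rule that; assumption)
  have "card (set (map alg.color ts)) \<le> card (set ts)" by (simp add: card_image_le)
  also have "\<dots> \<le> colors" unfolding card_palette[symmetric] by (rule card_mono[OF finite_palette ts(3)])
  finally have "edge_coloring colors es (map alg.color ts)"
    using ts(2,4) unfolding edge_coloring_def by (auto simp: alg.color_inject)
  thus ?thesis using ts(1) unfolding colors_stream_def by blast
qed

definition space_bound :: nat where "space_bound = peak"

lemma space_bound_eq: "space_bound = Smax base V W (n + (4 * K * (2 ^ I - 1) + RR n \<Delta>) * AA \<Delta> * 4 * n)"
  by (simp add: space_bound_def alg.NA_def alg.OF_def)

end

lemma (in sizes) good: "good_advice (Skip, arrive) n \<Delta> colors z"
  unfolding good_advice_def using coloring_ok by blast

text \<open>Every stream is colored correctly under every advice string, so an adaptive choice of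
  the stream gains nothing and the success event is everything.\<close>

lemma (in sizes) always_robust: "0 \<le> \<delta> \<Longrightarrow> robust (Skip, arrive) n \<Delta> colors k \<delta>"
proof -
  assume "0 \<le> \<delta>"
  moreover have "{z. succeeds_against (Skip, arrive) n \<Delta> colors \<A> z} = UNIV" for \<A>
    unfolding succeeds_against_def using coloring_ok by blast
  ultimately show ?thesis by (simp add: robust_def)
qed

theorem theorem4p8:
  fixes d :: nat
  shows "\<exists>(A :: algorithm) (verify :: prog) (compute :: prog)
      (k :: nat \<Rightarrow> nat \<Rightarrow> nat) (S :: nat \<Rightarrow> nat \<Rightarrow> nat) (a :: nat \<Rightarrow> nat \<Rightarrow> nat) (C :: real) (q :: nat) (r :: nat).
    \<forall>n\<ge>2. \<forall>\<Delta>\<ge>2.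
      real (k n \<Delta>) \<le> C * (real \<Delta> * log 2 \<Delta> ^ 2) \<and>
      real (S n \<Delta>) \<le> C * (real n * sqrt \<Delta> * log 2 n powr 2.5 * log 2 \<Delta> ^ 3) \<and>
      real (a n \<Delta>) \<le> C * (real n * sqrt \<Delta> * log 2 (real n * real \<Delta>) ^ q) \<and>
      (\<forall>z. length z = a n \<Delta> \<longrightarrow> runs_in_space A n \<Delta> z (S n \<Delta>)) \<and>
      (\<exists>z. length z = a n \<Delta> \<and> good_advice A n \<Delta> (k n \<Delta>) z) \<and>
      robust A n \<Delta> (k n \<Delta>) (a n \<Delta>) (1 / real n ^ d) \<and>
      (\<forall>z. length z = a n \<Delta> \<longrightarrow>
         computes_within verify ([n, \<Delta>], z) (2 ^ ((n + \<Delta>) ^ r))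
           [of_bool (good_advice A n \<Delta> (k n \<Delta>) z)]) \<and>
      (\<exists>z. length z = a n \<Delta> \<and> good_advice A n \<Delta> (k n \<Delta>) z \<and>
         computes_within compute ([n, \<Delta>], []) (2 ^ ((n + \<Delta>) ^ r)) (map of_bool z))"
proof -
  \<comment> \<open>This is the constant of \<open>space_le\<close>, with the constants of the
    program inserted; 10640 is that of \<open>colors_le\<close>.\<close>
  define c :: nat where "c = (base + 12) * (50000 * wgt + base + 1) + 500015"
  define C :: real where "C = 10640 + real c"
  show ?thesis
  proof (intro exI allI impI)
    fix n \<Delta> :: nat
    assume "2 \<le> n" "2 \<le> \<Delta>"
    then interpret sizes n \<Delta> by unfold_locales
    have C: "10640 \<le> C" "real c \<le> C" by (simp_all add: C_def)
    have "real colors \<le> 10640 * (real \<Delta> * log 2 \<Delta> ^ 2)" unfolding colors_def by (rule colors_le)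
    also have "\<dots> \<le> C * (real \<Delta> * log 2 \<Delta> ^ 2)" by (intro mult_right_mono C) simp
    finally have k: "real colors \<le> C * (real \<Delta> * log 2 \<Delta> ^ 2)" .
    have "real space_bound \<le> real c * (real n * bnd)" unfolding space_bound_eq c_def by (rule space_le)
    also have "\<dots> \<le> C * (real n * bnd)" using bnd_ge_1 by (intro mult_right_mono C) simp
    finally have S: "real space_bound \<le> C * (real n * sqrt \<Delta> * log 2 n powr 2.5 * log 2 \<Delta> ^ 3)"
      by (simp only: bnd_def mult.assoc)
    \<comment> \<open>The verifier always answers 1, which takes time
      \<open>1 + bits 1 = 3\<close>.\<close>
    have t: "3 \<le> (2::nat) ^ ((n + \<Delta>) ^ 1)"
      using n \<Delta> power_increasing[of 2 "n + \<Delta>" "2::nat"] by simp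
    have "exec ([n, \<Delta>], z) (Emit (Const 1)) [] (1 + cost ([n, \<Delta>], z) [] (Const 1))
        (footprint [] + cost ([n, \<Delta>], z) [] (Const 1)) [1] []" for z
      using exec.Emit[of _ "([n, \<Delta>], z)" "[]" "Const 1"] by simp
    moreover have "1 + cost ([n, \<Delta>], z) [] (Const 1) \<le> 2 ^ ((n + \<Delta>) ^ 1)" for z
      using t by (simp add: floorlog_eq_zero_iff compute_floorlog)
    ultimately have v: "computes_within (Emit (Const 1)) ([n, \<Delta>], z) (2 ^ ((n + \<Delta>) ^ 1))
        [of_bool (good_advice (Skip, arrive) n \<Delta> colors z)]" for z
      using good[of z] unfolding computes_within_def by auto
    have s: "computes_within Skip ([n, \<Delta>], []) (2 ^ ((n + \<Delta>) ^ 1)) (map of_bool [])"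
      unfolding computes_within_def list.map
      by (intro exI conjI, rule exec.Skip) (use t in linarith)
    show "real colors \<le> C * (real \<Delta> * log 2 \<Delta> ^ 2) \<and>
      real space_bound \<le> C * (real n * sqrt \<Delta> * log 2 n powr 2.5 * log 2 \<Delta> ^ 3) \<and>
      real 0 \<le> C * (real n * sqrt \<Delta> * log 2 (real n * real \<Delta>) ^ 0) \<and>
      (\<forall>z. length z = 0 \<longrightarrow> runs_in_space (Skip, arrive) n \<Delta> z space_bound) \<and>
      (\<exists>z. length z = 0 \<and> good_advice (Skip, arrive) n \<Delta> colors z) \<and>
      robust (Skip, arrive) n \<Delta> colors 0 (1 / real n ^ d) \<and>
      (\<forall>z. length z = 0 \<longrightarrow> computes_within (Emit (Const 1)) ([n, \<Delta>], z) (2 ^ ((n + \<Delta>) ^ 1))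
         [of_bool (good_advice (Skip, arrive) n \<Delta> colors z)]) \<and>
      (\<exists>z. length z = 0 \<and> good_advice (Skip, arrive) n \<Delta> colors z \<and>
         computes_within Skip ([n, \<Delta>], []) (2 ^ ((n + \<Delta>) ^ 1)) (map of_bool z))"
    proof (intro conjI)
      show "real 0 \<le> C * (real n * sqrt \<Delta> * log 2 (real n * real \<Delta>) ^ 0)" by (simp add: C_def)
      show "\<exists>z. length z = 0 \<and> good_advice (Skip, arrive) n \<Delta> colors z \<and>
         computes_within Skip ([n, \<Delta>], []) (2 ^ ((n + \<Delta>) ^ 1)) (map of_bool z)"
        using good s by (intro exI[of _ "[]"]) simp
      show "robust (Skip, arrive) n \<Delta> colors 0 (1 / real n ^ d)" by (rule always_robust) simp
    qed (use k S v good space_ok[folded space_bound_def] in auto)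
  qed
qed

end
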